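(* Let $\Gamma$ be a subgroup of $\mathrm{SL}_2(\mathbb{Z})$ which is Zariski dense in $\mathrm{SL}_2$ and which contains a parabolic element (a unipotent element other than $\pm I$), so that $\Gamma\backslash\mathbb{H}$ is a punctured, Zariski dense cover of the modular surface. Then $\Gamma$ is asymptotically length-saturating. In fact, there exists $\varepsilon>0$ such that $$\frac{\#\big(\mathcal{T}(\Gamma)\cap[-N,N]\big)}{\#\{t\in\mathbb{Z}\cap[-N,N]\ :\ t\text{ is admissible}\}} \;=\; 1+O(N^{-\varepsilon})\qquad (N\to\infty).$$
   Context: The trace set $\mathcal{T}(\Gamma)$ is the set (without multiplicity) of traces of hyperbolic elements of $\Gamma$ (equivalently of hyperbolic conjugacy classes), i.e. of lengths of closed geodesics on $\Gamma\backslash\mathbb{H}$ via trace. The trace field is $\mathbb{Q}$ with ring of integers $\mathbb{Z}$. An integer $t$ is admissible if for every integer $q\ge1$ there is an element of $\mathcal{T}(\Gamma)$ congruent to $t$ modulo $q$. A group $\Gamma$ is asymptotically length-saturating if the ratio displayed in the claim (the number of traces in the ball of radius $N$ divided by the number of admissible integers in that ball) tends to $1$ as $N\to\infty$. *)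

theory Defs
  imports
    "HOL-Analysis.Analysis"
    "HOL-Algebra.Group"
    "HOL-Number_Theory.Cong"
    "HOL-Library.Landau_Symbols"
begin

definition SL2 :: "('a::comm_ring_1 ^ 2 ^ 2) monoid" where
  "SL2 = \<lparr>carrier = {A. det A = 1}, monoid.mult = (**), one = mat 1\<rparr>"

lemma group_SL2: "group (SL2 :: ('a::comm_ring_1 ^ 2 ^ 2) monoid)"
proof (rule groupI)
  fix A :: "'a ^ 2 ^ 2" assume "A \<in> carrier SL2"
  then have d: "det A = 1" by (simp add: SL2_def)
  define B :: "'a ^ 2 ^ 2" where
    "B = (\<chi> i j. if i = 1 then (if j = 1 then A$2$2 else - A$1$2)
                  else (if j = 1 then - A$2$1 else A$1$1))"
  have "det B = 1" "B ** A = mat 1"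
    using d by (simp_all add: B_def det_2 vec_eq_iff forall_2 sum_2
        matrix_matrix_mult_def mat_def algebra_simps)
  then show "\<exists>B\<in>carrier SL2. B \<otimes>\<^bsub>SL2\<^esub> A = \<one>\<^bsub>SL2\<^esub>"
    by (auto simp: SL2_def)
qed (auto simp: SL2_def det_mul matrix_mul_assoc)

inductive matrix_polynomial :: "(complex ^ 2 ^ 2 \<Rightarrow> complex) \<Rightarrow> bool" where
  entry: "matrix_polynomial (\<lambda>A. A $ i $ j)"
| const: "matrix_polynomial (\<lambda>A. c)"
| add: "\<lbrakk>matrix_polynomial f; matrix_polynomial g\<rbrakk> \<Longrightarrow> matrix_polynomial (\<lambda>A. f A + g A)"
| mult: "\<lbrakk>matrix_polynomial f; matrix_polynomial g\<rbrakk> \<Longrightarrow> matrix_polynomial (\<lambda>A. f A * g A)"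

definition zariski_closed :: "(complex ^ 2 ^ 2) set \<Rightarrow> bool" where
  "zariski_closed Z \<longleftrightarrow>
     (\<exists>P. (\<forall>f\<in>P. matrix_polynomial f) \<and> Z = {A. \<forall>f\<in>P. f A = 0})"

definition zariski_closure :: "(complex ^ 2 ^ 2) set \<Rightarrow> (complex ^ 2 ^ 2) set" where
  "zariski_closure S = \<Inter>{Z. zariski_closed Z \<and> S \<subseteq> Z}"

definition zariski_dense_SL2 :: "(int ^ 2 ^ 2) set \<Rightarrow> bool" where
  "zariski_dense_SL2 \<Gamma> \<longleftrightarrow> zariski_closure (map_matrix of_int ` \<Gamma>) = carrier SL2"

text \<open>Matrix powers are written as iterated \<open>**\<close>, because \<open>*\<close> and \<open>^\<close> act entrywise on vectors.\<close>

definition unipotent :: "int ^ 2 ^ 2 \<Rightarrow> bool" where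
  "unipotent A \<longleftrightarrow> (\<exists>k::nat. (((**) (A - mat 1)) ^^ k) (mat 1) = 0)"

definition parabolic :: "int ^ 2 ^ 2 \<Rightarrow> bool" where
  "parabolic A \<longleftrightarrow> unipotent A \<and> A \<noteq> mat 1 \<and> A \<noteq> - mat 1"

definition hyperbolic :: "int ^ 2 ^ 2 \<Rightarrow> bool" where
  "hyperbolic A \<longleftrightarrow> \<bar>trace A\<bar> > 2"

definition trace_set :: "(int ^ 2 ^ 2) set \<Rightarrow> int set" where
  "trace_set \<Gamma> = trace ` {A \<in> \<Gamma>. hyperbolic A}"

definition admissible :: "(int ^ 2 ^ 2) set \<Rightarrow> int \<Rightarrow> bool" where
  "admissible \<Gamma> t \<longleftrightarrow> (\<forall>q::int. q \<ge> 1 \<longrightarrow> (\<exists>s\<in>trace_set \<Gamma>. [s = t] (mod q)))"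

definition saturation_ratio :: "(int ^ 2 ^ 2) set \<Rightarrow> real \<Rightarrow> real" where
  "saturation_ratio \<Gamma> N =
     real (card {t \<in> trace_set \<Gamma>. real_of_int t \<in> {-N..N}}) /
     real (card {t. real_of_int t \<in> {-N..N} \<and> admissible \<Gamma> t})"

definition asymptotically_length_saturating :: "(int ^ 2 ^ 2) set \<Rightarrow> bool" where
  "asymptotically_length_saturating \<Gamma> \<longleftrightarrow> (saturation_ratio \<Gamma> \<longlongrightarrow> 1) at_top"

end

theory Submission
  imports Defs "HOL-Number_Theory.Totient" "HOL-Computational_Algebra.Squarefree"
begin

text \<open>
  After conjugation \<open>\<Gamma>\<close> contains \<open>U = (1 w; 0 1)\<close> and, by Zariski density, a second parabolic \<open>V\<close>
  fixing another cusp. Writing \<open>c(\<gamma>)\<close> for the lower left entry, \<open>tr (U\<^sup>m \<gamma>) = tr \<gamma> + m w c(\<gamma>)\<close>, so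
  every \<open>\<gamma> \<in> \<Gamma>\<close> contributes a whole residue class modulo \<open>w c(\<gamma>)\<close> to the trace set. The classes
  used are those of \<open>\<gamma>\<^sub>1 U\<^sup>n V\<close>, for which membership of \<open>t\<close> becomes \<open>x dvd c\<^sub>1 c\<^sub>2 t + c\<^sub>1\<^sup>2 + c\<^sub>2\<^sup>2\<close>
  with \<open>c\<^sub>1 = c(\<gamma>\<^sub>1)\<close>, \<open>c\<^sub>2 = c(V)\<close> and \<open>x = c(\<gamma>\<^sub>1 U\<^sup>n V)\<close> linear in \<open>n\<close>. The integers \<open>t\<close> missed
  by all of these classes are counted by a second moment. Pairs with different \<open>c\<^sub>1\<close> are compatible
  only modulo divisors of a fixed nonzero integer \<open>E\<close>; weighting \<open>x\<close> by a truncated Ramanujan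
  expansion, which is orthogonal to all small moduli, makes them uncorrelated up to a power saving.
  Pairs with equal \<open>c\<^sub>1\<close> are controlled by the divisor bound together with the fact that \<open>\<gamma>\<^sub>1\<close> runs
  over more than \<open>Y powr (1 + \<eta>)\<close> cosets with \<open>c\<^sub>1 \<le> Y\<close>, a consequence of the divergence of the
  harmonic series. The finitely many primes dividing \<open>2 w c(V)\<close> are dealt with by starting from a
  \<open>\<gamma>\<^sub>0\<close> whose trace has the prescribed residue and multiplying it only by words that are trivial
  modulo a high power of these primes.
\<close>

section \<open>Moebius function and sieve weights\<close>

text \<open>The obstacle is that \<Gamma> may be thin. Pairs with equal \<open>c\<^sub>1\<close> are
  estimated without cancellation, and relative to the main term they cost Y divided by the number of
  cosets, times a power of the sieve level R; hence the need for more than Y powr (1 + \<eta>)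
  cosets. That surplus is an elementary form of the fact that a nonelementary Fuchsian group with a
  cusp has critical exponent above 1/2, and it fixes the exponent 8 that recurs below: it has to
  beat a seventh power of R. A class modulo x has density 1 / x, so hits are weighted by x; for two
  compatible classes the weighted density is then the gcd of the moduli, and it is the fluctuation
  of this gcd that the sieve weights have to average out. All words used are trivial modulo M ^ 10
  for a fixed M carrying the bad primes, so that every modulus x can be kept prime to M.
  Admissibility of t enters through one congruence only, to a trace modulo M ^ 8.\<close>

definition mobius :: "nat \<Rightarrow> real" where
  "mobius n = (if squarefree n then (- 1) ^ card (prime_factors n) else 0)"

lemma abs_mobius_le: "\<bar>mobius n\<bar> \<le> 1"
  by (simp add: mobius_def)

lemma mobius_1 [simp]: "mobius (Suc 0) = 1"
  by (simp add: mobius_def)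

lemma mobius_prime_mult:
  assumes "prime p" "\<not> p dvd d" "d > 0"
  shows "mobius (p * d) = - mobius d"
proof -
  have cop: "coprime p d" using assms by (simp add: prime_imp_coprime)
  have sq: "squarefree (p * d) \<longleftrightarrow> squarefree d"
    using assms cop squarefree_mult_coprime squarefree_multD(2) squarefree_prime
    by metis
  have "prime_factors (p * d) = insert p (prime_factors d)"
    using assms by (subst prime_factors_product) (auto simp: prime_prime_factors)
  moreover have "p \<notin> prime_factors d" using assms by auto
  ultimately show ?thesis using sq by (simp add: mobius_def)
qed

text \<open>Fix a prime p dividing n. Multiplication by p turns a divisor prime to p into one of
  opposite sign; divisors divisible by p that are not reached in this way are multiples of p ^ 2,
  where \<open>mobius\<close> vanishes.\<close>

lemma sum_mobius_divisors:
  assumes "n > 0"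
  shows "(\<Sum>d | d dvd n. mobius d) = (if n = 1 then 1 else 0)"
proof (cases "n = 1")
  case False
  then obtain p where p: "prime p" "p dvd n" using prime_factor_nat by blast
  define S where "S = {d. d dvd n \<and> \<not> p dvd d}"
  define S' where "S' = {d. d dvd n \<and> p dvd d}"
  have fin: "finite {d. d dvd n}" using assms by simp
  have finS: "finite S" "finite S'" using finite_subset[OF _ fin] by (auto simp: S_def S'_def)
  have "(\<Sum>d\<in>S'. mobius d) = (\<Sum>d\<in>(*) p ` S. mobius d)"
  proof (rule sum.mono_neutral_right)
    show "(*) p ` S \<subseteq> S'"
      using p by (auto simp: S_def S'_def prime_imp_coprime divides_mult)
    show "\<forall>d\<in>S' - (*) p ` S. mobius d = 0"
    proof
      fix d assume d: "d \<in> S' - (*) p ` S"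
      then obtain k where k: "d = p * k" by (auto simp: S'_def elim: dvdE)
      have "k dvd n" using d k by (auto simp: S'_def intro: dvd_mult_right)
      then have "p dvd k" using d k by (auto simp: S_def)
      then have "p ^ 2 dvd d" using k by (auto simp: power2_eq_square)
      then have "\<not> squarefree d"
        using p by (metis not_prime_unit squarefreeD)
      then show "mobius d = 0" by (simp add: mobius_def)
    qed
  qed (use finS in auto)
  also have "\<dots> = (\<Sum>d\<in>S. mobius (p * d))"
    using p by (subst sum.reindex) (auto simp: inj_on_def)
  also have "\<dots> = (\<Sum>d\<in>S. - mobius d)"
  proof (intro sum.cong refl mobius_prime_mult)
    fix d assume "d \<in> S"
    then show "d > 0" using assms by (auto simp: S_def intro: Nat.gr0I)
  qed (use p in \<open>auto simp: S_def\<close>)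
  finally have eq: "(\<Sum>d\<in>S'. mobius d) = - (\<Sum>d\<in>S. mobius d)" by (simp add: sum_negf)
  have "{d. d dvd n} = S \<union> S'" "S \<inter> S' = {}" by (auto simp: S_def S'_def)
  then have "(\<Sum>d | d dvd n. mobius d) = (\<Sum>d\<in>S. mobius d) + (\<Sum>d\<in>S'. mobius d)"
    using finS by (simp add: sum.union_disjoint)
  then show ?thesis using eq False by simp
qed (simp add: mobius_def)

lemma sum_mobius_cofactors:
  assumes "n > 0"
  shows "(\<Sum>d | d dvd n. mobius (n div d)) = (if n = 1 then 1 else 0)"
proof -
  have "(\<Sum>d | d dvd n. mobius (n div d)) = (\<Sum>d | d dvd n. mobius d)"
    by (rule sum.reindex_bij_witness[of _ "\<lambda>d. n div d" "\<lambda>d. n div d"])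
       (use assms in \<open>auto simp: div_div_eq_right\<close>)
  then show ?thesis using sum_mobius_divisors[OF assms] by simp
qed

lemma sum_mobius_between:
  assumes "j dvd k" "k > 0"
  shows "(\<Sum>d | j dvd d \<and> d dvd k. mobius (k div d)) = (if k = j then 1 else 0)"
proof -
  from assms obtain l where l: "k = j * l" by (auto elim: dvdE)
  then have pos: "j > 0" "l > 0" using assms by auto
  have "(\<Sum>d | j dvd d \<and> d dvd k. mobius (k div d)) = (\<Sum>d | d dvd l. mobius (l div d))"
    by (rule sum.reindex_bij_witness[of _ "\<lambda>d. j * d" "\<lambda>d. d div j"])
       (use l pos in \<open>auto elim!: dvdE simp: mult.assoc\<close>)
  also have "\<dots> = (if l = 1 then 1 else 0)" using sum_mobius_cofactors[OF pos(2)] .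
  finally show ?thesis using l pos by simp
qed

definition mobius_transform :: "(nat \<Rightarrow> real) \<Rightarrow> nat \<Rightarrow> real" where
  "mobius_transform f n = (\<Sum>d | d dvd n. mobius (n div d) * f d)"

lemma sum_mobius_transform:
  assumes "n > 0"
  shows "(\<Sum>e | e dvd n. mobius_transform f e) = f n"
proof -
  let ?s = "\<lambda>d e. if d dvd e then mobius (e div d) * f d else 0"
  have fin: "finite {d. d dvd n}" using assms by simp
  have "(\<Sum>e | e dvd n. mobius_transform f e)
      = (\<Sum>e | e dvd n. \<Sum>d | d dvd n. ?s d e)"
  proof (intro sum.cong refl)
    fix e assume e: "e \<in> {e. e dvd n}"
    have "(\<Sum>d | d dvd n. ?s d e)
        = (\<Sum>d\<in>{d \<in> {d. d dvd n}. d dvd e}. mobius (e div d) * f d)"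
      by (rule sum.inter_filter[OF fin, symmetric])
    also have "\<dots> = mobius_transform f e"
      unfolding mobius_transform_def using e by (intro sum.cong) (auto intro: dvd_trans)
    finally show "mobius_transform f e = (\<Sum>d | d dvd n. ?s d e)"
      by (rule sym)
  qed
  also have "\<dots> = (\<Sum>d | d dvd n. \<Sum>e | e dvd n. ?s d e)"
    by (rule sum.swap)
  also have "\<dots> = (\<Sum>d | d dvd n. f d * (\<Sum>e | d dvd e \<and> e dvd n. mobius (e div d)))"
  proof (intro sum.cong refl)
    fix d
    have "{e. d dvd e \<and> e dvd n} = {e \<in> {e. e dvd n}. d dvd e}" by auto
    then show "(\<Sum>e | e dvd n. ?s d e) =
       f d * (\<Sum>e | d dvd e \<and> e dvd n. mobius (e div d))"
      by (simp add: sum.inter_filter[symmetric] fin sum_distrib_left mult.commute)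
  qed
  also have "\<dots> = (\<Sum>d | d dvd n. if d = n then f d else 0)"
  proof (intro sum.cong refl)
    fix d assume "d \<in> {d. d dvd n}"
    then obtain l where l: "n = d * l" by (auto elim: dvdE)
    then have pos: "d > 0" "l > 0" using assms by auto
    have "(\<Sum>e | d dvd e \<and> e dvd n. mobius (e div d)) = (\<Sum>k | k dvd l. mobius k)"
      by (rule sum.reindex_bij_witness[of _ "\<lambda>k. d * k" "\<lambda>e. e div d"])
         (use l pos in \<open>auto elim!: dvdE simp: mult.assoc\<close>)
    then show "f d * (\<Sum>e | d dvd e \<and> e dvd n. mobius (e div d)) = (if d = n then f d else 0)"
      using sum_mobius_divisors[OF pos(2)] l pos by auto
  qed
  also have "\<dots> = f n" using fin by (simp add: sum.delta')
  finally show ?thesis .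
qed

text \<open>The sum of \<open>sieve_weight R m d\<close> over the divisors \<open>d \<in> sieve_range R m\<close> of \<open>x\<close> is a truncated
  Ramanujan expansion of the von Mangoldt function. Being signed, it can have mean \<open>1\<close> while its mean
  over the multiples of each \<open>e\<close> with \<open>1 < e \<le> R\<close> vanishes exactly.\<close>

definition sieve_range :: "nat \<Rightarrow> nat \<Rightarrow> nat set" where
  "sieve_range R m = {d. 0 < d \<and> d \<le> R \<and> coprime d m}"

definition sieve_weight :: "nat \<Rightarrow> nat \<Rightarrow> nat \<Rightarrow> real" where
  "sieve_weight R m d = real d *
     (\<Sum>k\<in>{k\<in>sieve_range R m. d dvd k}. mobius (k div d) * (mobius k / real (totient k)))"

lemma finite_sieve_range [simp]: "finite (sieve_range R m)"
  by (rule finite_subset[of _ "{..R}"]) (auto simp: sieve_range_def)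

lemma card_sieve_range_le: "card (sieve_range R m) \<le> R"
proof -
  have "sieve_range R m \<subseteq> {1..R}" by (auto simp: sieve_range_def)
  then show ?thesis using card_mono[of "{1..R}"] by fastforce
qed

lemma sieve_range_dvd:
  assumes "d dvd k" "k \<in> sieve_range R m"
  shows "d \<in> sieve_range R m"
proof -
  have k: "0 < k" "k \<le> R" "coprime k m" using assms(2) by (auto simp: sieve_range_def)
  have "coprime d m" by (rule coprime_divisors[OF assms(1) dvd_refl k(3)])
  then show ?thesis
    using k assms(1) dvd_imp_le[OF assms(1) k(1)] dvd_pos_nat[OF k(1) assms(1)]
    by (simp add: sieve_range_def)
qed

lemma abs_sieve_weight_le:
  assumes "d \<in> sieve_range R m"
  shows "\<bar>sieve_weight R m d\<bar> \<le> real R ^ 2"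
proof -
  have "\<bar>\<Sum>k\<in>{k\<in>sieve_range R m. d dvd k}. mobius (k div d) * (mobius k / real (totient k))\<bar>
      \<le> (\<Sum>k\<in>{k\<in>sieve_range R m. d dvd k}. 1)"
  proof (rule sum_abs[THEN order_trans], rule sum_mono)
    fix k assume "k \<in> {k\<in>sieve_range R m. d dvd k}"
    then have "k > 0" by (simp add: sieve_range_def)
    then have "totient k \<ge> 1" by (simp add: Suc_le_eq)
    then have "\<bar>mobius k / real (totient k)\<bar> \<le> 1 / 1"
      unfolding abs_divide by (intro frac_le) (use abs_mobius_le in auto)
    then show "\<bar>mobius (k div d) * (mobius k / real (totient k))\<bar> \<le> 1"
      unfolding abs_mult by (intro mult_le_one) (use abs_mobius_le in auto)
  qed
  also have "\<dots> \<le> real R"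
    using card_mono[of "sieve_range R m" "{k\<in>sieve_range R m. d dvd k}"] card_sieve_range_le[of R m]
    by simp
  finally show ?thesis using assms
    unfolding sieve_weight_def abs_mult power2_eq_square
    by (intro mult_mono) (auto simp: sieve_range_def)
qed

text \<open>Dual Moebius inversion: the weight divided by d is itself a sum over the multiples k of
  d, and summing again over the multiples of j leaves only k = j.\<close>

lemma sum_sieve_weight_multiples:
  assumes "j > 0"
  shows "(\<Sum>d\<in>{d\<in>sieve_range R m. j dvd d}. sieve_weight R m d / real d)
       = (if j \<in> sieve_range R m then mobius j / real (totient j) else 0)"
proof -
  let ?D = "sieve_range R m"
  let ?y = "\<lambda>k. mobius k / real (totient k)"
  let ?s = "\<lambda>d k. if j dvd d \<and> d dvd k then mobius (k div d) * ?y k else 0"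
  have "(\<Sum>d\<in>{d\<in>?D. j dvd d}. sieve_weight R m d / real d)
      = (\<Sum>d\<in>?D. \<Sum>k\<in>?D. ?s d k)"
    unfolding sum.inter_filter[OF finite_sieve_range]
  proof (intro sum.cong refl)
    fix d assume d: "d \<in> ?D"
    then have "d > 0" by (simp add: sieve_range_def)
    then show "(if j dvd d then sieve_weight R m d / real d else 0)
       = (\<Sum>k\<in>?D. ?s d k)"
      unfolding sieve_weight_def sum.inter_filter[OF finite_sieve_range]
      by (cases "j dvd d") auto
  qed
  also have "\<dots> = (\<Sum>k\<in>?D. \<Sum>d\<in>?D. ?s d k)"
    by (rule sum.swap)
  also have "\<dots> = (\<Sum>k\<in>?D. if k = j then ?y k else 0)"
  proof (intro sum.cong refl)
    fix k assume k: "k \<in> ?D"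
    then have k0: "k > 0" by (simp add: sieve_range_def)
    have "(\<Sum>d\<in>?D. ?s d k)
        = (\<Sum>d\<in>{d\<in>?D. j dvd d \<and> d dvd k}. mobius (k div d) * ?y k)"
      by (rule sum.inter_filter[symmetric]) simp
    also have "{d\<in>?D. j dvd d \<and> d dvd k} = {d. j dvd d \<and> d dvd k}"
      using sieve_range_dvd k by auto
    also have "(\<Sum>d | j dvd d \<and> d dvd k. mobius (k div d) * ?y k)
        = (\<Sum>d | j dvd d \<and> d dvd k. mobius (k div d)) * ?y k"
      by (rule sum_distrib_right[symmetric])
    also have "\<dots> = (if k = j then ?y k else 0)"
    proof (cases "j dvd k")
      case True
      then show ?thesis using sum_mobius_between[OF True k0] by simp
    next
      case False
      then have "{d. j dvd d \<and> d dvd k} = {}" using dvd_trans by blast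
      then show ?thesis using False by (auto simp only: sum.empty) auto
    qed
    finally show "(\<Sum>d\<in>?D. ?s d k)
        = (if k = j then ?y k else 0)" .
  qed
  also have "\<dots> = (if j \<in> ?D then ?y j else 0)" by (simp add: sum.delta)
  finally show ?thesis .
qed

text \<open>Write 1 / lcm d e as gcd d e / (d e) and expand the gcd as a sum of totients over common
  divisors. The factor 1 / totient k from \<open>sum_sieve_weight_multiples\<close> cancels, and a
  truncated Moebius sum over the divisors of e remains. For e \<le> R it is complete, hence zero
  unless e = 1: this is the orthogonality to small moduli.\<close>

lemma sum_sieve_weight_lcm:
  assumes "e > 0" "coprime e m"
  shows "(\<Sum>d\<in>sieve_range R m. sieve_weight R m d / real (lcm d e))
       = (\<Sum>k\<in>{k. k dvd e \<and> k \<le> R}. mobius k) / real e"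
proof -
  let ?D = "sieve_range R m"
  let ?s = "\<lambda>k d. if k dvd d then sieve_weight R m d / real d * real (totient k) / real e else 0"
  have fin: "finite {k. k dvd e}" using assms by simp
  have "(\<Sum>d\<in>?D. sieve_weight R m d / real (lcm d e))
      = (\<Sum>d\<in>?D. \<Sum>k | k dvd e. ?s k d)"
  proof (intro sum.cong refl)
    fix d assume "d \<in> ?D"
    then have d: "d > 0" by (simp add: sieve_range_def)
    have "real (lcm d e) * real (gcd d e) = real d * real e"
      by (metis of_nat_mult prod_gcd_lcm_nat mult.commute)
    moreover have "gcd d e > 0" "lcm d e > 0" using d assms by (auto simp: lcm_pos_nat)
    ultimately have "sieve_weight R m d / real (lcm d e) = sieve_weight R m d / real d * real (gcd d e) / real e"
      using d assms by (simp add: field_simps)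
    also have "real (gcd d e) = (\<Sum>k | k dvd gcd d e. real (totient k))"
      unfolding of_nat_sum[symmetric] totient_divisor_sum ..
    also have "{k. k dvd gcd d e} = {k \<in> {k. k dvd e}. k dvd d}" by auto
    also have "(\<Sum>k\<in>\<dots>. real (totient k)) = (\<Sum>k | k dvd e. if k dvd d then real (totient k) else 0)"
      by (rule sum.inter_filter[OF fin])
    finally have eq: "sieve_weight R m d / real (lcm d e)
        = sieve_weight R m d / real d * (\<Sum>k | k dvd e. if k dvd d then real (totient k) else 0) / real e" .
    show "sieve_weight R m d / real (lcm d e) = (\<Sum>k | k dvd e. ?s k d)"
      unfolding eq sum_distrib_left sum_divide_distrib by (intro sum.cong refl) simp
  qed
  also have "\<dots> = (\<Sum>k | k dvd e. \<Sum>d\<in>?D. ?s k d)"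
    by (rule sum.swap)
  also have "\<dots> = (\<Sum>k | k dvd e. if k \<le> R then mobius k / real e else 0)"
  proof (intro sum.cong refl)
    fix k assume k: "k \<in> {k. k dvd e}"
    then have k0: "k > 0" using assms by (auto intro: Nat.gr0I)
    have "coprime k m" by (rule coprime_divisors[OF _ dvd_refl assms(2)]) (use k in simp)
    then have kD: "k \<in> ?D \<longleftrightarrow> k \<le> R" using k0 by (simp add: sieve_range_def)
    have "(\<Sum>d\<in>?D. ?s k d)
       = (\<Sum>d\<in>{d\<in>?D. k dvd d}. sieve_weight R m d / real d) * (real (totient k) / real e)"
      unfolding sum_distrib_right by (subst sum.inter_filter[symmetric]) simp_all
    also have "\<dots> = (if k \<le> R then mobius k / real e else 0)"
      using sum_sieve_weight_multiples[OF k0, of R m] kD k0 by simp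
    finally show "(\<Sum>d\<in>?D. ?s k d)
       = (if k \<le> R then mobius k / real e else 0)" .
  qed
  also have "\<dots> = (\<Sum>k\<in>{k \<in> {k. k dvd e}. k \<le> R}. mobius k / real e)"
    by (rule sum.inter_filter[OF fin, symmetric])
  finally show ?thesis by (simp add: sum_divide_distrib)
qed

section \<open>Divisors and arithmetic progressions\<close>

lemma card_divisors_prime_power_mult_le:
  assumes "prime (p::nat)" "m > 0"
  shows "card {d. d dvd p ^ a * m} \<le> (a + 1) * card {d. d dvd m}"
proof -
  have "{d. d dvd p ^ a * m} \<subseteq> (\<lambda>(i, d). p ^ i * d) ` ({..a} \<times> {d. d dvd m})"
  proof
    fix d assume "d \<in> {d. d dvd p ^ a * m}"
    then obtain d1 d2 where d: "d = d1 * d2" "d1 dvd p ^ a" "d2 dvd m"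
      using division_decomp[of d "p ^ a" m] by auto
    then obtain i where "i \<le> a" "d1 = p ^ i" using assms divides_primepow_nat by blast
    then show "d \<in> (\<lambda>(i, d). p ^ i * d) ` ({..a} \<times> {d. d dvd m})" using d by force
  qed
  then have "card {d. d dvd p ^ a * m} \<le> card ({..a} \<times> {d. d dvd m})"
    using assms by (intro surj_card_le) auto
  then show ?thesis by (simp add: card_cartesian_product)
qed

text \<open>Strip off the full power p ^ a of one prime at a time. A large prime costs nothing,
  because a + 1 \<le> 2 ^ a \<le> p powr (a \<epsilon>); each of the boundedly many primes below
  \<open>P0\<close> costs a factor \<open>K\<close>.\<close>

lemma card_divisors_le_powr:
  fixes \<epsilon> :: real
  assumes "\<epsilon> > 0"
  obtains C where "C > 0" "\<And>n. n > 0 \<Longrightarrow> real (card {d. d dvd n}) \<le> C * real n powr \<epsilon>"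
proof -
  \<comment> \<open>Comes from exp y \<ge> 1 + y at y = \<epsilon> a ln 2, which gives a + 1 \<le> K
    * 2 powr (\<epsilon> a) for every a.\<close>
  define K where "K = 1 + 1 / (\<epsilon> * ln 2)"
  have K1: "K \<ge> 1" using assms by (simp add: K_def)
  \<comment> \<open>The threshold at which p powr \<epsilon> reaches 2.\<close>
  define P0 where "P0 = 2 powr (1 / \<epsilon>)"
  have Kb: "real (a + 1) \<le> K * 2 powr (\<epsilon> * real a)" for a :: nat
  proof -
    have "1 + \<epsilon> * real a * ln 2 \<le> 2 powr (\<epsilon> * real a)"
      using exp_ge_add_one_self[of "\<epsilon> * real a * ln 2"] by (simp add: powr_def)
    then have "K * (1 + \<epsilon> * real a * ln 2) \<le> K * 2 powr (\<epsilon> * real a)"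
      using K1 by (intro mult_left_mono) auto
    moreover have "real (a + 1) \<le> K * (1 + \<epsilon> * real a * ln 2)"
      using assms by (simp add: K_def field_simps)
    ultimately show ?thesis by linarith
  qed
  have main: "real (card {d. d dvd n}) \<le> K ^ card {p\<in>prime_factors n. real p < P0} * real n powr \<epsilon>"
    if "n > 0" for n
    using that
  proof (induction n rule: less_induct)
    case (less n)
    show ?case
    proof (cases "n = 1")
      case False
      then obtain p where p: "prime p" "p dvd n" using prime_factor_nat by blast
      define a where "a = multiplicity p n"
      obtain m where m: "n = p ^ a * m" "\<not> p dvd m"
        using multiplicity_decompose'[of n p] less.prems p not_prime_unit unfolding a_def by blast
      have a0: "a > 0" using p less.prems unfolding a_def
        by (simp add: prime_multiplicity_gt_zero_iff)
      have m0: "m > 0" using m less.prems by (auto intro: Nat.gr0I)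
      have "p ^ a > 1" using a0 p(1) by (intro one_less_power prime_gt_1_nat) auto
      have pa: "real (p ^ a) powr \<epsilon> = real p powr (real a * \<epsilon>)"
        using prime_gt_0_nat[OF p(1)] powr_realpow[of "real p" a] powr_powr[of "real p" "real a" \<epsilon>] by simp
      have npow: "real n powr \<epsilon> = real (p ^ a) powr \<epsilon> * real m powr \<epsilon>"
        by (simp only: m(1) of_nat_mult) (simp add: powr_mult)
      from \<open>p ^ a > 1\<close> have mn: "m < n" using m m0 by simp
      let ?S = "\<lambda>n. {p\<in>prime_factors n. real p < P0}"
      have pf: "prime_factors n = insert p (prime_factors m)"
        unfolding m(1) using m0 p a0
        by (subst prime_factors_product) (auto simp: prime_factors_power prime_prime_factors)
      have pm: "p \<notin> prime_factors m" using m by auto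
      have "real (card {d. d dvd n}) \<le> real ((a + 1) * card {d. d dvd m})"
        using card_divisors_prime_power_mult_le[OF p(1) m0, of a] m(1) by (simp only: of_nat_le_iff)
      also have "\<dots> \<le> real (a + 1) * (K ^ card (?S m) * real m powr \<epsilon>)"
        using less.IH[OF mn m0] by (simp only: of_nat_mult) (intro mult_left_mono, auto)
      also have "\<dots> \<le> (K ^ card (?S n) * real n powr \<epsilon>)"
      proof (cases "real p < P0")
        case True
        have "?S n = insert p (?S m)" using pf True by auto
        then have c: "card (?S n) = Suc (card (?S m))" using pm by simp
        have "2 powr (\<epsilon> * real a) \<le> real p powr (\<epsilon> * real a)"
          using p prime_ge_2_nat assms by (intro powr_mono2) auto
        then have "real (a + 1) \<le> K * real p powr (\<epsilon> * real a)"
          using Kb[of a] K1 by (meson mult_left_mono order_trans zero_le_one)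
        also have "real p powr (\<epsilon> * real a) = real (p ^ a) powr \<epsilon>"
          using pa by (simp add: mult.commute)
        finally have "real (a + 1) * (K ^ card (?S m) * real m powr \<epsilon>)
             \<le> (K * real (p ^ a) powr \<epsilon>) * (K ^ card (?S m) * real m powr \<epsilon>)"
          using K1 by (intro mult_right_mono) auto
        also have "\<dots> = K ^ card (?S n) * real n powr \<epsilon>"
          unfolding c npow by simp
        finally show ?thesis .
      next
        case False
        have "?S n = ?S m" using pf False by auto
        have "2 = P0 powr \<epsilon>" using assms by (simp add: P0_def powr_powr)
        also have "\<dots> \<le> real p powr \<epsilon>" using False assms by (intro powr_mono2) (auto simp: P0_def)
        finally have "2 ^ a \<le> (real p powr \<epsilon>) ^ a" by (intro power_mono) auto
        moreover have "real (a + 1) \<le> 2 ^ a" by (induction a) auto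
        moreover have "(real p powr \<epsilon>) ^ a = real (p ^ a) powr \<epsilon>"
          using pa p prime_gt_0_nat[OF p(1)] powr_realpow[of "real p powr \<epsilon>" a]
          by (simp add: powr_powr mult.commute)
        ultimately have "real (a + 1) \<le> real (p ^ a) powr \<epsilon>" by linarith
        then have "real (a + 1) * (K ^ card (?S m) * real m powr \<epsilon>)
             \<le> (real (p ^ a) powr \<epsilon>) * (K ^ card (?S m) * real m powr \<epsilon>)"
          using K1 by (intro mult_right_mono) auto
        also have "\<dots> = K ^ card (?S n) * real n powr \<epsilon>"
          unfolding \<open>?S n = ?S m\<close> npow by simp
        finally show ?thesis .
      qed
      finally show ?thesis .
    qed simp
  qed
  show thesis
  proof (rule that[of "K ^ nat \<lceil>P0\<rceil>"])
    show "K ^ nat \<lceil>P0\<rceil> > 0" using K1 by simp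
    fix n :: nat assume n: "n > 0"
    have "{p\<in>prime_factors n. real p < P0} \<subseteq> {..<nat \<lceil>P0\<rceil>}" by (auto simp: nat_less_iff) linarith
    then have "card {p\<in>prime_factors n. real p < P0} \<le> nat \<lceil>P0\<rceil>"
      using card_mono[of "{..<nat \<lceil>P0\<rceil>}"] by fastforce
    then have "K ^ card {p\<in>prime_factors n. real p < P0} \<le> K ^ nat \<lceil>P0\<rceil>"
      using K1 by (rule power_increasing)
    then show "real (card {d. d dvd n}) \<le> K ^ nat \<lceil>P0\<rceil> * real n powr \<epsilon>"
      using main[OF n] by (meson mult_right_mono order_trans powr_ge_zero)
  qed
qed

lemma card_cong_interval:
  fixes u r q :: int and I :: nat
  assumes "q > 0"
  shows "\<bar>real (card {t\<in>{u..<u + int I}. [t = r] (mod q)}) - real I / real_of_int q\<bar> \<le> 1"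
proof -
  \<comment> \<open>The endpoints in the variable j of t = r + j q; as the interval is half-open,
    the count is exactly a difference of two ceilings.\<close>
  define y where "y = real_of_int (u - r) / real_of_int q"
  define z where "z = y + real I / real_of_int q"
  have q: "real_of_int q > 0" using assms by simp
  have bnd: "j \<in> {\<lceil>y\<rceil>..<\<lceil>z\<rceil>} \<longleftrightarrow> r + j * q \<in> {u..<u + int I}" for j
  proof -
    have "\<lceil>y\<rceil> \<le> j \<longleftrightarrow> real_of_int (u - r) \<le> real_of_int (j * q)"
      unfolding ceiling_le_iff y_def using q by (simp add: field_simps)
    then have 1: "\<lceil>y\<rceil> \<le> j \<longleftrightarrow> u \<le> r + j * q" by (simp only: of_int_le_iff) linarith
    have "j < \<lceil>z\<rceil> \<longleftrightarrow> real_of_int (j * q) < real_of_int (u - r + int I)"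
      unfolding less_ceiling_iff z_def y_def using q by (simp add: field_simps)
    then have 2: "j < \<lceil>z\<rceil> \<longleftrightarrow> r + j * q < u + int I" by (simp only: of_int_less_iff) linarith
    show ?thesis using 1 2 by simp
  qed
  have "{t\<in>{u..<u + int I}. [t = r] (mod q)} = (\<lambda>j. r + j * q) ` {\<lceil>y\<rceil>..<\<lceil>z\<rceil>}"
  proof (intro equalityI subsetI)
    fix t assume t: "t \<in> {t\<in>{u..<u + int I}. [t = r] (mod q)}"
    then have "q dvd t - r" by (simp add: cong_iff_dvd_diff)
    then obtain j where "t - r = q * j" by (elim dvdE)
    then have j: "t = r + j * q" by (simp add: algebra_simps)
    then show "t \<in> (\<lambda>j. r + j * q) ` {\<lceil>y\<rceil>..<\<lceil>z\<rceil>}" using bnd t by blast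
  next
    fix t assume "t \<in> (\<lambda>j. r + j * q) ` {\<lceil>y\<rceil>..<\<lceil>z\<rceil>}"
    then obtain j where j: "t = r + j * q" "j \<in> {\<lceil>y\<rceil>..<\<lceil>z\<rceil>}" by blast
    then show "t \<in> {t\<in>{u..<u + int I}. [t = r] (mod q)}"
      using bnd by (auto simp: cong_def)
  qed
  moreover have "inj_on (\<lambda>j. r + j * q) A" for A using assms by (auto simp: inj_on_def)
  ultimately have "card {t\<in>{u..<u + int I}. [t = r] (mod q)} = nat (\<lceil>z\<rceil> - \<lceil>y\<rceil>)"
    by (simp add: card_image)
  moreover have "y \<le> z" using q by (simp add: z_def)
  then have "\<lceil>y\<rceil> \<le> \<lceil>z\<rceil>" by (rule ceiling_mono)
  ultimately have "real (card {t\<in>{u..<u + int I}. [t = r] (mod q)}) = real_of_int \<lceil>z\<rceil> - real_of_int \<lceil>y\<rceil>"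
    by simp
  then show ?thesis using z_def by linarith
qed

lemma linear_cong_int_iff:
  fixes k m u :: int
  assumes "coprime k m"
  obtains r where "\<And>t. k dvd u + m * t \<longleftrightarrow> [t = r] (mod k)"
proof -
  obtain s where s: "[m * s = 1] (mod k)"
    using assms cong_solve_coprime_int[of m k] by (auto simp: coprime_commute)
  have "k dvd u + m * t \<longleftrightarrow> [t = - u * s] (mod k)" for t
  proof -
    have r: "k dvd u + m * (- u * s)"
    proof -
      have "k dvd u * (1 - m * s)" using s by (simp add: cong_iff_dvd_diff dvd_diff_commute)
      then show ?thesis by (simp add: algebra_simps)
    qed
    have "k dvd u + m * t \<longleftrightarrow> k dvd (u + m * t) - (u + m * (- u * s))"
      using r by (metis dvd_diff_left_iff)
    also have "(u + m * t) - (u + m * (- u * s)) = m * (t - (- u * s))" by (simp add: algebra_simps)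
    also have "k dvd \<dots> \<longleftrightarrow> k dvd t - (- u * s)" using assms by (simp add: coprime_dvd_mult_right_iff)
    finally show ?thesis by (simp add: cong_iff_dvd_diff)
  qed
  then show thesis using that by blast
qed

lemma card_linear_multiples:
  fixes k u m X :: nat
  assumes "coprime k m" "k > 0"
  shows "\<bar>real (card {n\<in>{1..X}. k dvd u + m * n}) - real X / real k\<bar> \<le> 1"
proof -
  obtain r where r: "\<And>t. int k dvd int u + int m * t \<longleftrightarrow> [t = r] (mod int k)"
    using linear_cong_int_iff[of "int k" "int m" "int u"] assms by auto
  have "int ` {n\<in>{1..X}. k dvd u + m * n} = {t\<in>{1..<1 + int X}. [t = r] (mod int k)}"
  proof (intro equalityI subsetI)
    fix t assume "t \<in> int ` {n\<in>{1..X}. k dvd u + m * n}"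
    then obtain n where n: "t = int n" "n \<in> {1..X}" "k dvd u + m * n" by auto
    then have "int k dvd int (u + m * n)" by (simp only: of_nat_dvd_iff)
    then show "t \<in> {t\<in>{1..<1 + int X}. [t = r] (mod int k)}" using n r[of t] by auto
  next
    fix t assume t: "t \<in> {t\<in>{1..<1 + int X}. [t = r] (mod int k)}"
    then obtain n where n: "t = int n" by (auto intro: nonneg_int_cases[of t])
    then have "int k dvd int (u + m * n)" using t r[of t] by simp
    then have "k dvd u + m * n" by (simp only: of_nat_dvd_iff)
    then show "t \<in> int ` {n\<in>{1..X}. k dvd u + m * n}" using t n by auto
  qed
  then have "card {n\<in>{1..X}. k dvd u + m * n} = card {t\<in>{1..<1 + int X}. [t = r] (mod int k)}"
    using card_image[of int "{n\<in>{1..X}. k dvd u + m * n}"] by simp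
  then show ?thesis using card_cong_interval[of "int k" 1 X r] assms by simp
qed

text \<open>Chinese remainder theorem for moduli with a common factor; a Bezout relation for the gcd
  produces the common solution.\<close>

lemma cong_pair_int_iff:
  fixes k l r s :: int
  assumes "[r = s] (mod gcd k l)"
  obtains v where "\<And>t. [t = r] (mod k) \<and> [t = s] (mod l) \<longleftrightarrow> [t = v] (mod lcm k l)"
proof -
  obtain z where z: "s - r = gcd k l * z"
    using cong_sym[OF assms] by (auto simp: cong_iff_dvd_diff elim: dvdE)
  obtain i j where "i * k + j * l = gcd k l" using bezout_int by blast
  then have "s - r = (i * k + j * l) * z" using z by simp
  then have v: "r + z * i * k = s + (- z * j) * l" by (simp add: algebra_simps)
  have vr: "[r + z * i * k = r] (mod k)" by (simp add: cong_iff_dvd_diff)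
  have vs: "[r + z * i * k = s] (mod l)" unfolding v by (simp add: cong_iff_dvd_diff)
  show thesis
  proof (rule that[of "r + z * i * k"])
    fix t
    have "[t = r] (mod k) \<and> [t = s] (mod l) \<longleftrightarrow> [t = r + z * i * k] (mod k) \<and> [t = r + z * i * k] (mod l)"
      using vr vs by (metis cong_sym cong_trans)
    also have "\<dots> \<longleftrightarrow> [t = r + z * i * k] (mod lcm k l)"
      by (simp add: cong_iff_dvd_diff lcm_least_iff)
    finally show "[t = r] (mod k) \<and> [t = s] (mod l) \<longleftrightarrow> [t = r + z * i * k] (mod lcm k l)" .
  qed
qed

section \<open>A tree of coprime pairs\<close>

text \<open>Models the passage from \<gamma> to \<gamma> U^(q n) V^q on the bottom row (c, d) of
  \<gamma>. Up to sign, and a fixed factor in c, \<open>fst\<close> is c and \<open>snd\<close> is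
  \<kappa> d + r c, the bottom row applied to the vector (r, \<kappa>) fixed by V. Hence U moves
  only \<open>snd\<close> and V moves only \<open>fst\<close>.\<close>

definition child :: "nat \<Rightarrow> nat \<Rightarrow> nat \<times> nat \<Rightarrow> nat \<Rightarrow> nat \<times> nat" where
  "child a B v n = (fst v + a * (snd v + B * fst v * n), snd v + B * fst v * n)"

text \<open>Multiplication by powers of U^q shifts \<open>snd v\<close> by multiples of B *
  \<open>fst v\<close>, so the bound picks one representative per coset. The coprimality conditions
  reflect determinant 1 and the removal of the bad primes.\<close>

definition node :: "nat \<Rightarrow> nat \<Rightarrow> nat \<times> nat \<Rightarrow> bool" where
  "node a B v \<longleftrightarrow> 0 < fst v \<and> snd v < B * fst v \<and> coprime (fst v) a \<and> coprime (fst v) (snd v)"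

text \<open>The value n = 0 is excluded because it could return the same node, namely when
  \<open>snd\<close> is 0. For n \<ge> 1 the first component strictly grows.\<close>

inductive_set orbit :: "nat \<Rightarrow> nat \<Rightarrow> nat \<times> nat \<Rightarrow> (nat \<times> nat) set" for a B v where
  orbit_base: "v \<in> orbit a B v"
| orbit_step: "u \<in> orbit a B v \<Longrightarrow> n \<ge> 1 \<Longrightarrow> child a B u n \<in> orbit a B v"

lemma orbit_trans: "u \<in> orbit a B v \<Longrightarrow> t \<in> orbit a B u \<Longrightarrow> t \<in> orbit a B v"
  by (rotate_tac, induction rule: orbit.induct) (auto intro: orbit.intros)

lemma node_child:
  assumes "node a B v" "a > 0" "B > 0"
  shows "node a B (child a B v n)"
proof -
  let ?e = "snd v + B * fst v * n"
  let ?c = "fst v + a * ?e"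
  have v: "0 < fst v" "coprime (fst v) a" "coprime (fst v) (snd v)" using assms by (auto simp: node_def)
  have "?e \<le> a * ?e" using assms(2) by (cases a) auto
  then have "?e < ?c" using v(1) add_less_le_mono[of 0 "fst v" ?e "a * ?e"] by (simp only: add_0)
  also have "?c \<le> B * ?c" using assms(3) by (cases B) auto
  finally have 1: "?e < B * ?c" .
  have "gcd a ?c = gcd a (fst v)" using gcd_add_mult[of a ?e "fst v"] by (simp only: add.commute mult.commute)
  then have 2: "coprime ?c a" using v by (simp only: coprime_iff_gcd_eq_1 gcd.commute)
  have "gcd ?e ?c = gcd ?e (fst v)" using gcd_add_mult[of ?e a "fst v"] by (simp only: add.commute)
  also have "\<dots> = gcd (fst v) (B * n * fst v + snd v)" by (simp only: gcd.commute add.commute mult.commute mult.left_commute)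
  also have "\<dots> = gcd (fst v) (snd v)" by (rule gcd_add_mult)
  finally have 3: "coprime ?c ?e" using v by (simp only: coprime_iff_gcd_eq_1 gcd.commute)
  show ?thesis using 1 2 3 v by (simp add: node_def child_def)
qed

lemma child_coprime_parent:
  assumes "node a B v"
  shows "coprime (fst (child a B v n)) (fst v)"
proof -
  have "fst (child a B v n) = (1 + a * B * n) * fst v + a * snd v" by (simp add: child_def algebra_simps)
  then have "gcd (fst v) (fst (child a B v n)) = gcd (fst v) (a * snd v)" by (simp only: gcd_add_mult)
  moreover have "coprime (fst v) (a * snd v)" using assms by (simp add: node_def)
  ultimately show ?thesis by (simp add: coprime_iff_gcd_eq_1 gcd.commute)
qed

text \<open>Division with remainder decodes a child. Subtracting a times the second component from
  the first gives \<open>fst v\<close>; the second component then has quotient n and remainder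
  \<open>snd v\<close> on division by B * \<open>fst v\<close>. This replaces a proof that the
  semigroup of words is free.\<close>

lemma child_inj:
  assumes "node a B v" "node a B v'" "child a B v n = child a B v' n'"
  shows "v = v' \<and> n = n'"
proof -
  have e: "snd v + B * fst v * n = snd v' + B * fst v' * n'" using assms(3) by (simp add: child_def)
  have c: "fst v = fst v'" using assms(3) e by (simp add: child_def)
  let ?m = "B * fst v"
  have m: "snd v < ?m" "snd v' < ?m" using assms c by (auto simp: node_def)
  have e': "snd v + ?m * n = snd v' + ?m * n'" using e c by simp
  have s: "snd v = snd v'" using arg_cong[OF e', of "\<lambda>t. t mod ?m"] m by simp
  then have "?m * n = ?m * n'" using e' by simp
  moreover have "?m \<noteq> 0" using m by linarith
  ultimately have "n = n'" by simp
  then show ?thesis using s c by (simp add: prod_eq_iff)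
qed

lemma child_greater:
  assumes "node a B v" "a > 0" "n \<ge> 1"
  shows "fst v < fst (child a B v n)" "n \<le> fst (child a B v n)"
proof -
  define e where "e = snd v + B * fst v * n"
  have "B * fst v > 0" using assms(1) unfolding node_def by linarith
  then have "n \<le> B * fst v * n" "B * fst v * n > 0" using assms by auto
  then have e: "n \<le> e" "e > 0" unfolding e_def by linarith+
  have "e \<le> a * e" using assms(2) by (cases a) auto
  then show "fst v < fst (child a B v n)" "n \<le> fst (child a B v n)"
    using e unfolding child_def fst_conv e_def[symmetric] by linarith+
qed

text \<open>The 2 in n + 2 absorbs \<open>fst v\<close> and a * \<open>snd v\<close>, each of which
  is at most a * B * \<open>fst v\<close>.\<close>

lemma child_le:
  assumes "node a B v" "a > 0" "B > 0"
  shows "fst (child a B v n) \<le> fst v * (a * B * (n + 2))"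
proof -
  have "snd v \<le> B * fst v" using assms by (simp add: node_def)
  then have "a * snd v \<le> a * (B * fst v)" by (rule mult_left_mono) simp
  moreover have "fst v \<le> a * (B * fst v)" using assms by simp
  ultimately have "fst v + a * snd v + a * B * fst v * n \<le> 2 * (a * (B * fst v)) + a * B * fst v * n" by linarith
  then show ?thesis by (simp add: child_def algebra_simps)
qed

section \<open>Counting words of bounded growth\<close>

definition rate :: "nat \<Rightarrow> nat \<Rightarrow> nat \<Rightarrow> real" where "rate a B n = real (a * B * (n + 2))"

definition words :: "nat \<Rightarrow> nat \<Rightarrow> nat \<Rightarrow> real \<Rightarrow> nat list set" where
  "words a B M r = {ws \<in> lists {1..M}. prod_list (map (rate a B) ws) \<le> r}"

lemma rate_ge: "a > 0 \<Longrightarrow> B > 0 \<Longrightarrow> rate a B n \<ge> 2"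
proof -
  assume "a > 0" "B > 0"
  then have "1 * 2 \<le> (a * B) * (n + 2)" by (intro mult_mono) auto
  then have "real (1 * 2) \<le> real ((a * B) * (n + 2))" by (simp only: of_nat_le_iff)
  then show ?thesis by (simp add: rate_def)
qed

lemma finite_words:
  assumes "a > 0" "B > 0"
  shows "finite (words a B M r)"
proof -
  have pow: "2 ^ length ws \<le> prod_list (map (rate a B) ws)" for ws
  proof (induction ws)
    case (Cons n ws)
    then show ?case using rate_ge[OF assms, of n] by (auto intro!: mult_mono)
  qed simp
  obtain k :: nat where k: "r < 2 ^ k" using real_arch_pow[of 2 r] by auto
  have "words a B M r \<subseteq> {ws. set ws \<subseteq> {1..M} \<and> length ws \<le> k}"
  proof
    fix ws assume ws: "ws \<in> words a B M r"
    then have "2 ^ length ws < (2::real) ^ k"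
      using pow[of ws] k unfolding words_def by (simp only: mem_Collect_eq) linarith
    then have "length ws < k" by (simp add: power_strict_increasing_iff)
    then show "ws \<in> {ws. set ws \<subseteq> {1..M} \<and> length ws \<le> k}" using ws by (auto simp: words_def)
  qed
  then show ?thesis by (rule finite_subset) (rule finite_lists_length_le, simp)
qed

text \<open>A renewal inequality. Splitting off the first letter bounds the number W(r) of words
  below by the sum of W(r / rate n), and r powr s is a subsolution as soon as the rate n powr (- s)
  sum to at least 1. The factor rate M powr (- s) makes the claim true for r \<le> rate M, where the
  empty word suffices.\<close>

lemma card_words_ge:
  assumes ab: "a > 0" "B > 0" and M: "M > 0" and s: "s \<ge> 0"
    and sum: "(\<Sum>n\<in>{1..M}. rate a B n powr (- s)) \<ge> 1" and r: "r \<ge> 1"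
  shows "real (card (words a B M r)) \<ge> rate a B M powr (- s) * r powr s"
proof -
  let ?\<kappa> = "rate a B M powr (- s)"
  have rate2: "rate a B n \<ge> 2" for n using rate_ge[OF ab] .
  have rate_mono: "rate a B n \<le> rate a B M" if "n \<le> M" for n
  proof -
    have "a * B * (n + 2) \<le> a * B * (M + 2)" using that by simp
    then show ?thesis unfolding rate_def by (simp only: of_nat_le_iff)
  qed
  have base: "real (card (words a B M r)) \<ge> ?\<kappa> * r powr s" if "r \<ge> 1" "r \<le> rate a B M" for r
  proof -
    have "[] \<in> words a B M r" using that by (simp add: words_def)
    then have "card (words a B M r) \<ge> 1"
      using finite_words[OF ab] by (metis One_nat_def Suc_leI card_gt_0_iff empty_iff)
    moreover have "?\<kappa> * r powr s \<le> ?\<kappa> * rate a B M powr s"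
      using that s by (intro mult_left_mono powr_mono2) auto
    moreover have "?\<kappa> * rate a B M powr s = 1"
      using rate2[of M] by (simp flip: powr_add)
    ultimately show ?thesis by linarith
  qed
  \<comment> \<open>Every rate is at least 2, so removing a letter at least halves r; this makes
    induction on k possible.\<close>
  have main: "real (card (words a B M r)) \<ge> ?\<kappa> * r powr s" if "r \<ge> 1" "r \<le> rate a B M * 2 ^ k" for r k
    using that
  proof (induction k arbitrary: r)
    case 0
    then show ?case using base by simp
  next
    case (Suc k)
    show ?case
    proof (cases "r \<le> rate a B M")
      case True
      then show ?thesis using base Suc.prems by simp
    next
      case False
      let ?U = "\<lambda>n. (#) n ` words a B M (r / rate a B n)"
      have sub: "(\<Union>n\<in>{1..M}. ?U n) \<subseteq> words a B M r"
      proof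
        fix ws assume "ws \<in> (\<Union>n\<in>{1..M}. ?U n)"
        then obtain n vs where n: "n \<in> {1..M}" "ws = n # vs" "vs \<in> words a B M (r / rate a B n)" by auto
        have "rate a B n * prod_list (map (rate a B) vs) \<le> r"
          using n(3) rate2[of n] by (simp add: words_def field_simps)
        then show "ws \<in> words a B M r" using n by (auto simp: words_def)
      qed
      have IH: "real (card (?U n)) \<ge> ?\<kappa> * (r / rate a B n) powr s" if n: "n \<in> {1..M}" for n
      proof -
        have "r / rate a B n \<ge> 1" using False rate_mono[of n] n rate2[of n] by simp
        moreover have "r / rate a B n \<le> rate a B M * 2 ^ k"
        proof -
          have "r / rate a B n \<le> r / 2" using rate2[of n] Suc.prems by (intro divide_left_mono) auto
          moreover have "r / 2 \<le> rate a B M * 2 ^ k" using Suc.prems(2) by simp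
          ultimately show ?thesis by linarith
        qed
        ultimately show ?thesis using Suc.IH[of "r / rate a B n"] by (simp add: card_image)
      qed
      have "?\<kappa> * r powr s * 1 \<le> ?\<kappa> * r powr s * (\<Sum>n\<in>{1..M}. rate a B n powr (- s))"
        using sum by (intro mult_left_mono) auto
      also have "\<dots> = (\<Sum>n\<in>{1..M}. ?\<kappa> * (r / rate a B n) powr s)"
        unfolding sum_distrib_left
      proof (intro sum.cong refl)
        fix n
        have "(r / rate a B n) powr s = r powr s * rate a B n powr (- s)"
          using rate2[of n] Suc.prems by (simp add: powr_divide powr_minus_divide)
        then show "?\<kappa> * r powr s * rate a B n powr (- s) = ?\<kappa> * (r / rate a B n) powr s" by simp
      qed
      also have "\<dots> \<le> (\<Sum>n\<in>{1..M}. real (card (?U n)))" using IH by (rule sum_mono)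
      also have "\<dots> = real (card (\<Union>n\<in>{1..M}. ?U n))"
        by (subst card_UN_disjoint) (use finite_words[OF ab] in auto)
      also have "\<dots> \<le> real (card (words a B M r))"
        using card_mono[OF finite_words[OF ab] sub] by simp
      finally show ?thesis by simp
    qed
  qed
  obtain k :: nat where k: "r < 2 ^ k" using real_arch_pow[of 2 r] by auto
  have "1 * 2 ^ k \<le> rate a B M * 2 ^ k" using rate2[of M] by (intro mult_right_mono) auto
  then have "r \<le> rate a B M * 2 ^ k" using k by linarith
  then show ?thesis by (rule main[OF r])
qed

lemma run_word:
  assumes "node a B v" "a > 0" "B > 0" "ws \<in> lists {1..M}"
  shows "node a B (foldl (child a B) v ws)" "foldl (child a B) v ws \<in> orbit a B v"
    "fst v \<le> fst (foldl (child a B) v ws)"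
    "real (fst (foldl (child a B) v ws)) \<le> real (fst v) * prod_list (map (rate a B) ws)"
  using assms(4)
proof (induction ws rule: rev_induct)
  case Nil
  { case 1 show ?case using assms by simp }
  { case 2 show ?case by (simp add: orbit_base) }
  { case 3 show ?case by simp }
  { case 4 show ?case by simp }
next
  case (snoc n ws)
  let ?u = "foldl (child a B) v ws"
  have ws: "ws \<in> lists {1..M}" "n \<ge> 1" if "ws @ [n] \<in> lists {1..M}" using that by auto
  { case 1 then show ?case using snoc.IH(1)[OF ws(1)] node_child assms by simp }
  { case 2 then show ?case using snoc.IH(2)[OF ws(1)] orbit_step ws(2) by simp }
  { case 3 then show ?case
      using snoc.IH(3)[OF ws(1)] child_greater(1)[OF snoc.IH(1)[OF ws(1)] assms(2) ws(2)] by simp }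
  { case 4
    have "fst (child a B ?u n) \<le> fst ?u * (a * B * (n + 2))"
      using child_le[OF snoc.IH(1)[OF ws(1)[OF 4]] assms(2,3)] .
    then have "real (fst (child a B ?u n)) \<le> real (fst ?u * (a * B * (n + 2)))" by (simp only: of_nat_le_iff)
    also have "\<dots> = real (fst ?u) * rate a B n" by (simp add: rate_def)
    also have "\<dots> \<le> (real (fst v) * prod_list (map (rate a B) ws)) * rate a B n"
      by (rule mult_right_mono[OF snoc.IH(4)[OF ws(1)[OF 4]]]) (simp add: rate_def)
    finally show ?case by (simp add: mult.assoc) }
qed

text \<open>Words are decoded from the last letter by \<open>child_inj\<close>; a nonempty word
  cannot lead back to v because \<open>fst\<close> has strictly increased.\<close>

lemma inj_run:
  assumes v: "node a B v" "a > 0" "B > 0"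
  shows "inj_on (foldl (child a B) v) (lists {1..M})"
proof -
  have "ws = ws'" if "ws \<in> lists {1..M}" "ws' \<in> lists {1..M}"
    "foldl (child a B) v ws = foldl (child a B) v ws'" for ws ws'
    using that
  proof (induction ws arbitrary: ws' rule: rev_induct)
    case Nil
    show ?case
    proof (cases ws' rule: rev_cases)
      case (snoc vs n)
      then have vs: "vs \<in> lists {1..M}" "n \<ge> 1" using Nil by auto
      have "fst v < fst (foldl (child a B) v ws')"
        using run_word(3)[OF v vs(1)] child_greater(1)[OF run_word(1)[OF v vs(1)] v(2) vs(2)] snoc by simp
      then show ?thesis using Nil by simp
    qed simp
  next
    case (snoc m us)
    then have us: "us \<in> lists {1..M}" "m \<ge> 1" by auto
    show ?case
    proof (cases ws' rule: rev_cases)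
      case Nil
      have "fst v < fst (foldl (child a B) v (us @ [m]))"
        using run_word(3)[OF v us(1)] child_greater(1)[OF run_word(1)[OF v us(1)] v(2) us(2)] by simp
      then show ?thesis using snoc.prems Nil by simp
    next
      case (snoc vs n)
      then have vs: "vs \<in> lists {1..M}" using snoc.prems by auto
      have "foldl (child a B) v us = foldl (child a B) v vs \<and> m = n"
        using snoc.prems(3) snoc child_inj[OF run_word(1)[OF v us(1)] run_word(1)[OF v vs]] by simp
      then show ?thesis using snoc.IH[OF us(1) vs] snoc by simp
    qed
  qed
  then show ?thesis by (auto simp: inj_on_def)
qed

text \<open>The reciprocals of the rates are a constant times a tail of the harmonic series, so
  finitely many of them sum to at least 2; raising the exponent from 1 to 1 + \<eta> with small
  \<eta> loses at most a factor 2.\<close>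

lemma harmonic_words_exponent:
  assumes "a > 0" "B > 0"
  obtains M \<eta> where "M > 0" "\<eta> > 0" "(\<Sum>n\<in>{1..M}. rate a B n powr (- (1 + \<eta>))) \<ge> 1"
proof -
  let ?d = "real (a * B)"
  have d: "?d \<ge> 1" using assms by (metis One_nat_def Suc_leI mult_pos_pos of_nat_1 of_nat_mono)
  have "eventually (\<lambda>M. (harm M :: real) \<ge> 2 * ?d + 2) at_top"
    using harm_at_top by (simp add: filterlim_at_top)
  then obtain M0 where M0: "\<And>M. M \<ge> M0 \<Longrightarrow> (harm M :: real) \<ge> 2 * ?d + 2"
    by (auto simp: eventually_at_top_linorder)
  define M where "M = Suc M0"
  have "(harm (M + 2) :: real) = 1 + 1 / 2 + (\<Sum>n\<in>{1..M}. 1 / real (n + 2))"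
  proof -
    have "(\<Sum>k\<in>{1..m + 2}. 1 / real k) = 1 + 1 / 2 + (\<Sum>n\<in>{1..m}. 1 / real (n + 2))" for m
      by (induction m) (simp_all add: numeral_2_eq_2)
    then show ?thesis by (simp add: harm_def inverse_eq_divide)
  qed
  moreover have "(harm (M + 2) :: real) \<ge> 2 * ?d + 2" using M0 by (simp add: M_def)
  ultimately have S: "(\<Sum>n\<in>{1..M}. 1 / real (n + 2)) \<ge> 2 * ?d" by linarith
  \<comment> \<open>Chosen so that rate M powr (- \<eta>) = 1/2; smaller letters lose less.\<close>
  define \<eta> where "\<eta> = ln 2 / ln (rate a B M)"
  have r2: "rate a B n \<ge> 2" for n using rate_ge[OF assms] .
  have lnr: "ln (rate a B M) > 0" using r2[of M] by (intro ln_gt_zero) linarith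
  have \<eta>: "\<eta> > 0" using lnr by (simp add: \<eta>_def)
  have half: "rate a B M powr (- \<eta>) = 1 / 2"
  proof -
    have "rate a B M powr \<eta> = 2" using r2[of M] lnr by (simp add: powr_def \<eta>_def)
    then show ?thesis by (simp add: powr_minus_divide)
  qed
  have "1 \<le> (\<Sum>n\<in>{1..M}. 1 / real (n + 2)) * (1 / (2 * ?d))" using S d by (simp add: field_simps)
  also have "\<dots> = (\<Sum>n\<in>{1..M}. 1 / rate a B n * (1 / 2))"
    unfolding sum_distrib_right by (intro sum.cong refl) (simp add: rate_def field_simps)
  also have "\<dots> \<le> (\<Sum>n\<in>{1..M}. rate a B n powr (- (1 + \<eta>)))"
  proof (rule sum_mono)
    fix n assume n: "n \<in> {1..M}"
    have "a * B * (n + 2) \<le> a * B * (M + 2)" using n by simp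
    then have "rate a B n \<le> rate a B M" unfolding rate_def by (simp only: of_nat_le_iff)
    then have "rate a B M powr (- \<eta>) \<le> rate a B n powr (- \<eta>)"
      using r2[of n] \<eta> by (intro powr_mono2') auto
    then have "1 / rate a B n * (1 / 2) \<le> 1 / rate a B n * rate a B n powr (- \<eta>)"
      unfolding half using r2[of n] by (intro mult_left_mono) auto
    also have "\<dots> = rate a B n powr (- 1) * rate a B n powr (- \<eta>)" using r2[of n] by (simp add: powr_minus_divide)
    also have "\<dots> = rate a B n powr (- (1 + \<eta>))" by (subst powr_add[symmetric]) simp
    finally show "1 / rate a B n * (1 / 2) \<le> rate a B n powr (- (1 + \<eta>))" .
  qed
  finally show thesis using that[of M \<eta>] \<eta> by (simp add: M_def)
qed

text \<open>Words with product of rates at most R ^ j lead to nodes with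
  \<open>fst u \<le> fst v * R ^ j\<close>, and up to a constant there are at least R ^ j powr (1 +
  \<eta>) of them. Taking j with j * \<eta> \<ge> 8 yields the surplus R ^ 8 over the size of
  \<open>fst u\<close> that pays for the pairs with equal \<open>fst\<close>.\<close>

lemma many_nodes:
  assumes v: "node a B v" "a > 0" "B > 0"
  obtains j :: nat and \<kappa> :: real where "\<kappa> > 0"
    "\<And>R::nat. R \<ge> 1 \<Longrightarrow> \<exists>G \<subseteq> orbit a B v. finite G \<and> (\<forall>u\<in>G. node a B u \<and> fst v \<le> fst u \<and> fst u \<le> fst v * R ^ j)
       \<and> real (card G) \<ge> \<kappa> * real R ^ (j + 8)"
proof -
  obtain M \<eta> where M: "M > 0" "\<eta> > 0" "(\<Sum>n\<in>{1..M}. rate a B n powr (- (1 + \<eta>))) \<ge> 1"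
    using harmonic_words_exponent[OF v(2,3)] .
  obtain j :: nat where j: "8 / \<eta> \<le> real j" using real_arch_simple by blast
  define \<kappa> where "\<kappa> = rate a B M powr (- (1 + \<eta>))"
  show thesis
  proof (rule that[of \<kappa> j])
    show "\<kappa> > 0" using rate_ge[OF v(2,3), of M] by (simp add: \<kappa>_def)
    fix R :: nat assume R: "R \<ge> 1"
    let ?r = "real R ^ j"
    let ?G = "foldl (child a B) v ` words a B M ?r"
    have w: "ws \<in> lists {1..M}" "prod_list (map (rate a B) ws) \<le> ?r" if "ws \<in> words a B M ?r" for ws
      using that by (auto simp: words_def)
    have r1: "?r \<ge> 1" using R by simp
    have "card ?G = card (words a B M ?r)"
      by (rule card_image, rule inj_on_subset[OF inj_run[OF v]]) (use w(1) in blast)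
    moreover have "real (card (words a B M ?r)) \<ge> \<kappa> * ?r powr (1 + \<eta>)"
      unfolding \<kappa>_def using M r1 by (intro card_words_ge[OF v(2,3)]) auto
    moreover have "?r powr (1 + \<eta>) \<ge> real R ^ (j + 8)"
    proof -
      have "?r powr (1 + \<eta>) = real R powr (real j * (1 + \<eta>))"
        using R by (simp add: powr_realpow[symmetric] powr_powr)
      also have "\<dots> \<ge> real R powr real (j + 8)"
        using R j M(2) by (intro powr_mono) (auto simp: field_simps)
      also have "real R powr real (j + 8) = real R ^ (j + 8)" by (rule powr_realpow) (use R in simp)
      finally show ?thesis .
    qed
    then have "\<kappa> * ?r powr (1 + \<eta>) \<ge> \<kappa> * real R ^ (j + 8)"
      by (intro mult_left_mono) (auto simp: \<kappa>_def)
    ultimately have "real (card ?G) \<ge> \<kappa> * real R ^ (j + 8)" by linarith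
    moreover have "fst (foldl (child a B) v ws) \<le> fst v * R ^ j" if "ws \<in> words a B M ?r" for ws
    proof -
      have "real (fst (foldl (child a B) v ws)) \<le> real (fst v) * ?r"
        using run_word(4)[OF v w(1)[OF that]] w(2)[OF that]
        by (meson mult_left_mono of_nat_0_le_iff order_trans)
      then have "real (fst (foldl (child a B) v ws)) \<le> real (fst v * R ^ j)" by simp
      then show ?thesis by (simp only: of_nat_le_iff)
    qed
    ultimately show "\<exists>G \<subseteq> orbit a B v. finite G \<and> (\<forall>u\<in>G. node a B u \<and> fst v \<le> fst u \<and> fst u \<le> fst v * R ^ j)
       \<and> real (card G) \<ge> \<kappa> * real R ^ (j + 8)"
      using run_word[OF v w(1)] finite_words[OF v(2,3)] by (intro exI[of _ ?G]) auto
  qed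
qed

section \<open>The second moment\<close>

text \<open>\<open>Y\<close> bounds the lower left entries, \<open>X\<close> the exponents n,
  \<open>R\<close> is the sieve level and \<open>N\<close> the range of traces. \<open>K\<close>
  dominates every integer whose divisors are counted, and \<Delta> collects the losses smaller than
  any power: divisor counts and a logarithm. The assumption \<open>bad\<close> says that each prime
  dividing B * b * h divides a.\<close>

locale divisor_moments =
  fixes a B b h R X Y N K :: nat and \<Delta> :: real and G :: "(nat \<times> nat) set"
  assumes a_pos: "a > 0" and B_pos: "B > 0" and b_pos: "b > 0" and h_pos: "h > 0"
    and bad: "\<And>k. coprime k a \<Longrightarrow> coprime k (B * b * h)"
    and finite_G: "finite G" and G_nonempty: "G \<noteq> {}"
    and G_gt: "\<And>v. v \<in> G \<Longrightarrow> h ^ 2 < fst v" and G_le: "\<And>v. v \<in> G \<Longrightarrow> fst v \<le> Y"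
    and G_node: "\<And>v. v \<in> G \<Longrightarrow> node a B v"
    and R_pos: "R \<ge> 1" and X_ge: "X \<ge> 2 * R ^ 3"
    and \<Delta>_div: "\<And>k. 0 < k \<Longrightarrow> k \<le> K \<Longrightarrow> real (card {d. d dvd k}) \<le> \<Delta>"
    and P_le: "a * B * Y * (X + 2) \<le> K"
    and T_le: "b * h * Y * N + b ^ 2 * Y ^ 2 + h ^ 2 \<le> K"
    and E_le: "b ^ 2 * Y ^ 3 \<le> K"
    and ln_le: "1 + ln (real (a * B * Y * (X + 2))) \<le> \<Delta>"
begin

definition P :: nat where "P = a * B * Y * (X + 2)"
definition md :: "nat \<times> nat \<Rightarrow> nat" where "md v = a * B * fst v"
definition st :: "nat \<times> nat \<Rightarrow> nat" where "st v = fst v + a * snd v"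
definition x :: "nat \<times> nat \<Rightarrow> nat \<Rightarrow> nat" where "x v n = st v + md v * n"
definition T :: "nat \<Rightarrow> int \<Rightarrow> int" where "T c \<tau> = int (b ^ 2 * c ^ 2 + h ^ 2) + int (b * h * c) * \<tau>"
text \<open>The integers from -N to N, in the half-open form of
  \<open>card_cong_interval\<close>.\<close>

definition J :: "int set" where "J = {- int N..<- int N + int (2 * N + 1)}"
definition L :: real where "L = real (2 * N + 1)"
text \<open>As \<open>x v n\<close> is prime to \<open>md v\<close>, a number sharing a factor with
  \<open>md v\<close> cannot divide it; the sieve therefore runs over the numbers prime to
  \<open>md v\<close>.\<close>

definition nu :: "nat \<times> nat \<Rightarrow> nat \<Rightarrow> real" where
  "nu v n = (\<Sum>d\<in>{d\<in>sieve_range R (md v). d dvd x v n}. sieve_weight R (md v) d)"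
text \<open>A residue class modulo x has density 1 / x; the factor \<open>x v n\<close> makes each n
  contribute \<open>nu v n\<close> on average.\<close>

definition f :: "nat \<times> nat \<Rightarrow> int \<Rightarrow> real" where
  "f v \<tau> = (\<Sum>n\<in>{1..X}. if int (x v n) dvd T (fst v) \<tau> then nu v n * real (x v n) else 0)"
definition A :: "nat \<times> nat \<Rightarrow> nat \<Rightarrow> real" where
  "A v k = (\<Sum>n\<in>{1..X}. if k dvd x v n then nu v n else 0)"
definition cnt :: "nat \<times> nat \<Rightarrow> nat \<Rightarrow> real" where
  "cnt v n = real (card {\<tau>\<in>J. int (x v n) dvd T (fst v) \<tau>})"
text \<open>What remains of T c \<tau> and T c' \<tau> after eliminating \<tau>, as
  \<open>T_E\<close> shows, factored so that its zeros are visible.\<close>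

definition E :: "nat \<Rightarrow> nat \<Rightarrow> int" where
  "E c c' = (int c - int c') * (int (b ^ 2 * c * c') - int (h ^ 2))"
text \<open>The weighted joint density of two residue classes whose moduli have gcd g and which are
  compatible exactly if g divides D.\<close>

definition w :: "int \<Rightarrow> nat \<Rightarrow> real" where "w D g = (if int g dvd D then real g else 0)"

lemma G_pos: "v \<in> G \<Longrightarrow> fst v > 0"
  using G_gt by fastforce

lemma Y_pos: "Y > 0"
  using G_nonempty G_pos G_le by fastforce

lemma P_pos: "P > 0"
  using a_pos B_pos Y_pos by (simp add: P_def)

lemma \<Delta>_ge1: "\<Delta> \<ge> 1"
  using ln_le P_pos ln_ge_zero[of "real P"] unfolding P_def[symmetric] by linarith

lemma finite_J [simp]: "finite J" and card_J: "card J = 2 * N + 1"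
  by (auto simp: J_def)

lemma x_pos: "v \<in> G \<Longrightarrow> x v n > 0"
  using G_pos by (simp add: x_def st_def)

lemma x_child: "x v n = fst (child a B v n)"
  by (simp add: x_def st_def md_def child_def algebra_simps)

lemma x_le:
  assumes "v \<in> G" "n \<le> X"
  shows "x v n \<le> P"
proof -
  have "x v n \<le> fst v * (a * B * (n + 2))"
    unfolding x_child by (rule child_le[OF G_node[OF assms(1)] a_pos B_pos])
  also have "\<dots> \<le> Y * (a * B * (X + 2))" using assms G_le by (intro mult_mono) auto
  also have "\<dots> = P" by (simp add: P_def algebra_simps)
  finally show ?thesis .
qed

lemma x_coprime_a: "v \<in> G \<Longrightarrow> coprime (x v n) a"
  using node_child[OF G_node a_pos B_pos, of v n] by (simp add: node_def x_child)

lemma x_coprime_fst: "v \<in> G \<Longrightarrow> coprime (x v n) (fst v)"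
  using child_coprime_parent[OF G_node, of v n] by (simp add: x_child)

lemma x_coprime_md: "v \<in> G \<Longrightarrow> coprime (x v n) (md v)"
  using x_coprime_a[of v n] x_coprime_fst[of v n] bad[of "x v n"] by (simp add: md_def)

lemma x_coprime_T: "v \<in> G \<Longrightarrow> coprime (x v n) (b * h * fst v)"
  using x_coprime_a[of v n] x_coprime_fst[of v n] bad[of "x v n"] by simp

section \<open>Sums of the sieve weight over multiples\<close>

lemma abs_nu_le: "\<bar>nu v n\<bar> \<le> real R ^ 3"
proof -
  have "\<bar>nu v n\<bar> \<le> (\<Sum>d\<in>{d\<in>sieve_range R (md v). d dvd x v n}. real R ^ 2)"
    unfolding nu_def by (rule sum_abs[THEN order_trans], rule sum_mono, rule abs_sieve_weight_le) simp
  also have "\<dots> = real (card {d\<in>sieve_range R (md v). d dvd x v n}) * real R ^ 2" by simp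
  also have "\<dots> \<le> real R * real R ^ 2"
  proof -
    have "card {d\<in>sieve_range R (md v). d dvd x v n} \<le> R"
      using card_mono[of "sieve_range R (md v)" "{d\<in>sieve_range R (md v). d dvd x v n}"]
        card_sieve_range_le[of R "md v"] by fastforce
    then show ?thesis by (intro mult_right_mono) auto
  qed
  finally show ?thesis by (simp add: power3_eq_cube power2_eq_square)
qed

text \<open>Expanding \<open>nu\<close> replaces k dvd x v n by lcm d k dvd x v n, a linear
  congruence in n that is counted up to an error 1. At most R values of d with weights at most R ^ 2
  give the error R ^ 3; the main term is evaluated by \<open>sum_sieve_weight_lcm\<close>.\<close>

lemma A_approx:
  assumes v: "v \<in> G" and k: "k > 0" "coprime k (md v)"
  shows "\<bar>A v k - real X * ((\<Sum>j\<in>{j. j dvd k \<and> j \<le> R}. mobius j) / real k)\<bar> \<le> real R ^ 3"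
proof -
  let ?D = "sieve_range R (md v)"
  let ?c = "\<lambda>d. real (card {n\<in>{1..X}. lcm d k dvd st v + md v * n})"
  have "A v k = (\<Sum>n\<in>{1..X}. \<Sum>d\<in>?D. if lcm d k dvd st v + md v * n then sieve_weight R (md v) d else 0)"
    unfolding A_def nu_def
  proof (intro sum.cong refl)
    fix n
    show "(if k dvd x v n then \<Sum>d\<in>{d\<in>?D. d dvd x v n}. sieve_weight R (md v) d else 0)
      = (\<Sum>d\<in>?D. if lcm d k dvd st v + md v * n then sieve_weight R (md v) d else 0)"
      unfolding sum.inter_filter[OF finite_sieve_range] x_def by (cases "k dvd st v + md v * n") simp_all
  qed
  also have "\<dots> = (\<Sum>d\<in>?D. sieve_weight R (md v) d * ?c d)"
    by (subst sum.swap) (simp add: sum.inter_filter[symmetric] mult.commute)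
  finally have eq: "A v k = (\<Sum>d\<in>?D. sieve_weight R (md v) d * ?c d)" .
  have "\<bar>A v k - (\<Sum>d\<in>?D. sieve_weight R (md v) d * (real X / real (lcm d k)))\<bar>
     = \<bar>\<Sum>d\<in>?D. sieve_weight R (md v) d * (?c d - real X / real (lcm d k))\<bar>"
    unfolding eq by (simp add: sum_subtractf right_diff_distrib)
  also have "\<dots> \<le> (\<Sum>d\<in>?D. real R ^ 2 * 1)"
  proof (rule sum_abs[THEN order_trans], rule sum_mono)
    fix d assume d: "d \<in> ?D"
    then have "coprime d (md v)" "d > 0" by (auto simp: sieve_range_def)
    then have "coprime (d * k) (md v)" using k by simp
    then have "coprime (lcm d k) (md v)"
      by (rule coprime_divisors[rotated 2]) (simp_all add: lcm_least_iff)
    moreover have "lcm d k > 0" using \<open>d > 0\<close> k by (simp add: lcm_pos_nat)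
    ultimately have "\<bar>?c d - real X / real (lcm d k)\<bar> \<le> 1" by (rule card_linear_multiples)
    then show "\<bar>sieve_weight R (md v) d * (?c d - real X / real (lcm d k))\<bar> \<le> real R ^ 2 * 1"
      unfolding abs_mult using abs_sieve_weight_le[OF d] by (intro mult_mono) auto
  qed
  also have "\<dots> = real (card ?D) * real R ^ 2" by simp
  also have "\<dots> \<le> real R * real R ^ 2"
    using card_sieve_range_le[of R "md v"] by (intro mult_right_mono) auto
  finally have "\<bar>A v k - (\<Sum>d\<in>?D. sieve_weight R (md v) d * (real X / real (lcm d k)))\<bar> \<le> real R ^ 3"
    by (simp add: power3_eq_cube power2_eq_square)
  moreover have "(\<Sum>d\<in>?D. sieve_weight R (md v) d * (real X / real (lcm d k)))
     = real X * ((\<Sum>j\<in>{j. j dvd k \<and> j \<le> R}. mobius j) / real k)"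
    unfolding sum_sieve_weight_lcm[OF k, symmetric] sum_distrib_left
    by (intro sum.cong refl) simp
  ultimately show ?thesis by simp
qed

lemma A_1: "v \<in> G \<Longrightarrow> \<bar>A v 1 - real X\<bar> \<le> real R ^ 3"
proof -
  assume v: "v \<in> G"
  have "{j::nat. j dvd 1 \<and> j \<le> R} = {1}" using R_pos by auto
  then have "(\<Sum>j\<in>{j::nat. j dvd 1 \<and> j \<le> R}. mobius j) = 1" by simp
  then show ?thesis using A_approx[OF v, of 1] by simp
qed

text \<open>If k is not prime to \<open>md v\<close>, it divides no x v n. Otherwise the Moebius sum
  in \<open>A_approx\<close> is complete and vanishes for k \<le> R, while for k > R it is bounded
  by the number of divisors of k.\<close>

lemma abs_A_le:
  assumes v: "v \<in> G" and k: "1 < k" "k \<le> K"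
  shows "\<bar>A v k\<bar> \<le> real R ^ 3 + (if k \<le> R then 0 else real X * \<Delta> / real k)"
proof (cases "coprime k (md v)")
  case False
  have "\<not> k dvd x v n" for n
  proof
    assume "k dvd x v n"
    then have "coprime k (md v)" by (rule coprime_divisors[OF _ dvd_refl x_coprime_md[OF v]])
    then show False using False by simp
  qed
  then have "A v k = 0" by (simp add: A_def)
  then show ?thesis using \<Delta>_ge1 by simp
next
  case True
  let ?S = "\<Sum>j\<in>{j. j dvd k \<and> j \<le> R}. mobius j"
  have ap: "\<bar>A v k - real X * (?S / real k)\<bar> \<le> real R ^ 3" using A_approx[OF v _ True] k by simp
  have "\<bar>real X * (?S / real k)\<bar> \<le> (if k \<le> R then 0 else real X * \<Delta> / real k)"
  proof (cases "k \<le> R")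
    case True
    have "{j. j dvd k \<and> j \<le> R} = {j. j dvd k}" using True k by (auto dest: dvd_imp_le)
    then show ?thesis using sum_mobius_divisors[of k] k True by simp
  next
    case False
    have "\<bar>?S\<bar> \<le> (\<Sum>j\<in>{j. j dvd k \<and> j \<le> R}. 1)"
      by (rule sum_abs[THEN order_trans], rule sum_mono, rule abs_mobius_le)
    also have "\<dots> = real (card {j. j dvd k \<and> j \<le> R})" by simp
    also have "\<dots> \<le> real (card {j. j dvd k})"
      using k by (intro of_nat_mono card_mono) auto
    also have "\<dots> \<le> \<Delta>" using \<Delta>_div k by simp
    finally have "\<bar>?S\<bar> \<le> \<Delta>" .
    then have "real X * (\<bar>?S\<bar> / real k) \<le> real X * (\<Delta> / real k)"
      by (intro mult_left_mono divide_right_mono) auto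
    then show ?thesis using False by (simp add: abs_mult)
  qed
  moreover have "\<bar>A v k\<bar> \<le> real R ^ 3 + \<bar>real X * (?S / real k)\<bar>"
    using abs_triangle_ineq[of "A v k - real X * (?S / real k)" "real X * (?S / real k)"] ap by simp
  ultimately show ?thesis by (meson add_left_mono order_trans)
qed

text \<open>The main terms are present only for k > R, so one of the two factors 1 / k may be
  replaced by 1 / R. This is the saving that survives to the end.\<close>

lemma abs_A_mult_le:
  assumes "v \<in> G" "v' \<in> G" "1 < k" "k \<le> K"
  shows "\<bar>A v k * A v' k\<bar> \<le> 2 * real R ^ 6 + 2 * real X ^ 2 * \<Delta> ^ 2 / (real R * real k)"
proof -
  let ?t = "if k \<le> R then 0 else real X * \<Delta> / real k"
  have t0: "?t \<ge> 0" using \<Delta>_ge1 by simp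
  have "\<bar>A v k * A v' k\<bar> \<le> (real R ^ 3 + ?t) * (real R ^ 3 + ?t)"
    unfolding abs_mult using abs_A_le[OF assms(1,3,4)] abs_A_le[OF assms(2,3,4)] t0
    by (intro mult_mono) auto
  also have "\<dots> = (real R ^ 3 + ?t) ^ 2" by (simp add: power2_eq_square)
  also have "\<dots> \<le> 2 * (real R ^ 3) ^ 2 + 2 * ?t ^ 2"
    using sum_squares_bound[of "real R ^ 3" "?t"] by (simp add: power2_sum)
  also have "(real R ^ 3) ^ 2 = real R ^ 6" by simp
  also have "?t ^ 2 \<le> real X ^ 2 * \<Delta> ^ 2 / (real R * real k)"
  proof (cases "k \<le> R")
    case False
    have "?t ^ 2 = real X ^ 2 * \<Delta> ^ 2 / (real k * real k)" using False
      by (simp add: power_divide power_mult_distrib power2_eq_square)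
    also have "\<dots> \<le> real X ^ 2 * \<Delta> ^ 2 / (real R * real k)"
      using False R_pos by (intro divide_left_mono mult_right_mono) auto
    finally show ?thesis .
  qed (use \<Delta>_ge1 in simp)
  finally show ?thesis by simp
qed

section \<open>Residue classes and their compatibility\<close>

lemma T_cong:
  assumes "v \<in> G"
  obtains r where "\<And>\<tau>. int (x v n) dvd T (fst v) \<tau> \<longleftrightarrow> [\<tau> = r] (mod int (x v n))"
proof -
  have "coprime (int (x v n)) (int (b * h * fst v))" using x_coprime_T[OF assms] by (simp only: coprime_int_iff)
  then show thesis
    using linear_cong_int_iff[of "int (x v n)" "int (b * h * fst v)" "int (b ^ 2 * fst v ^ 2 + h ^ 2)"] that
    unfolding T_def by metis
qed

lemma x_count:
  assumes "v \<in> G"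
  shows "\<bar>real (x v n) * cnt v n - L\<bar> \<le> real (x v n)"
proof -
  let ?x = "x v n"
  obtain r where r: "\<And>\<tau>. int ?x dvd T (fst v) \<tau> \<longleftrightarrow> [\<tau> = r] (mod int ?x)" using T_cong[OF assms] by blast
  have xp: "real ?x > 0" using x_pos[OF assms] by simp
  have "\<bar>cnt v n - L / real ?x\<bar> \<le> 1"
    unfolding cnt_def r J_def L_def using card_cong_interval[of "int ?x" "- int N" "2 * N + 1" r] xp by simp
  then have "real ?x * \<bar>cnt v n - L / real ?x\<bar> \<le> real ?x * 1"
    by (rule mult_left_mono) simp
  also have "real ?x * \<bar>cnt v n - L / real ?x\<bar>
     = \<bar>real ?x * (cnt v n - L / real ?x)\<bar>"
    by (simp add: abs_mult)
  also have "real ?x * (cnt v n - L / real ?x)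
     = real ?x * cnt v n - L"
    using xp by (simp add: right_diff_distrib)
  finally show ?thesis by simp
qed

lemma T_E: "int c' * T c \<tau> - int c * T c' \<tau> = E c c'"
  by (simp add: T_def E_def algebra_simps power2_eq_square)

text \<open>Let g be the gcd of the two moduli. Both \<open>fst v\<close> and b * h *
  \<open>fst v'\<close> are invertible modulo g, so by \<open>T_E\<close> the two residues agree
  modulo g exactly if g divides E. They then form one class modulo the lcm, whose density times the
  product of the moduli is g.\<close>

lemma pair_count:
  assumes v: "v \<in> G" "v' \<in> G"
  shows "\<bar>real (x v n) * real (x v' n') *
       real (card {\<tau>\<in>J. int (x v n) dvd T (fst v) \<tau> \<and> int (x v' n') dvd T (fst v') \<tau>})
       - L * w (E (fst v) (fst v')) (gcd (x v n) (x v' n'))\<bar> \<le> real (x v n) * real (x v' n')"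
proof -
  let ?x = "x v n" and ?y = "x v' n'"
  let ?g = "gcd ?x ?y"
  obtain r where r: "\<And>\<tau>. int ?x dvd T (fst v) \<tau> \<longleftrightarrow> [\<tau> = r] (mod int ?x)" using T_cong[OF v(1)] by blast
  obtain s where s: "\<And>\<tau>. int ?y dvd T (fst v') \<tau> \<longleftrightarrow> [\<tau> = s] (mod int ?y)" using T_cong[OF v(2)] by blast
  have xp: "real ?x > 0" "real ?y > 0" using x_pos v by auto
  have cop: "coprime (int ?g) (int (b * h * fst v'))"
    by (subst coprime_int_iff) (rule coprime_divisors[OF _ dvd_refl x_coprime_T[OF v(2), of n']], simp)
  have copc: "coprime (int ?g) (int (fst v))"
    by (subst coprime_int_iff) (rule coprime_divisors[OF _ dvd_refl x_coprime_fst[OF v(1), of n]], simp)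
  have gE: "int ?g dvd E (fst v) (fst v') \<longleftrightarrow> [r = s] (mod gcd (int ?x) (int ?y))"
  proof -
    have gx: "int ?g dvd int ?x" "int ?g dvd int ?y" by (simp_all only: of_nat_dvd_iff gcd_dvd1 gcd_dvd2)
    have "int ?x dvd T (fst v) r" using r by simp
    then have 1: "int ?g dvd int (fst v') * T (fst v) r" using gx(1) by (meson dvd_mult dvd_trans)
    have "int ?y dvd T (fst v') s" using s by simp
    then have 2: "int ?g dvd T (fst v') s" using gx(2) by (meson dvd_trans)
    have "int ?g dvd E (fst v) (fst v') \<longleftrightarrow> int ?g dvd int (fst v) * T (fst v') r"
      unfolding T_E[of "fst v'" "fst v" r, symmetric] using 1 by (simp add: dvd_diff_right_iff)
    also have "\<dots> \<longleftrightarrow> int ?g dvd T (fst v') r" using copc by (simp add: coprime_dvd_mult_right_iff)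
    also have "\<dots> \<longleftrightarrow> int ?g dvd T (fst v') r - T (fst v') s" using 2 by (simp add: dvd_diff_left_iff)
    also have "T (fst v') r - T (fst v') s = int (b * h * fst v') * (r - s)"
      by (simp add: T_def algebra_simps)
    also have "int ?g dvd \<dots> \<longleftrightarrow> int ?g dvd r - s" using cop by (simp only: coprime_dvd_mult_right_iff)
    finally show ?thesis by (simp add: cong_iff_dvd_diff)
  qed
  show ?thesis
  proof (cases "int ?g dvd E (fst v) (fst v')")
    case True
    then obtain z where z: "\<And>t. [t = r] (mod int ?x) \<and> [t = s] (mod int ?y) \<longleftrightarrow> [t = z] (mod lcm (int ?x) (int ?y))"
      using cong_pair_int_iff gE by metis
    have lp: "lcm ?x ?y > 0" using xp by (simp add: lcm_pos_nat)
    have lg: "real ?x * real ?y = real (lcm ?x ?y) * real ?g"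
      by (metis of_nat_mult prod_gcd_lcm_nat mult.commute)
    have gp: "real ?g > 0" using xp by simp
    let ?c = "real (card {\<tau>\<in>J. int ?x dvd T (fst v) \<tau> \<and> int ?y dvd T (fst v') \<tau>})"
    have "\<bar>?c - L / real (lcm ?x ?y)\<bar> \<le> 1"
      unfolding r s z J_def L_def lcm_int_int_eq using card_cong_interval[of "int (lcm ?x ?y)" "- int N" "2 * N + 1" z] lp by simp
    then have "(real ?x * real ?y) * \<bar>?c - L / real (lcm ?x ?y)\<bar> \<le> real ?x * real ?y * 1"
      by (rule mult_left_mono) simp
    also have "(real ?x * real ?y) * \<bar>?c - L / real (lcm ?x ?y)\<bar> = \<bar>(real ?x * real ?y) * (?c - L / real (lcm ?x ?y))\<bar>"
      by (simp add: abs_mult)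
    also have "(real ?x * real ?y) * (?c - L / real (lcm ?x ?y)) = real ?x * real ?y * ?c - L * real ?g"
    proof -
      have "(real ?x * real ?y) * (L / real (lcm ?x ?y)) = L * real ?g"
        unfolding lg using lp xp by (simp add: field_simps)
      then show ?thesis by (simp add: right_diff_distrib)
    qed
    finally show ?thesis using True by (simp add: w_def)
  next
    case False
    have emp: "{\<tau>\<in>J. int ?x dvd T (fst v) \<tau> \<and> int ?y dvd T (fst v') \<tau>} = {}"
    proof (rule ccontr)
      assume "\<not> ?thesis"
      then obtain \<tau> where "[\<tau> = r] (mod int ?x)" "[\<tau> = s] (mod int ?y)" unfolding r s by auto
      then have "[\<tau> = r] (mod gcd (int ?x) (int ?y))" "[\<tau> = s] (mod gcd (int ?x) (int ?y))"
        by (auto intro: cong_dvd_modulus)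
      then have "[r = s] (mod gcd (int ?x) (int ?y))" by (meson cong_sym cong_trans)
      then show False using False gE by simp
    qed
    show ?thesis unfolding emp using False by (simp add: w_def)
  qed
qed

section \<open>Pairs with different lower left entries\<close>

lemma E_nonzero:
  assumes "v \<in> G" "v' \<in> G" "fst v \<noteq> fst v'"
  shows "E (fst v) (fst v') \<noteq> 0"
proof -
  \<comment> \<open>\<open>h ^ 2 < fst v\<close> makes the second factor of E positive, so that only
    equal entries could make E vanish.\<close>
  have "h ^ 2 * 1 < fst v * fst v'"
    using G_gt[OF assms(1)] G_pos[OF assms(2)] by (intro mult_less_le_imp_less) auto
  also have "\<dots> \<le> b ^ 2 * (fst v * fst v')" using b_pos by simp
  finally have "int (h ^ 2) < int (b ^ 2 * fst v * fst v')" by (simp only: of_nat_less_iff mult.assoc mult_1_right)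
  then show ?thesis using assms(3) by (simp add: E_def)
qed

lemma E_bound:
  assumes "v \<in> G" "v' \<in> G"
  shows "nat \<bar>E (fst v) (fst v')\<bar> \<le> K"
proof -
  have c: "fst v \<le> Y" "fst v' \<le> Y" using G_le assms by auto
  have "h ^ 2 * 1 \<le> fst v * fst v'"
    using G_gt[OF assms(1)] G_pos[OF assms(2)] by (intro mult_mono) auto
  also have "\<dots> \<le> b ^ 2 * (fst v * fst v')" using b_pos by simp
  finally have h: "int (h ^ 2) \<le> int (b ^ 2 * fst v * fst v')" by (simp only: of_nat_le_iff mult.assoc mult_1_right)
  have "b ^ 2 * fst v * fst v' \<le> b ^ 2 * Y * Y" using c by (intro mult_mono) auto
  then have "int (b ^ 2 * fst v * fst v') \<le> int (b ^ 2 * Y * Y)" by (simp only: of_nat_le_iff)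
  then have 2: "\<bar>int (b ^ 2 * fst v * fst v') - int (h ^ 2)\<bar> \<le> int (b ^ 2 * Y * Y)" using h by linarith
  have 1: "\<bar>int (fst v) - int (fst v')\<bar> \<le> int Y" using c by linarith
  have "\<bar>E (fst v) (fst v')\<bar> \<le> int Y * int (b ^ 2 * Y * Y)"
    unfolding E_def abs_mult by (intro mult_mono 1 2) auto
  also have "\<dots> = int (b ^ 2 * Y ^ 3)" by (simp add: power3_eq_cube)
  finally show ?thesis using E_le by linarith
qed

text \<open>Moebius inversion writes w D (gcd x y) as a sum over the common divisors k of x and y,
  which separates the variables n and n'.\<close>

lemma sum_gcd_expand:
  assumes v: "v \<in> G" "v' \<in> G"
  shows "(\<Sum>n\<in>{1..X}. \<Sum>n'\<in>{1..X}. nu v n * nu v' n' * w D (gcd (x v n) (x v' n')))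
      = (\<Sum>k\<in>{1..P}. mobius_transform (w D) k * (A v k * A v' k))"
proof -
  let ?t = "mobius_transform (w D)"
  have w: "w D (gcd (x v n) (x v' n'))
     = (\<Sum>k\<in>{1..P}. if k dvd x v n \<and> k dvd x v' n' then ?t k else 0)" if "n \<in> {1..X}" for n n'
  proof -
    have g: "gcd (x v n) (x v' n') > 0" using x_pos[OF v(1)] by simp
    have "{k. k dvd gcd (x v n) (x v' n')} = {k\<in>{1..P}. k dvd x v n \<and> k dvd x v' n'}"
    proof (intro equalityI subsetI)
      fix k assume "k \<in> {k. k dvd gcd (x v n) (x v' n')}"
      then have k: "k dvd x v n" "k dvd x v' n'" by auto
      have "k \<le> x v n" "k > 0" using k x_pos[OF v(1), of n] by (auto simp: dvd_imp_le dvd_pos_nat)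
      then show "k \<in> {k\<in>{1..P}. k dvd x v n \<and> k dvd x v' n'}"
        using k x_le[OF v(1), of n] that by auto
    qed auto
    then show ?thesis
      using sum_mobius_transform[OF g, of "w D"] by (simp add: sum.inter_filter[symmetric])
  qed
  have "(\<Sum>n\<in>{1..X}. \<Sum>n'\<in>{1..X}. nu v n * nu v' n' * w D (gcd (x v n) (x v' n')))
     = (\<Sum>n\<in>{1..X}. \<Sum>n'\<in>{1..X}. \<Sum>k\<in>{1..P}.
          ?t k * ((if k dvd x v n then nu v n else 0) * (if k dvd x v' n' then nu v' n' else 0)))"
    by (intro sum.cong refl, subst w, assumption, unfold sum_distrib_left, intro sum.cong refl) simp
  also have "\<dots> = (\<Sum>k\<in>{1..P}. \<Sum>n\<in>{1..X}. \<Sum>n'\<in>{1..X}.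
          ?t k * ((if k dvd x v n then nu v n else 0) * (if k dvd x v' n' then nu v' n' else 0)))"
    by (subst (2) sum.swap, subst sum.swap, rule refl)
  also have "\<dots> = (\<Sum>k\<in>{1..P}. ?t k * (A v k * A v' k))"
    unfolding A_def by (intro sum.cong refl, subst sum_product, simp only: sum_distrib_left)
  finally show ?thesis .
qed

text \<open>For D \<noteq> 0 the sum of the common divisors of D and k; it majorises the Moebius
  transform of \<open>w D\<close>.\<close>

definition S :: "int \<Rightarrow> nat \<Rightarrow> real" where
  "S D k = (\<Sum>d | d dvd nat \<bar>D\<bar>. if d dvd k then real d else 0)"

lemma S_nonneg: "S D k \<ge> 0"
  unfolding S_def by (rule sum_nonneg) simp

lemma abs_transform_le:
  assumes "D \<noteq> 0" "k > 0"
  shows "\<bar>mobius_transform (w D) k\<bar> \<le> S D k"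
proof -
  have "\<bar>mobius_transform (w D) k\<bar> \<le> (\<Sum>d | d dvd k. if int d dvd D then real d else 0)"
    unfolding mobius_transform_def
  proof (rule sum_abs[THEN order_trans], rule sum_mono)
    fix d
    have "\<bar>mobius (k div d) * w D d\<bar> \<le> 1 * w D d"
      unfolding abs_mult using abs_mobius_le by (intro mult_mono) (auto simp: w_def)
    then show "\<bar>mobius (k div d) * w D d\<bar> \<le> (if int d dvd D then real d else 0)" by (simp add: w_def)
  qed
  also have "\<dots> = (\<Sum>d\<in>{d\<in>{d. d dvd k}. int d dvd D}. real d)"
    using assms by (intro sum.inter_filter[symmetric] finite_divisors_nat)
  also have "{d\<in>{d. d dvd k}. int d dvd D} = {d\<in>{d. d dvd nat \<bar>D\<bar>}. d dvd k}"
    by auto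
  also have "(\<Sum>d\<in>\<dots>. real d) = S D k"
    unfolding S_def using assms by (intro sum.inter_filter finite_divisors_nat) simp
  finally show ?thesis .
qed

lemma card_multiples_le: "d > 0 \<Longrightarrow> card {k\<in>{1..P}. d dvd k} * d \<le> P"
proof -
  assume d: "d > 0"
  have "{k\<in>{1..P}. d dvd k} \<subseteq> (\<lambda>j. d * j) ` {1..P div d}"
  proof
    fix k assume k: "k \<in> {k\<in>{1..P}. d dvd k}"
    then obtain j where j: "k = d * j" by (auto elim: dvdE)
    then have "j \<le> P div d" "j \<ge> 1" using k d by (auto simp: less_eq_div_iff_mult_less_eq mult.commute Suc_le_eq)
    then show "k \<in> (\<lambda>j. d * j) ` {1..P div d}" using j by auto
  qed
  then have "card {k\<in>{1..P}. d dvd k} \<le> P div d" 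
    using surj_card_le[of "{1..P div d}" "{k\<in>{1..P}. d dvd k}" "\<lambda>j. d * j"] by simp
  then have "card {k\<in>{1..P}. d dvd k} * d \<le> P div d * d" by simp
  then show ?thesis using div_times_less_eq_dividend order_trans by blast
qed

lemma harmonic_le: "(\<Sum>j\<in>{1..P}. 1 / real j) \<le> \<Delta>"
proof -
  have "(\<Sum>j\<in>{1..n}. 1 / real j) \<le> 1 + ln (real n)" if "n > 0" for n :: nat
    using that
  proof (induction n rule: nat_induct_non_zero)
    case (Suc n)
    have "1 / real (Suc n) \<le> ln (real (Suc n)) - ln (real n)"
      using ln_le_minus_one[of "real n / real (Suc n)"] Suc.hyps by (simp add: ln_div field_simps)
    then show ?case using Suc.IH by simp
  qed simp
  then show ?thesis using ln_le P_pos unfolding P_def by (meson order_trans)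
qed

lemma sum_inverse_multiples_le:
  assumes "d > 0"
  shows "(\<Sum>k\<in>{1..P}. if d dvd k then real d / real k else 0) \<le> \<Delta>"
proof -
  have "(\<Sum>k\<in>{1..P}. if d dvd k then real d / real k else 0) = (\<Sum>k\<in>{k\<in>{1..P}. d dvd k}. real d / real k)"
    by (rule sum.inter_filter[symmetric]) simp
  also have "\<dots> = (\<Sum>j\<in>(\<lambda>k. k div d) ` {k\<in>{1..P}. d dvd k}. 1 / real j)"
    using assms by (subst sum.reindex) (auto simp: inj_on_def elim!: dvdE intro!: sum.cong)
  also have "\<dots> \<le> (\<Sum>j\<in>{1..P}. 1 / real j)"
  proof (rule sum_mono2)
    show "(\<lambda>k. k div d) ` {k\<in>{1..P}. d dvd k} \<subseteq> {1..P}"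
    proof
      fix j assume "j \<in> (\<lambda>k. k div d) ` {k\<in>{1..P}. d dvd k}"
      then obtain k where k: "j = k div d" "1 \<le> k" "k \<le> P" "d dvd k" by auto
      then have "k = d * j" by simp
      then have "j > 0" "j \<le> k" using k assms by (auto intro: Nat.gr0I)
      then show "j \<in> {1..P}" using k(3) by (simp only: atLeastAtMost_iff) linarith
    qed
  qed auto
  also have "\<dots> \<le> \<Delta>" by (rule harmonic_le)
  finally show ?thesis .
qed

text \<open>For each d dividing D, the multiples of d up to P contribute at most d * (P / d) = P to
  the first sum, and a harmonic sum of size at most \<Delta> to the second; D has at most \<Delta>
  divisors.\<close>

lemma sum_S_le:
  assumes "D \<noteq> 0" "nat \<bar>D\<bar> \<le> K"
  shows "(\<Sum>k\<in>{1..P}. S D k) \<le> \<Delta> * real P" "(\<Sum>k\<in>{1..P}. S D k / real k) \<le> \<Delta> ^ 2"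
proof -
  have fin: "finite {d. d dvd nat \<bar>D\<bar>}" using assms by (intro finite_divisors_nat) simp
  have dpos: "d > 0" if "d dvd nat \<bar>D\<bar>" for d using that assms by (auto intro: Nat.gr0I)
  have card: "real (card {d. d dvd nat \<bar>D\<bar>}) \<le> \<Delta>" using assms by (intro \<Delta>_div) auto
  have "(\<Sum>k\<in>{1..P}. S D k) = (\<Sum>d | d dvd nat \<bar>D\<bar>. \<Sum>k\<in>{1..P}. if d dvd k then real d else 0)"
    unfolding S_def by (rule sum.swap)
  also have "\<dots> \<le> (\<Sum>d | d dvd nat \<bar>D\<bar>. real P)"
  proof (rule sum_mono)
    fix d assume "d \<in> {d. d dvd nat \<bar>D\<bar>}"
    then have d: "d > 0" using dpos by simp
    have "(\<Sum>k\<in>{1..P}. if d dvd k then real d else 0) = real (card {k\<in>{1..P}. d dvd k} * d)"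
      by (subst sum.inter_filter[symmetric]) simp_all
    then show "(\<Sum>k\<in>{1..P}. if d dvd k then real d else 0) \<le> real P"
      using card_multiples_le[OF d] by (simp only: of_nat_le_iff)
  qed
  also have "\<dots> \<le> \<Delta> * real P" using card by (simp add: mult_right_mono)
  finally show "(\<Sum>k\<in>{1..P}. S D k) \<le> \<Delta> * real P" .
  have "(\<Sum>k\<in>{1..P}. S D k / real k)
      = (\<Sum>d | d dvd nat \<bar>D\<bar>. \<Sum>k\<in>{1..P}. if d dvd k then real d / real k else 0)"
    unfolding S_def sum_divide_distrib by (subst sum.swap, intro sum.cong refl) simp
  also have "\<dots> \<le> (\<Sum>d | d dvd nat \<bar>D\<bar>. \<Delta>)"
    by (rule sum_mono, rule sum_inverse_multiples_le) (simp add: dpos)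
  also have "\<dots> \<le> \<Delta> * \<Delta>" using card \<Delta>_ge1 by (simp add: mult_right_mono)
  finally show "(\<Sum>k\<in>{1..P}. S D k / real k) \<le> \<Delta> ^ 2" by (simp add: power2_eq_square)
qed

text \<open>The two parts of \<open>abs_A_mult_le\<close> summed over k against S: the remainder of
  the sieve, and the main terms with k > R.\<close>

definition Err :: real where
  "Err = 2 * real R ^ 6 * \<Delta> * real P + 2 * real X ^ 2 * \<Delta> ^ 4 / real R"

lemma Err_nonneg: "Err \<ge> 0"
  using \<Delta>_ge1 by (simp add: Err_def)

lemma offdiagonal_sum_le:
  assumes v: "v \<in> G" "v' \<in> G" "fst v \<noteq> fst v'"
  shows "(\<Sum>n\<in>{1..X}. \<Sum>n'\<in>{1..X}. nu v n * nu v' n' * w (E (fst v) (fst v')) (gcd (x v n) (x v' n')))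
     \<le> A v 1 * A v' 1 + Err"
proof -
  let ?D = "E (fst v) (fst v')"
  let ?t = "mobius_transform (w ?D)"
  let ?p = "\<lambda>k. ?t k * (A v k * A v' k)"
  let ?s = "\<lambda>k. S ?D k * (2 * real R ^ 6 + 2 * real X ^ 2 * \<Delta> ^ 2 / (real R * real k))"
  note D0 = E_nonzero[OF v] and DK = E_bound[OF v(1,2)]
  have PK: "P \<le> K" using P_le by (simp add: P_def)
  have t1: "?t 1 = 1"
  proof -
    have "{d::nat. d dvd 1} = {1}" by auto
    then show ?thesis by (simp add: mobius_transform_def w_def)
  qed
  \<comment> \<open>The term k = 1 carries the product of the two means; everything else goes into
    \<open>Err\<close>.\<close>
  have split: "(\<Sum>k\<in>{1..P}. ?p k)
     = ?p 1 + (\<Sum>k\<in>{2..P}. ?p k)"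
    using P_pos by (subst sum.atLeast_Suc_atMost) (auto simp: numeral_2_eq_2)
  have "(\<Sum>k\<in>{2..P}. ?p k)
     \<le> (\<Sum>k\<in>{2..P}. ?s k)"
  proof (rule sum_mono)
    fix k assume k: "k \<in> {2..P}"
    have "?p k \<le> \<bar>?t k\<bar> * \<bar>A v k * A v' k\<bar>" by (simp only: abs_ge_self flip: abs_mult)
    also have "\<dots> \<le> ?s k"
      using abs_transform_le[OF D0, of k] abs_A_mult_le[OF v(1,2), of k] k PK
      by (intro mult_mono S_nonneg) auto
    finally show "?p k \<le> ?s k" .
  qed
  also have "\<dots> \<le> (\<Sum>k\<in>{1..P}. ?s k)"
    by (rule sum_mono2, simp, force, rule mult_nonneg_nonneg, rule S_nonneg) simp
  also have "\<dots> = 2 * real R ^ 6 * (\<Sum>k\<in>{1..P}. S ?D k)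
       + 2 * real X ^ 2 * \<Delta> ^ 2 / real R * (\<Sum>k\<in>{1..P}. S ?D k / real k)"
    unfolding sum_distrib_left sum.distrib[symmetric] by (intro sum.cong refl) (simp add: algebra_simps)
  also have "\<dots> \<le> 2 * real R ^ 6 * (\<Delta> * real P) + 2 * real X ^ 2 * \<Delta> ^ 2 / real R * \<Delta> ^ 2"
    using sum_S_le[OF D0 DK] by (intro add_mono mult_left_mono) auto
  also have "\<dots> = Err" by (simp add: Err_def flip: power_add)
  finally have "(\<Sum>k\<in>{2..P}. ?p k) \<le> Err" .
  then show ?thesis unfolding sum_gcd_expand[OF v(1,2)] split t1 by simp
qed

lemma offdiagonal_le:
  assumes v: "v \<in> G" "v' \<in> G" "fst v \<noteq> fst v'"
  shows "(\<Sum>\<tau>\<in>J. f v \<tau> * f v' \<tau>) \<le> L * (A v 1 * A v' 1 + Err) + real X ^ 2 * real R ^ 6 * real P ^ 2"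
proof -
  let ?c = "\<lambda>n n'. real (card {\<tau>\<in>J. int (x v n) dvd T (fst v) \<tau> \<and> int (x v' n') dvd T (fst v') \<tau>})"
  let ?w = "\<lambda>n n'. w (E (fst v) (fst v')) (gcd (x v n) (x v' n'))"
  let ?i = "\<lambda>n n' \<tau>. if int (x v n) dvd T (fst v) \<tau> \<and> int (x v' n') dvd T (fst v') \<tau>
      then nu v n * nu v' n' * (real (x v n) * real (x v' n')) else 0"
  have "(\<Sum>\<tau>\<in>J. f v \<tau> * f v' \<tau>) = (\<Sum>\<tau>\<in>J. \<Sum>n\<in>{1..X}. \<Sum>n'\<in>{1..X}. ?i n n' \<tau>)"
    unfolding f_def sum_product by (intro sum.cong refl) simp
  also have "\<dots> = (\<Sum>n\<in>{1..X}. \<Sum>n'\<in>{1..X}. \<Sum>\<tau>\<in>J. ?i n n' \<tau>)"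
    by (subst sum.swap, subst (2) sum.swap, rule refl)
  also have "\<dots> = (\<Sum>n\<in>{1..X}. \<Sum>n'\<in>{1..X}. nu v n * nu v' n' * (real (x v n) * real (x v' n') * ?c n n'))"
    by (intro sum.cong refl, subst sum.inter_filter[symmetric]) simp_all
  also have "\<dots> \<le> (\<Sum>n\<in>{1..X}. \<Sum>n'\<in>{1..X}. L * (nu v n * nu v' n' * ?w n n') + real R ^ 6 * real P ^ 2)"
  proof (intro sum_mono)
    fix n n' assume n: "n \<in> {1..X}" "n' \<in> {1..X}"
    let ?p = "real (x v n) * real (x v' n')"
    have xx: "?p \<le> real P * real P"
      using x_le[OF v(1), of n] x_le[OF v(2), of n'] n by (intro mult_mono) auto
    have "nu v n * nu v' n' * (?p * ?c n n') - L * (nu v n * nu v' n' * ?w n n')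
        = (nu v n * nu v' n') * (?p * ?c n n' - L * ?w n n')" by (simp add: algebra_simps)
    also have "\<dots> \<le> \<bar>nu v n * nu v' n'\<bar> * \<bar>?p * ?c n n' - L * ?w n n'\<bar>" by (simp only: abs_ge_self flip: abs_mult)
    also have "\<dots> \<le> (real R ^ 3 * real R ^ 3) * (real P * real P)"
    proof (rule mult_mono)
      show "\<bar>nu v n * nu v' n'\<bar> \<le> real R ^ 3 * real R ^ 3"
        unfolding abs_mult by (intro mult_mono abs_nu_le) auto
      show "\<bar>?p * ?c n n' - L * ?w n n'\<bar> \<le> real P * real P"
        using pair_count[OF v(1,2), of n n'] xx by linarith
    qed auto
    finally show "nu v n * nu v' n' * (?p * ?c n n') \<le> L * (nu v n * nu v' n' * ?w n n') + real R ^ 6 * real P ^ 2"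
      by (simp add: power2_eq_square flip: power_add)
  qed
  also have "\<dots> = L * (\<Sum>n\<in>{1..X}. \<Sum>n'\<in>{1..X}. nu v n * nu v' n' * ?w n n') + real X ^ 2 * real R ^ 6 * real P ^ 2"
    unfolding sum.distrib sum_distrib_left[symmetric] by (simp add: power2_eq_square)
  also have "\<dots> \<le> L * (A v 1 * A v' 1 + Err) + real X ^ 2 * real R ^ 6 * real P ^ 2"
    using offdiagonal_sum_le[OF v] by (intro add_right_mono mult_left_mono) (auto simp: L_def)
  finally show ?thesis .
qed

section \<open>Pairs with equal lower left entry\<close>

lemma T_nonzero:
  assumes v: "v \<in> G"
  shows "T (fst v) \<tau> \<noteq> 0"
proof
  assume "T (fst v) \<tau> = 0"
  \<comment> \<open>Modulo \<open>fst v\<close> the value of T is h ^ 2, which is positive and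
    smaller than \<open>fst v\<close>.\<close>
  then have "int (h ^ 2) = int (fst v) * (- (int (b ^ 2 * fst v) + int (b * h) * \<tau>))"
    by (simp add: T_def algebra_simps power2_eq_square)
  then have "int (fst v) dvd int (h ^ 2)" by (rule dvdI)
  then have "fst v dvd h ^ 2" by (simp only: int_dvd_int_iff)
  then have "fst v \<le> h ^ 2" using h_pos by (intro dvd_imp_le) auto
  then show False using G_gt[OF v] by simp
qed

lemma T_bound:
  assumes v: "v \<in> G" and \<tau>: "\<tau> \<in> J"
  shows "nat \<bar>T (fst v) \<tau>\<bar> \<le> K"
proof -
  have "\<bar>\<tau>\<bar> \<le> int N" using \<tau> by (auto simp: J_def)
  moreover have "int (b * h * fst v) \<le> int (b * h * Y)"
    using G_le[OF v] by (simp only: of_nat_le_iff mult_le_mono2)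
  ultimately have "int (b * h * fst v) * \<bar>\<tau>\<bar> \<le> int (b * h * Y) * int N"
    by (intro mult_mono) auto
  moreover have "b ^ 2 * fst v ^ 2 + h ^ 2 \<le> b ^ 2 * Y ^ 2 + h ^ 2"
    using G_le[OF v] by (intro add_mono mult_mono power_mono) auto
  then have "int (b ^ 2 * fst v ^ 2 + h ^ 2) \<le> int (b ^ 2 * Y ^ 2 + h ^ 2)" by (simp only: of_nat_le_iff)
  moreover have "\<bar>T (fst v) \<tau>\<bar> \<le> int (b ^ 2 * fst v ^ 2 + h ^ 2) + int (b * h * fst v) * \<bar>\<tau>\<bar>"
    unfolding T_def by (rule order_trans[OF abs_triangle_ineq]) (simp only: abs_mult abs_of_nat order_refl)
  ultimately have "\<bar>T (fst v) \<tau>\<bar> \<le> int (b ^ 2 * Y ^ 2 + h ^ 2) + int (b * h * Y) * int N" by linarith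
  also have "\<dots> = int (b * h * Y * N + b ^ 2 * Y ^ 2 + h ^ 2)" by simp
  also have "\<dots> \<le> int K" using T_le by (simp only: of_nat_le_iff)
  finally show ?thesis by linarith
qed

text \<open>For given c = \<open>fst v\<close>, the value x = c + a * e determines e and hence the
  whole child, from which \<open>child_inj\<close> recovers v and n.\<close>

lemma x_inj:
  assumes "v \<in> G" "v' \<in> G" "fst v' = fst v" "x v n = x v' n'"
  shows "v' = v \<and> n' = n"
proof -
  have "a * snd (child a B v n) = a * snd (child a B v' n')"
    using assms(3,4) unfolding x_child by (simp add: child_def)
  then have "child a B v n = child a B v' n'"
    using assms(4) a_pos unfolding x_child by (simp add: prod_eq_iff)
  then show ?thesis using child_inj[OF G_node G_node] assms(1,2) by blast
qed

text \<open>By \<open>x_inj\<close> the pairs (v', n) that hit \<tau> give distinct divisors of the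
  one nonzero integer T (fst v) \<tau>. So there are at most \<Delta> of them, however many v' share
  the same \<open>fst\<close>.\<close>

lemma diagonal_pointwise_le:
  assumes v: "v \<in> G" and \<tau>: "\<tau> \<in> J"
  shows "(\<Sum>v'\<in>{v'\<in>G. fst v' = fst v}. \<bar>f v' \<tau>\<bar>) \<le> real R ^ 3 * real P * \<Delta>"
proof -
  let ?G = "{v'\<in>G. fst v' = fst v}"
  let ?W = "{(v', n). v' \<in> ?G \<and> n \<in> {1..X} \<and> int (x v' n) dvd T (fst v) \<tau>}"
  have fin: "finite ?W"
    by (rule finite_subset[of _ "G \<times> {1..X}"]) (use finite_G in auto)
  have "card ?W = card ((\<lambda>(v', n). x v' n) ` ?W)"
  proof (rule card_image[symmetric], rule inj_onI)
    fix p p' assume p: "p \<in> ?W" "p' \<in> ?W" "(\<lambda>(v', n). x v' n) p = (\<lambda>(v', n). x v' n) p'"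
    have "fst p' = fst p \<and> snd p' = snd p" by (rule x_inj) (use p in auto)
    then show "p = p'" by (simp add: prod_eq_iff)
  qed
  also have "\<dots> \<le> card {d. d dvd nat \<bar>T (fst v) \<tau>\<bar>}"
  proof (rule card_mono)
    show "finite {d. d dvd nat \<bar>T (fst v) \<tau>\<bar>}"
      using T_nonzero[OF v] by (intro finite_divisors_nat) simp
  qed auto
  finally have "real (card ?W) \<le> real (card {d. d dvd nat \<bar>T (fst v) \<tau>\<bar>})"
    by (simp only: of_nat_le_iff)
  also have "\<dots> \<le> \<Delta>" using T_nonzero[OF v, of \<tau>] by (intro \<Delta>_div T_bound[OF v \<tau>]) simp
  finally have cW: "real (card ?W) \<le> \<Delta>" .
  have "(\<Sum>v'\<in>?G. \<bar>f v' \<tau>\<bar>) \<le> (\<Sum>v'\<in>?G. \<Sum>n\<in>{1..X}. if int (x v' n) dvd T (fst v) \<tau> then real R ^ 3 * real P else 0)"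
    unfolding f_def
  proof (rule sum_mono, rule sum_abs[THEN order_trans], rule sum_mono)
    fix v' n assume v': "v' \<in> ?G" and n: "n \<in> {1..X}"
    have "\<bar>nu v' n * real (x v' n)\<bar> \<le> real R ^ 3 * real P"
      unfolding abs_mult using abs_nu_le[of v' n] x_le[of v' n] v' n by (intro mult_mono) auto
    then show "\<bar>if int (x v' n) dvd T (fst v') \<tau> then nu v' n * real (x v' n) else 0\<bar>
        \<le> (if int (x v' n) dvd T (fst v) \<tau> then real R ^ 3 * real P else 0)"
      using v' by simp
  qed
  also have "\<dots> = (\<Sum>p\<in>?G \<times> {1..X}. if int (x (fst p) (snd p)) dvd T (fst v) \<tau> then real R ^ 3 * real P else 0)"
    by (subst sum.cartesian_product) (simp add: case_prod_beta)
  also have "\<dots> = (\<Sum>p\<in>{p\<in>?G \<times> {1..X}. int (x (fst p) (snd p)) dvd T (fst v) \<tau>}. real R ^ 3 * real P)"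
    using finite_G by (intro sum.inter_filter[symmetric]) auto
  also have "{p\<in>?G \<times> {1..X}. int (x (fst p) (snd p)) dvd T (fst v) \<tau>} = ?W" by auto
  also have "(\<Sum>p\<in>?W. real R ^ 3 * real P) = real R ^ 3 * real P * real (card ?W)" by simp
  also have "\<dots> \<le> real R ^ 3 * real P * \<Delta>" using cW by (intro mult_left_mono) auto
  finally show ?thesis .
qed

lemma sum_abs_f_le:
  assumes v: "v \<in> G"
  shows "(\<Sum>\<tau>\<in>J. \<bar>f v \<tau>\<bar>) \<le> real X * real R ^ 3 * (L + real P)"
proof -
  have "(\<Sum>\<tau>\<in>J. \<bar>f v \<tau>\<bar>) \<le> (\<Sum>\<tau>\<in>J. \<Sum>n\<in>{1..X}. if int (x v n) dvd T (fst v) \<tau> then \<bar>nu v n * real (x v n)\<bar> else 0)"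
    unfolding f_def by (rule sum_mono, rule sum_abs[THEN order_trans], rule sum_mono) simp
  also have "\<dots> = (\<Sum>n\<in>{1..X}. \<bar>nu v n\<bar> * (real (x v n) * cnt v n))"
    by (subst sum.swap, intro sum.cong refl, subst sum.inter_filter[symmetric]) (simp_all add: abs_mult cnt_def)
  also have "\<dots> \<le> (\<Sum>n\<in>{1..X}. real R ^ 3 * (L + real P))"
  proof (rule sum_mono)
    fix n assume "n \<in> {1..X}"
    then have "real (x v n) \<le> real P" using x_le[OF v] by simp
    then have "real (x v n) * cnt v n \<le> L + real P"
      using x_count[OF v, of n] by linarith
    then show "\<bar>nu v n\<bar> * (real (x v n) * cnt v n) \<le> real R ^ 3 * (L + real P)"
      by (intro mult_mono abs_nu_le) (auto simp: cnt_def)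
  qed
  also have "\<dots> = real X * real R ^ 3 * (L + real P)" by simp
  finally show ?thesis .
qed

lemma sum_f_approx:
  assumes v: "v \<in> G"
  shows "\<bar>(\<Sum>\<tau>\<in>J. f v \<tau>) - L * A v 1\<bar> \<le> real X * real R ^ 3 * real P"
proof -
  have "(\<Sum>\<tau>\<in>J. f v \<tau>) = (\<Sum>n\<in>{1..X}. nu v n * (real (x v n) * cnt v n))"
    unfolding f_def by (subst sum.swap, intro sum.cong refl, subst sum.inter_filter[symmetric]) (simp_all add: cnt_def)
  moreover have "L * A v 1 = (\<Sum>n\<in>{1..X}. nu v n * L)"
    by (simp add: A_def sum_distrib_left mult.commute)
  ultimately have "\<bar>(\<Sum>\<tau>\<in>J. f v \<tau>) - L * A v 1\<bar>
     = \<bar>\<Sum>n\<in>{1..X}. nu v n * (real (x v n) * cnt v n - L)\<bar>"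
    by (simp only: sum_subtractf[symmetric] right_diff_distrib)
  also have "\<dots> \<le> (\<Sum>n\<in>{1..X}. real R ^ 3 * real P)"
  proof (rule sum_abs[THEN order_trans], rule sum_mono)
    fix n assume "n \<in> {1..X}"
    then have "real (x v n) \<le> real P" using x_le[OF v] by simp
    then have "\<bar>real (x v n) * cnt v n - L\<bar> \<le> real P"
      using x_count[OF v, of n] by linarith
    then show "\<bar>nu v n * (real (x v n) * cnt v n - L)\<bar> \<le> real R ^ 3 * real P"
      unfolding abs_mult by (intro mult_mono abs_nu_le) auto
  qed
  also have "\<dots> = real X * real R ^ 3 * real P" by simp
  finally show ?thesis .
qed

lemma A_1_bounds: "v \<in> G \<Longrightarrow> real X / 2 \<le> A v 1 \<and> A v 1 \<le> 2 * real X"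
proof -
  assume v: "v \<in> G"
  have "real (2 * R ^ 3) \<le> real X" using X_ge by (simp only: of_nat_le_iff)
  then show ?thesis using A_1[OF v] by simp linarith
qed

text \<open>Chebyshev's inequality around the expected value m: F vanishes at every missed \<tau>,
  which therefore contributes m ^ 2 to the sum of (F - m) ^ 2. In that sum the terms L * m ^ 2
  cancel. What is left, in order, is the off-diagonal sieve error, the rounding error of the pair
  counts, the pairs with equal \<open>fst\<close>, and the error of the first moment.\<close>

theorem exceptional_second_moment:
  defines "g \<equiv> real (card G)"
  defines "Z \<equiv> real (card {\<tau>\<in>J. \<forall>v\<in>G. \<forall>n\<in>{1..X}. \<not> int (x v n) dvd T (fst v) \<tau>})"
  shows "Z * (g * real X / 2) ^ 2 \<le> L * g ^ 2 * Err + g ^ 2 * real X ^ 2 * real R ^ 6 * real P ^ 2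
     + g * real X * real R ^ 6 * real P * \<Delta> * (L + real P) + 4 * g ^ 2 * real X ^ 2 * real R ^ 3 * real P"
proof -
  define F where "F \<tau> = (\<Sum>v\<in>G. f v \<tau>)" for \<tau>
  define m where "m = (\<Sum>v\<in>G. A v 1)"
  define Q where "Q = real X ^ 2 * real R ^ 6 * real P ^ 2"
  have L0: "L \<ge> 0" by (simp add: L_def)
  let ?d = "\<lambda>v v'. if fst v' = fst v then \<Sum>\<tau>\<in>J. \<bar>f v \<tau>\<bar> * \<bar>f v' \<tau>\<bar> else 0"
  let ?b = "(real R ^ 3 * real P * \<Delta>) * (real X * real R ^ 3 * (L + real P))"
  have g0: "g \<ge> 0" by (simp add: g_def)
  have A0: "A v 1 \<ge> 0" if "v \<in> G" for v using A_1_bounds[OF that] by (smt (verit) divide_nonneg_nonneg of_nat_0_le_iff)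
  have m_ge: "m \<ge> g * real X / 2"
    using sum_mono[of G "\<lambda>_. real X / 2" "\<lambda>v. A v 1"] A_1_bounds by (simp add: m_def g_def)
  have m_le: "m \<le> 2 * g * real X"
    using sum_mono[of G "\<lambda>v. A v 1" "\<lambda>_. 2 * real X"] A_1_bounds by (simp add: m_def g_def)
  have m0: "m \<ge> 0" using m_ge g0 by (smt (verit) divide_nonneg_nonneg mult_nonneg_nonneg of_nat_0_le_iff)
  have FF: "(\<Sum>\<tau>\<in>J. F \<tau> ^ 2) = (\<Sum>v\<in>G. \<Sum>v'\<in>G. \<Sum>\<tau>\<in>J. f v \<tau> * f v' \<tau>)"
    unfolding F_def power2_eq_square sum_product by (subst sum.swap, intro sum.cong refl, rule sum.swap)
  have "\<dots> \<le> (\<Sum>v\<in>G. \<Sum>v'\<in>G. (L * (A v 1 * A v' 1 + Err) + Q)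
       + (?d v v'))"
  proof (intro sum_mono)
    fix v v' assume v: "v \<in> G" "v' \<in> G"
    show "(\<Sum>\<tau>\<in>J. f v \<tau> * f v' \<tau>) \<le> (L * (A v 1 * A v' 1 + Err) + Q)
       + (?d v v')"
    proof (cases "fst v' = fst v")
      case True
      have "(\<Sum>\<tau>\<in>J. f v \<tau> * f v' \<tau>) \<le> (\<Sum>\<tau>\<in>J. \<bar>f v \<tau>\<bar> * \<bar>f v' \<tau>\<bar>)"
        by (rule sum_mono) (simp only: abs_ge_self flip: abs_mult)
      moreover have "L * (A v 1 * A v' 1 + Err) + Q \<ge> 0"
        using L0 A0[OF v(1)] A0[OF v(2)] Err_nonneg by (auto simp: Q_def)
      ultimately show ?thesis using True by simp
    next
      case False
      then show ?thesis using offdiagonal_le[OF v] by (auto simp: Q_def)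
    qed
  qed
  also have "\<dots> = (\<Sum>v\<in>G. \<Sum>v'\<in>G. L * (A v 1 * A v' 1 + Err) + Q)
       + (\<Sum>v\<in>G. \<Sum>v'\<in>G. ?d v v')"
    by (simp only: sum.distrib)
  also have "(\<Sum>v\<in>G. \<Sum>v'\<in>G. L * (A v 1 * A v' 1 + Err) + Q) = L * m ^ 2 + L * g ^ 2 * Err + g ^ 2 * Q"
  proof -
    have "(\<Sum>v\<in>G. \<Sum>v'\<in>G. L * (A v 1 * A v' 1 + Err) + Q) = (\<Sum>v\<in>G. \<Sum>v'\<in>G. L * (A v 1 * A v' 1)) + (\<Sum>v\<in>G. \<Sum>v'\<in>G. L * Err + Q)"
      by (simp only: sum.distrib[symmetric] distrib_left add.assoc)
    also have "(\<Sum>v\<in>G. \<Sum>v'\<in>G. L * (A v 1 * A v' 1)) = L * m ^ 2"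
      unfolding m_def power2_eq_square sum_product by (simp only: sum_distrib_left)
    also have "(\<Sum>v\<in>G. \<Sum>v'\<in>G. L * Err + Q) = L * g ^ 2 * Err + g ^ 2 * Q"
      by (simp add: g_def power2_eq_square algebra_simps)
    finally show ?thesis by simp
  qed
  finally have *: "(\<Sum>v\<in>G. \<Sum>v'\<in>G. \<Sum>\<tau>\<in>J. f v \<tau> * f v' \<tau>) \<le> L * m ^ 2 + L * g ^ 2 * Err + g ^ 2 * Q
     + (\<Sum>v\<in>G. \<Sum>v'\<in>G. ?d v v')" .
  have "(\<Sum>v\<in>G. \<Sum>v'\<in>G. ?d v v')
     \<le> (\<Sum>v\<in>G. ?b)"
  proof (rule sum_mono)
    fix v assume v: "v \<in> G"
    have "(\<Sum>v'\<in>G. ?d v v')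
       = (\<Sum>v'\<in>{v'\<in>G. fst v' = fst v}. \<Sum>\<tau>\<in>J. \<bar>f v \<tau>\<bar> * \<bar>f v' \<tau>\<bar>)"
      using finite_G by (rule sum.inter_filter[symmetric])
    also have "\<dots> = (\<Sum>\<tau>\<in>J. \<bar>f v \<tau>\<bar> * (\<Sum>v'\<in>{v'\<in>G. fst v' = fst v}. \<bar>f v' \<tau>\<bar>))"
      unfolding sum_distrib_left by (rule sum.swap)
    also have "\<dots> \<le> (\<Sum>\<tau>\<in>J. \<bar>f v \<tau>\<bar> * (real R ^ 3 * real P * \<Delta>))"
      by (intro sum_mono mult_left_mono diagonal_pointwise_le[OF v]) auto
    also have "\<dots> = (real R ^ 3 * real P * \<Delta>) * (\<Sum>\<tau>\<in>J. \<bar>f v \<tau>\<bar>)"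
      by (simp only: sum_distrib_right[symmetric] mult.commute)
    also have "\<dots> \<le> ?b"
      using sum_abs_f_le[OF v] \<Delta>_ge1 by (intro mult_left_mono) auto
    finally show "(\<Sum>v'\<in>G. ?d v v')
      \<le> ?b" .
  qed
  also have "\<dots> = g * real X * real R ^ 6 * real P * \<Delta> * (L + real P)"
  proof -
    have "real R ^ 6 = real R ^ 3 * real R ^ 3" by (simp flip: power_add)
    then show ?thesis by (simp add: g_def)
  qed
  finally have sq: "(\<Sum>\<tau>\<in>J. F \<tau> ^ 2) \<le> L * m ^ 2 + L * g ^ 2 * Err + g ^ 2 * Q
       + g * real X * real R ^ 6 * real P * \<Delta> * (L + real P)"
    using * FF by linarith
  have "\<bar>(\<Sum>\<tau>\<in>J. F \<tau>) - L * m\<bar> = \<bar>\<Sum>v\<in>G. (\<Sum>\<tau>\<in>J. f v \<tau>) - L * A v 1\<bar>"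
    unfolding F_def m_def sum_distrib_left sum_subtractf by (subst sum.swap) simp
  also have "\<dots> \<le> (\<Sum>v\<in>G. real X * real R ^ 3 * real P)"
    by (rule sum_abs[THEN order_trans], rule sum_mono, rule sum_f_approx)
  also have "\<dots> = g * real X * real R ^ 3 * real P" by (simp add: g_def)
  finally have first: "(\<Sum>\<tau>\<in>J. F \<tau>) \<ge> L * m - g * real X * real R ^ 3 * real P" by linarith
  let ?Z = "{\<tau>\<in>J. \<forall>v\<in>G. \<forall>n\<in>{1..X}. \<not> int (x v n) dvd T (fst v) \<tau>}"
  have "Z * m ^ 2 = (\<Sum>\<tau>\<in>?Z. (F \<tau> - m) ^ 2)"
  proof -
    have "(F \<tau> - m) ^ 2 = m ^ 2" if "\<tau> \<in> ?Z" for \<tau>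
    proof -
      have "f v \<tau> = 0" if "v \<in> G" for v using \<open>\<tau> \<in> ?Z\<close> that by (auto simp: f_def)
      then show ?thesis by (simp add: F_def)
    qed
    then show ?thesis by (simp add: Z_def)
  qed
  also have "\<dots> \<le> (\<Sum>\<tau>\<in>J. (F \<tau> - m) ^ 2)" by (rule sum_mono2) auto
  also have "\<dots> = (\<Sum>\<tau>\<in>J. F \<tau> ^ 2) - 2 * m * (\<Sum>\<tau>\<in>J. F \<tau>) + L * m ^ 2"
    by (simp add: power2_diff sum.distrib sum_subtractf sum_distrib_left card_J L_def algebra_simps)
  also have "\<dots> \<le> L * g ^ 2 * Err + g ^ 2 * Q + g * real X * real R ^ 6 * real P * \<Delta> * (L + real P)
       + 2 * m * (g * real X * real R ^ 3 * real P)"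
  proof -
    have "2 * m * (\<Sum>\<tau>\<in>J. F \<tau>) \<ge> 2 * m * (L * m - g * real X * real R ^ 3 * real P)"
      using first m0 by (intro mult_left_mono) auto
    then show ?thesis using sq by (simp add: algebra_simps power2_eq_square)
  qed
  also have "2 * m * (g * real X * real R ^ 3 * real P) \<le> 2 * (2 * g * real X) * (g * real X * real R ^ 3 * real P)"
    using m_le g0 by (intro mult_right_mono mult_left_mono) auto
  finally have fin: "Z * m ^ 2 \<le> L * g ^ 2 * Err + g ^ 2 * Q + g * real X * real R ^ 6 * real P * \<Delta> * (L + real P)
       + 4 * g ^ 2 * real X ^ 2 * real R ^ 3 * real P" by (simp add: power2_eq_square algebra_simps)
  have "(g * real X / 2) ^ 2 \<le> m ^ 2" using m_ge g0 by (intro power_mono) auto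
  then have "Z * (g * real X / 2) ^ 2 \<le> Z * m ^ 2" by (rule mult_left_mono) (simp add: Z_def)
  then show ?thesis using fin by (simp add: Q_def mult.assoc)
qed

end

section \<open>Choice of parameters\<close>

lemma second_moment_combine:
  fixes g X R P \<Delta> L N Z k1 k2 k3 k4 k5 :: real
  assumes nonneg: "k1 \<ge> 0" "k2 \<ge> 0" "k3 \<ge> 0" "k4 \<ge> 0" "k5 \<ge> 0" "N \<ge> 0" "P \<ge> 0" "L \<ge> 0"
    and gX: "g > 0" "X > 0" and R: "R \<ge> 1" and \<Delta>: "\<Delta> \<ge> 1"
    and h1: "R ^ 7 * P \<le> k1 * X ^ 2" and h2: "R ^ 7 * P ^ 2 \<le> k2 * N"
    and h3: "R ^ 7 * P \<le> k3 * (g * X)" and h4: "R ^ 4 * P \<le> k4 * N"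
    and h5: "L \<le> 3 * N" "L + P \<le> k5 * N"
    and main: "Z * (g * X / 2) ^ 2 \<le> L * g ^ 2 * (2 * R ^ 6 * \<Delta> * P + 2 * X ^ 2 * \<Delta> ^ 4 / R)
       + g ^ 2 * X ^ 2 * R ^ 6 * P ^ 2 + g * X * R ^ 6 * P * \<Delta> * (L + P) + 4 * g ^ 2 * X ^ 2 * R ^ 3 * P"
  shows "Z \<le> 4 * (3 * (2 * k1 + 2) + k2 + k3 * k5 + 4 * k4) * (N * \<Delta> ^ 4 / R)"
proof -
  have \<Delta>4: "\<Delta> \<le> \<Delta> ^ 4" "1 \<le> \<Delta> ^ 4" using \<Delta> by (auto simp: self_le_power)
  have R0: "R > 0" using R by simp
  have a1: "R ^ 6 * P \<le> k1 * X ^ 2 / R" using h1 R0 by (simp add: field_simps eval_nat_numeral)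
  have a2: "R ^ 6 * P ^ 2 \<le> k2 * N / R" using h2 R0 by (simp add: field_simps eval_nat_numeral)
  have a3: "R ^ 6 * P \<le> k3 * (g * X) / R" using h3 R0 by (simp add: field_simps eval_nat_numeral)
  have a4: "R ^ 3 * P \<le> k4 * N / R" using h4 R0 by (simp add: field_simps eval_nat_numeral)
  \<comment> \<open>The common measure for all four terms. Each hypothesis \<open>h1\<close> to
    \<open>h4\<close> has one power of R more than the term it bounds, and this spare power is the
    factor 1 / R.\<close>
  let ?Q = "N * \<Delta> ^ 4 / R * (g * X) ^ 2"
  have t1: "L * g ^ 2 * (2 * R ^ 6 * \<Delta> * P + 2 * X ^ 2 * \<Delta> ^ 4 / R) \<le> 3 * (2 * k1 + 2) * ?Q"
  proof -
    have "(R ^ 6 * P) * \<Delta> \<le> (k1 * X ^ 2 / R) * \<Delta> ^ 4"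
      using a1 \<Delta>4 nonneg R0 \<Delta> by (intro mult_mono) auto
    then have "2 * R ^ 6 * \<Delta> * P + 2 * X ^ 2 * \<Delta> ^ 4 / R \<le> 2 * ((k1 * X ^ 2 / R) * \<Delta> ^ 4) + 2 * X ^ 2 * \<Delta> ^ 4 / R"
    proof -
      have "2 * R ^ 6 * \<Delta> * P = 2 * ((R ^ 6 * P) * \<Delta>)" by simp
      then show ?thesis using \<open>(R ^ 6 * P) * \<Delta> \<le> _\<close> by linarith
    qed
    also have "\<dots> = (2 * k1 + 2) * (X ^ 2 * \<Delta> ^ 4 / R)" by (simp add: algebra_simps add_divide_distrib)
    finally have "L * g ^ 2 * (2 * R ^ 6 * \<Delta> * P + 2 * X ^ 2 * \<Delta> ^ 4 / R) \<le> (3 * N * g ^ 2) * ((2 * k1 + 2) * (X ^ 2 * \<Delta> ^ 4 / R))"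
      using h5 nonneg R0 \<Delta> by (intro mult_mono mult_right_mono) auto
    also have "\<dots> = 3 * (2 * k1 + 2) * ?Q" by (simp add: power_mult_distrib)
    finally show ?thesis .
  qed
  have t2: "g ^ 2 * X ^ 2 * R ^ 6 * P ^ 2 \<le> k2 * ?Q"
  proof -
    have "R ^ 6 * P ^ 2 \<le> (k2 * N / R) * \<Delta> ^ 4"
      using a2 \<Delta>4 nonneg R0 mult_left_mono[of 1 "\<Delta> ^ 4" "k2 * N / R"] by auto
    then have "(g * X) ^ 2 * (R ^ 6 * P ^ 2) \<le> (g * X) ^ 2 * ((k2 * N / R) * \<Delta> ^ 4)" by (rule mult_left_mono) simp
    then show ?thesis by (simp add: power_mult_distrib mult_ac)
  qed
  have t3: "g * X * R ^ 6 * P * \<Delta> * (L + P) \<le> k3 * k5 * ?Q"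
  proof -
    have "(R ^ 6 * P) * \<Delta> \<le> (k3 * (g * X) / R) * \<Delta> ^ 4"
      using a3 \<Delta>4 nonneg gX R0 \<Delta> by (intro mult_mono) auto
    then have "(R ^ 6 * P) * \<Delta> * (L + P) \<le> (k3 * (g * X) / R) * \<Delta> ^ 4 * (k5 * N)"
      using a3 \<Delta>4 h5 nonneg gX R0 \<Delta> by (intro mult_mono) auto
    then have "(g * X) * ((R ^ 6 * P) * \<Delta> * (L + P)) \<le> (g * X) * ((k3 * (g * X) / R) * \<Delta> ^ 4 * (k5 * N))"
      using gX by (intro mult_left_mono) auto
    then show ?thesis by (simp add: power2_eq_square mult_ac)
  qed
  have t4: "4 * g ^ 2 * X ^ 2 * R ^ 3 * P \<le> 4 * k4 * ?Q"
  proof -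
    have "R ^ 3 * P \<le> (k4 * N / R) * \<Delta> ^ 4"
      using a4 \<Delta>4 nonneg R0 mult_left_mono[of 1 "\<Delta> ^ 4" "k4 * N / R"] by auto
    then have "(4 * (g * X) ^ 2) * (R ^ 3 * P) \<le> (4 * (g * X) ^ 2) * ((k4 * N / R) * \<Delta> ^ 4)" by (rule mult_left_mono) simp
    then show ?thesis by (simp add: power_mult_distrib mult_ac)
  qed
  let ?k = "3 * (2 * k1 + 2) + k2 + k3 * k5 + 4 * k4"
  have "Z * (g * X / 2) ^ 2 \<le> 3 * (2 * k1 + 2) * ?Q + k2 * ?Q + k3 * k5 * ?Q + 4 * k4 * ?Q"
    using main t1 t2 t3 t4 by linarith
  also have "\<dots> = ?k * ?Q" by (simp only: distrib_right)
  also have "\<dots> = (4 * ?k * (N * \<Delta> ^ 4 / R)) * (g * X / 2) ^ 2"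
  proof -
    have "k * (q * y ^ 2) = (4 * k * q) * (y / 2) ^ 2" for k q y :: real by (simp add: power_divide)
    then show ?thesis .
  qed
  finally show ?thesis by (rule mult_right_le_imp_le) (use gX in simp)
qed

lemma floor_root:
  fixes N s :: nat
  assumes "s > 0" "N \<ge> 1"
  obtains R :: nat where "R \<ge> 1" "R ^ s \<le> N" "N < (R + 1) ^ s"
proof -
  let ?P = "\<lambda>R. R ^ s \<le> N"
  have b: "\<And>R. ?P R \<Longrightarrow> R \<le> N"
  proof -
    fix R assume R: "?P R"
    have "R \<le> R ^ s" using assms by (cases "R = 0") (auto simp: self_le_power)
    then show "R \<le> N" using R by linarith
  qed
  have P1: "?P 1" using assms by simp
  have g: "?P (Greatest ?P)" using GreatestI_nat[of ?P 1 N] P1 b by blast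
  have g1: "1 \<le> Greatest ?P" using Greatest_le_nat[of ?P 1 N] P1 b by blast
  have "\<not> ?P (Greatest ?P + 1)" using Greatest_le_nat[of ?P "Greatest ?P + 1" N] b by fastforce
  then show thesis using that g g1 by (simp only: not_le)
qed

text \<open>Here \<tau> stands for s * t, with t the candidate trace and s the sign of the lower
  left entry at the root, since the tree records entries without their sign.\<close>

definition missed :: "nat \<Rightarrow> nat \<Rightarrow> nat \<Rightarrow> nat \<Rightarrow> nat \<times> nat \<Rightarrow> nat \<Rightarrow> int set" where
  "missed a B b h v0 N = {\<tau>\<in>{- int N..int N}. \<forall>v\<in>orbit a B v0. \<forall>n\<ge>1.
        \<not> int (fst (child a B v n)) dvd int (b ^ 2 * fst v ^ 2 + h ^ 2) + int (b * h * fst v) * \<tau>}"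

theorem exceptional_set_bound:
  fixes a B b h :: nat
  assumes pos: "a > 0" "B > 0" "b > 0" "h > 0"
    and bad: "\<And>k. coprime k a \<Longrightarrow> coprime k (B * b * h)"
    and v0: "node a B v0"
  obtains C \<epsilon> :: real where "C > 0" "\<epsilon> > 0"
    "\<And>N::nat. N \<ge> 1 \<Longrightarrow> real (card (missed a B b h v0 N))
      \<le> C * real N powr (1 - \<epsilon>)"
proof -
  \<comment> \<open>One step with this n lifts \<open>fst\<close> above h ^ 2, and later steps only
    increase it; so v1 becomes the root.\<close>
  define v1 where "v1 = child a B v0 (h ^ 2 + 1)"
  have v1: "node a B v1" unfolding v1_def using node_child[OF v0 pos(1,2)] .
  have v1_orbit: "v1 \<in> orbit a B v0" unfolding v1_def by (intro orbit.intros) simp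
  define c where "c = fst v1"
  have "h ^ 2 + 1 \<le> c" unfolding c_def v1_def by (rule child_greater[OF v0 pos(1)]) simp
  then have c: "h ^ 2 < c" by simp
  then have c0: "c > 0" by simp
  obtain j :: nat and \<kappa> :: real where \<kappa>: "\<kappa> > 0"
    and many: "\<And>R::nat. R \<ge> 1 \<Longrightarrow> \<exists>G \<subseteq> orbit a B v1. finite G \<and> (\<forall>u\<in>G. node a B u \<and> c \<le> fst u \<and> fst u \<le> c * R ^ j)
       \<and> real (card G) \<ge> \<kappa> * real R ^ (j + 8)"
    by (rule many_nodes[OF v1 pos(1,2), folded c_def]) (rule that)
  \<comment> \<open>N is about R ^ s. The largest power of R that has to stay below N is 7 + 2 (8 +
    2 j) = 4 j + 23, in \<open>hyp2\<close>.\<close>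
  define s where "s = 4 * j + 24"
  have s0: "s > 0" by (simp add: s_def)
  \<comment> \<open>K is of size N ^ 2, so K powr \<delta> is at most about R powr (1/8) and
    \<Delta> ^ 4 about R powr (1/2): half of the saving 1 / R survives.\<close>
  define \<delta> where "\<delta> = 1 / (16 * real s)"
  have \<delta>: "\<delta> > 0" using s0 by (simp add: \<delta>_def)
  obtain Cd where Cd: "Cd > 0" "\<And>n. n > 0 \<Longrightarrow> real (card {d. d dvd n}) \<le> Cd * real n powr \<delta>"
    using card_divisors_le_powr[OF \<delta>] by blast
  define CK where "CK = 3 * a * B * c ^ 2 + (b * h * c + b ^ 2 * c ^ 2 + h ^ 2) + b ^ 2 * c ^ 3"
  define C\<Delta> where "C\<Delta> = (Cd + 1 + 1 / \<delta>) * (real CK powr \<delta> * 2)"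
  define k1 where "k1 = 3 * real a * real B"
  define k2 where "k2 = 9 * real a ^ 2 * real B ^ 2 * real c ^ 4"
  define k3 where "k3 = 3 * real a * real B * (real c / \<kappa>)"
  define k4 where "k4 = 3 * real a * real B * real c ^ 2"
  define k5 where "k5 = 3 + 3 * real a * real B * real c ^ 2"
  define k where "k = 4 * (3 * (2 * k1 + 2) + k2 + k3 * k5 + 4 * k4)"
  \<comment> \<open>The surviving saving R powr (- 1/2), expressed in N.\<close>
  define \<epsilon> where "\<epsilon> = 1 / (2 * real s)"
  have knn: "k1 \<ge> 0" "k2 \<ge> 0" "k3 \<ge> 0" "k4 \<ge> 0" "k5 \<ge> 0"
    using \<kappa> by (auto simp: k1_def k2_def k3_def k4_def k5_def)
  have kk: "k \<ge> 0" unfolding k_def using knn by simp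
  define C where "C = k * (C\<Delta> ^ 4 * 2) + 3 * 2 ^ s"
  have bound: "real (card (missed a B b h v0 N)) \<le> C * real N powr (1 - \<epsilon>)" if N: "N \<ge> 1" for N :: nat
  proof -
    obtain R where R: "R \<ge> 1" "R ^ s \<le> N" "N < (R + 1) ^ s" using floor_root[OF s0 N] by blast
    have eps1: "1 - \<epsilon> \<ge> 0" using s0 by (simp add: \<epsilon>_def)
    have C\<Delta>0: "C\<Delta> \<ge> 0" using Cd(1) \<delta> by (simp add: C\<Delta>_def)
    show ?thesis
    \<comment> \<open>For R = 1 the range N is bounded and the trivial count suffices; R \<ge> 2
      gives 2 R ^ 3 \<le> R ^ 4 \<le> X.\<close>
    proof (cases "R = 1")
      case True
      then have "N < 2 ^ s" using R(3) by (simp only: one_add_one)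
      then have "real N < real (2 ^ s)" by (simp only: of_nat_less_iff)
      then have N2: "real N \<le> 2 ^ s" by simp
      have "card (missed a B b h v0 N) \<le> card {- int N..int N}" by (rule card_mono) (auto simp: missed_def)
      then have "real (card (missed a B b h v0 N)) \<le> 3 * real N" using N by simp
      also have "\<dots> \<le> 3 * 2 ^ s * 1" using N2 by simp
      also have "\<dots> \<le> C * real N powr (1 - \<epsilon>)"
        using N eps1 kk C\<Delta>0 by (intro mult_mono) (auto simp: C_def ge_one_powr_ge_zero)
      finally show ?thesis .
    next
      case False
      then have R2: "R \<ge> 2" using R by simp
      obtain G where G0: "G \<subseteq> orbit a B v1 \<and> finite G \<and> (\<forall>u\<in>G. node a B u \<and> c \<le> fst u \<and> fst u \<le> c * R ^ j)
          \<and> \<kappa> * real R ^ (j + 8) \<le> real (card G)" using many[OF R(1)] by (elim exE conjE) (rule that, intro conjI)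
      then have G: "G \<subseteq> orbit a B v1" "finite G" "\<And>u. u \<in> G \<Longrightarrow> node a B u"
        "\<And>u. u \<in> G \<Longrightarrow> c \<le> fst u" "\<And>u. u \<in> G \<Longrightarrow> fst u \<le> c * R ^ j"
        "real (card G) \<ge> \<kappa> * real R ^ (j + 8)" by simp_all
      have pows: "real R powr (1 / 2) / real R powr 1 = real R powr (- (1 / 2))"
        by (subst powr_diff[symmetric]) simp
      define Y where "Y = c * R ^ j"
      \<comment> \<open>As P is of size Y * X, \<open>hyp1\<close> asks that X exceed Y by a factor
        R ^ 7.\<close>
      define X where "X = R ^ 8 * Y"
      define K where "K = CK * N ^ 2"
      define \<Delta> where "\<Delta> = C\<Delta> * real R powr (1 / 8)"
      have Rpow: "R ^ i \<le> N" if "i \<le> s" for i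
        using power_increasing[OF that R(1)] R(2) by linarith
      have "real N \<le> real ((R + 1) ^ s)" using R(3) by (simp only: of_nat_le_iff less_imp_le)
      also have "\<dots> \<le> (2 * real R) ^ s" unfolding of_nat_power using R(1) by (intro power_mono) auto
      also have "\<dots> = (2 * real R) powr real s" by (rule powr_realpow[symmetric]) (use R(1) in simp)
      finally have NR: "real N \<le> (2 * real R) powr real s" .
      have Y1: "Y \<ge> 1" using c0 R by (simp add: Y_def)
      have X1: "X \<ge> 1" using Y1 R by (simp add: X_def)
      have NN: "N \<le> N ^ 2" using N by (simp add: power2_eq_square)
      have YX: "Y * X = c ^ 2 * R ^ (8 + 2 * j)"
        by (simp add: X_def Y_def power_add power2_eq_square mult_ac power_mult)
      have P3: "a * B * Y * (X + 2) \<le> 3 * a * B * (Y * X)"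
      proof -
        have "a * B * Y * (X + 2) \<le> a * B * Y * (3 * X)" using X1 by (intro mult_left_mono) auto
        then show ?thesis by (simp add: mult_ac)
      qed
      have PN: "a * B * Y * (X + 2) \<le> 3 * a * B * c ^ 2 * N"
      proof -
        have "3 * a * B * (Y * X) \<le> 3 * a * B * (c ^ 2 * N)"
          unfolding YX using Rpow[of "8 + 2 * j"] by (intro mult_left_mono) (auto simp: s_def)
        then show ?thesis using P3 by (simp only: mult.assoc)
      qed
      have PK: "a * B * Y * (X + 2) \<le> K"
      proof -
        have "3 * a * B * c ^ 2 * N \<le> CK * N ^ 2" using NN by (intro mult_mono) (auto simp: CK_def)
        then show ?thesis using PN by (simp add: K_def)
      qed
      have YN: "Y \<le> c * N" unfolding Y_def using Rpow[of j] by (intro mult_left_mono) (auto simp: s_def)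
      have Y2N: "Y ^ 2 \<le> c ^ 2 * N"
      proof -
        have "Y ^ 2 = c ^ 2 * R ^ (2 * j)" by (simp add: Y_def power_mult_distrib power_mult mult.commute)
        then show ?thesis using Rpow[of "2 * j"] by (simp add: s_def)
      qed
      have Y3N: "Y ^ 3 \<le> c ^ 3 * N"
      proof -
        have "Y ^ 3 = c ^ 3 * R ^ (3 * j)" by (simp add: Y_def power_mult_distrib power_mult[symmetric] mult.commute)
        then show ?thesis using Rpow[of "3 * j"] by (simp add: s_def)
      qed
      have TK: "b * h * Y * N + b ^ 2 * Y ^ 2 + h ^ 2 \<le> K"
      proof -
        have "b * h * Y * N \<le> b * h * (c * N) * N" using YN by (intro mult_mono) auto
        also have "\<dots> = b * h * c * N ^ 2" by (simp add: power2_eq_square)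
        finally have 1: "b * h * Y * N \<le> b * h * c * N ^ 2" .
        have "b ^ 2 * Y ^ 2 \<le> b ^ 2 * (c ^ 2 * N ^ 2)" using Y2N NN by (intro mult_left_mono) (auto intro: order_trans)
        then have 2: "b ^ 2 * Y ^ 2 \<le> b ^ 2 * c ^ 2 * N ^ 2" by (simp add: mult.assoc)
        have 3: "h ^ 2 \<le> h ^ 2 * N ^ 2" using N by simp
        have "(b * h * c + b ^ 2 * c ^ 2 + h ^ 2) * N ^ 2 \<le> CK * N ^ 2" by (intro mult_right_mono) (auto simp: CK_def)
        then show ?thesis using 1 2 3 unfolding K_def by (simp only: distrib_right)
      qed
      have EK: "b ^ 2 * Y ^ 3 \<le> K"
      proof -
        have "b ^ 2 * Y ^ 3 \<le> b ^ 2 * (c ^ 3 * N ^ 2)" using Y3N NN by (intro mult_left_mono) (auto intro: order_trans)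
        also have "\<dots> = b ^ 2 * c ^ 3 * N ^ 2" by simp
        also have "\<dots> \<le> CK * N ^ 2" by (intro mult_right_mono) (auto simp: CK_def)
        finally show ?thesis by (simp add: K_def)
      qed
      have CK1: "CK \<ge> 1" using pos c0 by (simp add: CK_def Suc_le_eq)
      have "CK * N ^ 2 \<ge> 1" using CK1 N by (simp add: Suc_le_eq)
      then have "real 1 \<le> real (CK * N ^ 2)" by (simp only: of_nat_le_iff)
      then have K1: "real K \<ge> 1" by (simp only: K_def of_nat_1)
      have Kd: "real K powr \<delta> \<le> real CK powr \<delta> * 2 * real R powr (1 / 8)"
      proof -
        from NR have "real N powr (2 * \<delta>) \<le> ((2 * real R) powr real s) powr (2 * \<delta>)"
          using \<delta> by (intro powr_mono2) auto
        also have "\<dots> = (2 * real R) powr (1 / 8)" using s0 by (simp add: powr_powr \<delta>_def)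
        also have "\<dots> = 2 powr (1 / 8) * real R powr (1 / 8)" by (simp add: powr_mult)
        also have "\<dots> \<le> 2 powr 1 * real R powr (1 / 8)" by (intro mult_right_mono powr_mono) auto
        finally have 1: "real N powr (2 * \<delta>) \<le> 2 * real R powr (1 / 8)" by simp
        have "real K powr \<delta> = real CK powr \<delta> * (real N ^ 2) powr \<delta>" by (simp add: K_def powr_mult)
        also have "(real N ^ 2) powr \<delta> = real N powr (2 * \<delta>)"
          using N powr_realpow[of "real N" 2] by (simp add: powr_powr[symmetric])
        also have "real CK powr \<delta> * real N powr (2 * \<delta>) \<le> real CK powr \<delta> * (2 * real R powr (1 / 8))"
          using 1 by (intro mult_left_mono) auto
        finally show ?thesis by simp
      qed
      have \<Delta>K: "(Cd + 1 + 1 / \<delta>) * real K powr \<delta> \<le> \<Delta>"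
      proof -
        have "(Cd + 1 + 1 / \<delta>) * real K powr \<delta> \<le> (Cd + 1 + 1 / \<delta>) * (real CK powr \<delta> * 2 * real R powr (1 / 8))"
          using Kd Cd(1) \<delta> by (intro mult_left_mono) auto
        then show ?thesis by (simp add: \<Delta>_def C\<Delta>_def mult.assoc)
      qed
      have Kp1: "real K powr \<delta> \<ge> 1" using K1 \<delta> by (intro ge_one_powr_ge_zero) auto
      interpret M: divisor_moments a B b h R X Y N K \<Delta> G
      proof
        show "a > 0" "B > 0" "b > 0" "h > 0" "\<And>k. coprime k a \<Longrightarrow> coprime k (B * b * h)" using pos bad by auto
        show "finite G" by (rule G(2))
        have "\<kappa> * real R ^ (j + 8) > 0" using \<kappa> R(1) by simp
        then have "card G > 0" using G(6) by linarith
        then show "G \<noteq> {}" by auto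
        show "h\<^sup>2 < fst v" if "v \<in> G" for v using G(4)[OF that] c by linarith
        show "fst v \<le> Y" if "v \<in> G" for v using G(5)[OF that] by (simp add: Y_def)
        show "node a B v" if "v \<in> G" for v by (rule G(3)[OF that])
        show "1 \<le> R" by (rule R(1))
        have "2 * R ^ 3 \<le> R * R ^ 3" using R2 by (intro mult_right_mono) auto
        also have "\<dots> = R ^ 4" by (simp add: eval_nat_numeral)
        also have "\<dots> \<le> R ^ 8" using R(1) by (intro power_increasing) auto
        also have "\<dots> \<le> X" using Y1 by (simp add: X_def)
        finally show "2 * R ^ 3 \<le> X" .
        show "real (card {d. d dvd k}) \<le> \<Delta>" if "0 < k" "k \<le> K" for k
        proof -
          have "real (card {d. d dvd k}) \<le> Cd * real k powr \<delta>" using Cd(2) that by simp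
          also have "\<dots> \<le> Cd * real K powr \<delta>" using that Cd(1) \<delta> by (intro mult_left_mono powr_mono2) auto
          also have "\<dots> \<le> (Cd + 1 + 1 / \<delta>) * real K powr \<delta>" using \<delta> by (intro mult_right_mono) auto
          finally show ?thesis using \<Delta>K by linarith
        qed
        show "a * B * Y * (X + 2) \<le> K" by (rule PK)
        show "b * h * Y * N + b\<^sup>2 * Y\<^sup>2 + h\<^sup>2 \<le> K" by (rule TK)
        show "b\<^sup>2 * Y ^ 3 \<le> K" by (rule EK)
        have "a * B * Y * (X + 2) > 0" using pos Y1 by simp
        moreover have "ln (real p) \<le> ln (real K)" if "p > 0" "p \<le> K" for p using that by simp
        ultimately have "ln (real (a * B * Y * (X + 2))) \<le> ln (real K)" using PK by blast
        also have "\<dots> \<le> real K powr \<delta> / \<delta>" using K1 \<delta> by (rule ln_powr_bound)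
        finally have "1 + ln (real (a * B * Y * (X + 2))) \<le> real K powr \<delta> + real K powr \<delta> / \<delta>"
          using Kp1 by linarith
        also have "\<dots> = (1 + 1 / \<delta>) * real K powr \<delta>" by (simp add: field_simps)
        also have "\<dots> \<le> (Cd + 1 + 1 / \<delta>) * real K powr \<delta>" using Cd(1) by (intro mult_right_mono) auto
        finally show "1 + ln (real (a * B * Y * (X + 2))) \<le> \<Delta>" using \<Delta>K by linarith
      qed
      let ?g = "real (card G)"
      let ?W = "{\<tau>\<in>M.J. \<forall>v\<in>G. \<forall>n\<in>{1..X}. \<not> int (M.x v n) dvd M.T (fst v) \<tau>}"
      have "missed a B b h v0 N \<subseteq> ?W"
      proof
        fix \<tau> assume \<tau>: "\<tau> \<in> missed a B b h v0 N"
        have "v \<in> orbit a B v0" if "v \<in> G" for v using that G(1) orbit_trans[OF v1_orbit] by blast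
        then show "\<tau> \<in> ?W" using \<tau> by (auto simp: missed_def M.x_child M.T_def M.J_def)
      qed
      then have "card (missed a B b h v0 N) \<le> card ?W" by (intro card_mono) auto
      then have ZW: "real (card (missed a B b h v0 N)) \<le> real (card ?W)" by simp
      have P_real: "real M.P \<le> 3 * real a * real B * (real Y * real X)"
      proof -
        have "real M.P \<le> real (3 * a * B * (Y * X))" unfolding M.P_def using P3 by (simp only: of_nat_le_iff)
        then show ?thesis by simp
      qed
      have YXr: "real Y * real X = real c ^ 2 * real R ^ (8 + 2 * j)"
        using arg_cong[OF YX, of real] by simp
      have P_real2: "real M.P \<le> k4 * real R ^ (8 + 2 * j)"
        using P_real unfolding YXr k4_def by (simp add: mult.assoc)
      have RpowR: "real R ^ i \<le> real N" if "i \<le> s" for i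
      proof -
        have "real (R ^ i) \<le> real N" using Rpow[OF that] by (simp only: of_nat_le_iff)
        then show ?thesis by simp
      qed
      have R1: "real R \<ge> 1" using R(1) by simp
      have Xr: "real X = real R ^ 8 * real Y" by (simp add: X_def)
      have P_N: "real M.P \<le> k4 * real N"
      proof -
        have "k4 * real R ^ (8 + 2 * j) \<le> k4 * real N" using RpowR[of "8 + 2 * j"] knn by (intro mult_left_mono) (auto simp: s_def)
        then show ?thesis using P_real2 by linarith
      qed
      have R78: "real R ^ 7 \<le> real R ^ 8" using R1 by (intro power_increasing) auto
      have hyp1: "real R ^ 7 * real M.P \<le> k1 * real X ^ 2"
      proof -
        have "real R ^ 7 * real M.P \<le> real R ^ 8 * (k1 * (real Y * real X))"
          using P_real R78 by (intro mult_mono) (auto simp: k1_def)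
        also have "\<dots> = k1 * real X ^ 2" by (simp add: Xr power2_eq_square)
        finally show ?thesis .
      qed
      have hyp2: "real R ^ 7 * real M.P ^ 2 \<le> k2 * real N"
      proof -
        have "real R ^ 7 * real M.P ^ 2 \<le> real R ^ 7 * (k4 * real R ^ (8 + 2 * j)) ^ 2"
          using P_real2 by (intro mult_left_mono power_mono) auto
        also have "\<dots> = k4 ^ 2 * real R ^ (7 + (8 + 2 * j) * 2)"
          unfolding power_mult_distrib power_add[of _ 7] power_mult[of _ "8 + 2 * j" 2] by (simp only: mult.left_commute)
        also have "\<dots> \<le> k4 ^ 2 * real N" using RpowR[of "7 + (8 + 2 * j) * 2"] by (intro mult_left_mono) (auto simp: s_def)
        also have "k4 ^ 2 = k2" by (simp add: k4_def k2_def power_mult_distrib flip: power_mult)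
        finally show ?thesis .
      qed
      have hyp3: "real R ^ 7 * real M.P \<le> k3 * (?g * real X)"
      proof -
        have "real R ^ 8 * real Y = real c * real R ^ (j + 8)" by (simp add: Y_def power_add)
        also have "\<dots> \<le> real c * (?g / \<kappa>)" using G(6) \<kappa> by (intro mult_left_mono) (auto simp: field_simps)
        finally have gY: "real R ^ 8 * real Y \<le> real c * (?g / \<kappa>)" .
        have "real R ^ 7 * real M.P \<le> real R ^ 8 * (3 * real a * real B * (real Y * real X))"
          using P_real R78 by (intro mult_mono) auto
        also have "\<dots> = (3 * real a * real B * real X) * (real R ^ 8 * real Y)" by simp
        also have "\<dots> \<le> (3 * real a * real B * real X) * (real c * (?g / \<kappa>))"
          using gY by (intro mult_left_mono) auto
        also have "\<dots> = k3 * (?g * real X)" by (simp add: k3_def)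
        finally show ?thesis .
      qed
      have hyp4: "real R ^ 4 * real M.P \<le> k4 * real N"
      proof -
        have "real R ^ 4 * real M.P \<le> real R ^ 4 * (k4 * real R ^ (8 + 2 * j))"
          using P_real2 by (intro mult_left_mono) auto
        also have "\<dots> = k4 * real R ^ (4 + (8 + 2 * j))" by (simp add: power_add)
        also have "\<dots> \<le> k4 * real N" using RpowR[of "4 + (8 + 2 * j)"] knn by (intro mult_left_mono) (auto simp: s_def)
        finally show ?thesis .
      qed
      have L3: "M.L \<le> 3 * real N" using N by (simp add: M.L_def)
      have L5: "M.L + real M.P \<le> k5 * real N" using L3 P_N by (simp add: k5_def k4_def algebra_simps)
      have g0: "?g > 0" using M.G_nonempty M.finite_G by (simp add: card_gt_0_iff)
      have "real (card ?W) \<le> k * (real N * \<Delta> ^ 4 / real R)"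
        unfolding k_def
        by (rule second_moment_combine[OF knn _ _ _ g0 _ R1 M.\<Delta>_ge1 hyp1 hyp2 hyp3 hyp4 L3 L5
              M.exceptional_second_moment[unfolded M.Err_def]])
           (use X1 in \<open>auto simp: M.L_def\<close>)
      also have "\<dots> \<le> k * (C\<Delta> ^ 4 * 2 * real N powr (1 - \<epsilon>))"
      proof (rule mult_left_mono[OF _ kk])
        have R0: "real R > 0" using R1 by simp
        have "\<Delta> ^ 4 = C\<Delta> ^ 4 * real R powr (1 / 2)"
          using R0 by (simp add: \<Delta>_def power_mult_distrib powr_powr flip: powr_realpow)
        then have "real N * \<Delta> ^ 4 / real R = C\<Delta> ^ 4 * (real N * (real R powr (1 / 2) / real R powr 1))"
          using R0 by simp
        then have 0: "real N * \<Delta> ^ 4 / real R = C\<Delta> ^ 4 * (real N * real R powr (- (1 / 2)))"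
          unfolding pows .
        have "real R powr (- (1 / 2)) \<le> 2 * real N powr (- \<epsilon>)"
        proof -
          from NR have "((2 * real R) powr real s) powr (- \<epsilon>) \<le> real N powr (- \<epsilon>)"
            using N s0 by (intro powr_mono2') (auto simp: \<epsilon>_def)
          also have "((2 * real R) powr real s) powr (- \<epsilon>) = (2 * real R) powr (- (1 / 2))"
            using s0 by (simp add: powr_powr \<epsilon>_def)
          also have "\<dots> = 2 powr (- (1 / 2)) * real R powr (- (1 / 2))" by (simp add: powr_mult)
          finally have "2 * (2 powr (- (1 / 2)) * real R powr (- (1 / 2))) \<le> 2 * real N powr (- \<epsilon>)" by simp
          moreover have "2 * 2 powr (- (1 / 2)) = (2::real) powr (1 / 2)"
            by (simp add: powr_minus_divide powr_half_sqrt real_div_sqrt)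
          moreover have "(2::real) powr (1 / 2) \<ge> 1" by (rule ge_one_powr_ge_zero) auto
          then have "1 * real R powr (- (1 / 2)) \<le> 2 powr (1 / 2) * real R powr (- (1 / 2))"
            by (rule mult_right_mono) simp
          ultimately show ?thesis by (simp add: mult.assoc[symmetric])
        qed
        then have "real N * \<Delta> ^ 4 / real R \<le> C\<Delta> ^ 4 * (real N * (2 * real N powr (- \<epsilon>)))"
          unfolding 0 using C\<Delta>0 by (intro mult_left_mono) auto
        also have "real N * (2 * real N powr (- \<epsilon>)) = 2 * real N powr (1 - \<epsilon>)"
          using N by (simp add: powr_diff powr_minus_divide)
        finally show "real N * \<Delta> ^ 4 / real R \<le> C\<Delta> ^ 4 * 2 * real N powr (1 - \<epsilon>)" by simp
      qed
      also have "\<dots> \<le> C * real N powr (1 - \<epsilon>)"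
        by (simp add: C_def algebra_simps)
      finally show ?thesis using ZW by linarith
    qed
  qed
  show thesis
  proof (rule that[of C \<epsilon>])
    have "k * (C\<Delta> ^ 4 * 2) \<ge> 0" using kk by (intro mult_nonneg_nonneg) auto
    then show "C > 0" by (simp add: C_def add_nonneg_pos)
    show "\<epsilon> > 0" using s0 by (simp add: \<epsilon>_def)
  qed (rule bound)
qed

section \<open>Groups with a cusp\<close>

type_synonym mat2 = "int \<times> int \<times> int \<times> int"

fun mm :: "mat2 \<Rightarrow> mat2 \<Rightarrow> mat2" where
  "mm (a, b, c, d) (a', b', c', d') = (a * a' + b * c', a * b' + b * d', c * a' + d * c', c * b' + d * d')"

fun tr :: "mat2 \<Rightarrow> int" where "tr (a, b, c, d) = a + d"

text \<open>Q is the full p-part of M, so the p-part of M ^ i is exactly Q ^ i and can be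
  cancelled.\<close>

lemma prime_part_dvd_cancel:
  fixes p M y :: int
  assumes p: "prime p" and M: "M \<noteq> 0" and Q: "Q = p ^ multiplicity p M"
    and dvd: "Q ^ (i + j) dvd M ^ i * y"
  shows "Q ^ j dvd y"
proof -
  obtain M' where M': "M = Q * M'" "\<not> p dvd M'"
    using multiplicity_decompose'[of M p] M p not_prime_unit unfolding Q by metis
  have Q0: "Q \<noteq> 0" using Q p by auto
  have "Q ^ i * Q ^ j dvd Q ^ i * (M' ^ i * y)" using dvd unfolding M'(1) by (simp only: power_add power_mult_distrib mult.assoc)
  then have "Q ^ j dvd M' ^ i * y" using Q0 by (simp only: dvd_mult_cancel_left power_eq_0_iff) simp
  moreover have "coprime p M'" using p M'(2) by (rule prime_imp_coprime)
  then have "coprime (Q ^ j) (M' ^ i)" unfolding Q by (simp only: coprime_power_left_iff coprime_power_right_iff) simp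
  ultimately show ?thesis by (simp only: coprime_dvd_mult_right_iff)
qed

text \<open>The powers of p form a chain under divisibility, so one that divides y lies below any
  one that does not.\<close>

lemma power_dvd_if_not_multiple:
  fixes p y :: int
  assumes "\<not> (p ^ m) ^ i dvd y" "p ^ e dvd y"
  shows "p ^ e dvd (p ^ m) ^ i"
proof -
  have "e \<le> m * i"
  proof (rule ccontr)
    assume "\<not> ?thesis"
    then have "p ^ (m * i) dvd p ^ e" by (intro le_imp_power_dvd) simp
    then show False using assms dvd_trans unfolding power_mult by blast
  qed
  then show ?thesis unfolding power_mult[symmetric] by (rule le_imp_power_dvd)
qed

lemma dvd_if_prime_powers_dvd:
  fixes g y :: int
  assumes "g \<noteq> 0" "\<And>p e. prime p \<Longrightarrow> p ^ e dvd g \<Longrightarrow> p ^ e dvd y"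
  shows "g dvd y"
proof (cases "y = 0")
  case False
  show ?thesis
  proof (rule multiplicity_le_imp_dvd[OF assms(1)])
    fix p :: int assume p: "prime p"
    have "p ^ multiplicity p g dvd y" using assms(2)[OF p] multiplicity_dvd by blast
    then show "multiplicity p g \<le> multiplicity p y"
      using False p by (intro multiplicity_geI) auto
  qed
qed simp

text \<open>The second parabolic enters through all its powers V^n = I + n w (r, \<kappa>)^T
  (\<kappa>, - r), which fix the cusp r / \<kappa>, while U^n fixes infinity. As n runs over all
  integers, the inverses of U and V are included.\<close>

locale cusp_group =
  fixes H :: "mat2 set" and w r \<kappa> :: int
  assumes H_mult: "x \<in> H \<Longrightarrow> y \<in> H \<Longrightarrow> mm x y \<in> H"
    and H_det: "(a, b, c, d) \<in> H \<Longrightarrow> a * d - b * c = 1"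
    and H_U: "(1, n * w, 0, 1) \<in> H"
    and H_V: "(1 + n * w * r * \<kappa>, - (n * w * r ^ 2), n * w * \<kappa> ^ 2, 1 - n * w * r * \<kappa>) \<in> H"
    and w_pos: "w > 0" and \<kappa>_pos: "\<kappa> > 0"
begin

section \<open>Prescribing the trace at the bad primes\<close>

definition M :: int where "M = 2 * w * \<kappa>"

lemma M_pos: "M > 0" using w_pos \<kappa>_pos by (simp add: M_def)

lemma w_dvd_cancel:
  assumes "prime p" "(p ^ multiplicity p M) ^ Suc i dvd w * y"
  shows "(p ^ multiplicity p M) ^ i dvd y"
proof (rule prime_part_dvd_cancel[OF assms(1) _ refl, where i = 1])
  show "M \<noteq> 0" using M_pos by simp
  have "(p ^ multiplicity p M) ^ (1 + i) dvd (2 * \<kappa>) * (w * y)" using assms(2) by (simp add: dvd_mult)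
  then show "(p ^ multiplicity p M) ^ (1 + i) dvd M ^ 1 * y" by (simp add: M_def mult_ac)
qed

lemma trace_step:
  assumes "(a, b, c, d) \<in> H"
  shows "a + d + m * w * c \<in> tr ` H" "(a + m * w * c, b + m * w * d, c, d) \<in> H"
proof -
  show *: "(a + m * w * c, b + m * w * d, c, d) \<in> H" using H_mult[OF H_U[of m] assms] by simp
  then show "a + d + m * w * c \<in> tr ` H" by force
qed

text \<open>\<open>V\<^sup>k \<gamma> V\<^sup>m\<close> for the second parabolic \<open>V\<close>: its lower left entry is a polynomial in \<open>k\<close>, \<open>m\<close>
  whose coefficients cannot all be highly divisible by a prime dividing \<open>M\<close>, while the trace only
  moves by a multiple of \<open>\<theta> = tr (\<gamma> (V - 1))\<close>.\<close>

lemma conjugates: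
  assumes H: "(a, b, c, d) \<in> H"
  defines "\<nu> \<equiv> w * \<kappa> ^ 2"
  defines "\<theta> \<equiv> w * r * \<kappa> * (a - d) + \<nu> * b - w * r ^ 2 * c"
  defines "\<alpha> \<equiv> \<nu> * a - w * r * \<kappa> * c"
  defines "\<beta> \<equiv> \<nu> * d + w * r * \<kappa> * c"
  obtains a' b' d' where "(a', b', c + k * \<alpha> + m * \<beta> + k * m * \<theta> * \<nu>, d') \<in> H" "a' + d' = a + d + (k + m) * \<theta>"
proof -
  let ?V = "\<lambda>n. (1 + n * w * r * \<kappa>, - (n * w * r ^ 2), n * w * \<kappa> ^ 2, 1 - n * w * r * \<kappa>)"
  have in_H: "mm (mm (?V k) (a, b, c, d)) (?V m) \<in> H" by (intro H_mult H_V H)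
  obtain a' b' c' d' where e: "mm (mm (?V k) (a, b, c, d)) (?V m) = (a', b', c', d')"
    by (metis prod_cases4)
  have "c' = c + k * \<alpha> + m * \<beta> + k * m * \<theta> * \<nu>" "a' + d' = a + d + (k + m) * \<theta>"
    using e[symmetric] by (simp_all add: \<theta>_def \<alpha>_def \<beta>_def \<nu>_def algebra_simps power2_eq_square)
  then show thesis using that in_H e by metis
qed

text \<open>If Q ^ 4 divides \<theta>, the trace stays fixed modulo Q ^ 4 for all k and m, and it
  suffices that some f k m avoid Q ^ 3. Otherwise m = - k keeps the trace fixed exactly, and the
  quadratic term forces some f k (- k) to avoid Q ^ 7. Multiplication by w may cost one more Q, so
  the second case uses the full precision Q ^ 8; this is the origin of the modulus M ^ 8.\<close>

lemma local_prime:
  fixes p :: int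
  assumes H: "(a, b, c, d) \<in> H" and t: "[a + d = t] (mod M ^ 8)" and p: "prime p" "p dvd M"
  defines "\<nu> \<equiv> w * \<kappa> ^ 2"
  defines "\<theta> \<equiv> w * r * \<kappa> * (a - d) + \<nu> * b - w * r ^ 2 * c"
  defines "\<alpha> \<equiv> \<nu> * a - w * r * \<kappa> * c"
  defines "\<beta> \<equiv> \<nu> * d + w * r * \<kappa> * c"
  defines "f \<equiv> \<lambda>k m. c + k * \<alpha> + m * \<beta> + k * m * \<theta> * \<nu>"
  defines "Q \<equiv> p ^ multiplicity p M"
  shows "\<exists>k m. \<not> Q ^ 7 dvd f k m \<and> (\<forall>e. p ^ e dvd w * f k m \<longrightarrow> p ^ e dvd t - (a + d + (k + m) * \<theta>))"
proof -
  have M0: "M \<noteq> 0" using M_pos by simp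
  have QM: "Q dvd M" unfolding Q_def by (rule multiplicity_dvd)
  have "multiplicity p M > 0" using p M0 prime_multiplicity_gt_zero_iff prime_imp_prime_elem by blast
  then have pQ: "p dvd Q" unfolding Q_def by (intro dvd_power) simp
  note cancel = prime_part_dvd_cancel[OF p(1) M0, of Q, unfolded Q_def, OF refl, folded Q_def]
  have Qt: "Q ^ 8 dvd t - (a + d)"
  proof -
    have "Q ^ 8 dvd M ^ 8" using QM by (rule dvd_power_same)
    also have "M ^ 8 dvd t - (a + d)" using t by (simp add: cong_iff_dvd_diff dvd_diff_commute)
    finally show ?thesis .
  qed
  note power_cmp = power_dvd_if_not_multiple[of p "multiplicity p M", folded Q_def]
  note w_cancel = w_dvd_cancel[OF p(1), folded Q_def]
  have det: "a * d - b * c = 1" by (rule H_det[OF H])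
  show ?thesis
  proof (cases "Q ^ 4 dvd \<theta>")
    case True
    have "\<exists>k m. \<not> Q ^ 3 dvd f k m"
    proof (rule ccontr)
      assume "\<not> ?thesis"
      \<comment> \<open>The values at (0, 0) and (1, 0) then make p divide both c and a, against
        determinant 1.\<close>
      then have all: "\<And>k m. Q ^ 3 dvd f k m" by blast
      have c: "Q ^ 3 dvd c" using all[of 0 0] by (simp add: f_def)
      have "Q ^ 3 dvd f 1 0 - c" by (intro dvd_diff all c)
      then have "Q ^ 3 dvd \<alpha> + w * r * \<kappa> * c" using c by (simp add: f_def)
      then have "Q ^ 3 dvd (4 * w) * (\<nu> * a)" unfolding \<alpha>_def by (simp add: dvd_mult)
      then have "Q ^ (2 + 1) dvd M ^ 2 * a" by (simp add: M_def \<nu>_def power2_eq_square mult_ac)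
      then have "Q ^ 1 dvd a" by (rule cancel)
      then have "p dvd a" using pQ by (simp add: dvd_trans)
      moreover have "p dvd c"
      proof -
        have "p dvd Q ^ 3" by (rule dvd_trans[OF pQ dvd_power]) simp
        then show ?thesis using c dvd_trans by blast
      qed
      ultimately have "p dvd a * d - b * c" by (intro dvd_diff) (simp_all add: dvd_mult dvd_mult2)
      then have "is_unit p" unfolding det .
      then show False using p not_prime_unit by blast
    qed
    then obtain k m where km: "\<not> Q ^ 3 dvd f k m" by blast
    have "\<not> Q ^ 7 dvd f k m"
    proof
      assume "Q ^ 7 dvd f k m"
      moreover have "Q ^ 3 dvd Q ^ 7" by (rule le_imp_power_dvd) simp
      ultimately show False using km dvd_trans by blast
    qed
    moreover have "p ^ e dvd t - (a + d + (k + m) * \<theta>)" if "p ^ e dvd w * f k m" for e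
    proof -
      have "\<not> Q ^ 4 dvd w * f k m" using km w_cancel[of 3 "f k m"] by (auto simp: numeral_eq_Suc)
      then have pe: "p ^ e dvd Q ^ 4" using that by (rule power_cmp)
      have "Q ^ 4 dvd Q ^ 8" by (rule le_imp_power_dvd) simp
      then have "Q ^ 4 dvd t - (a + d)" using Qt by (rule dvd_trans)
      then have "Q ^ 4 dvd (t - (a + d)) - (k + m) * \<theta>"
        by (rule dvd_diff) (rule dvd_mult[OF True])
      then have "Q ^ 4 dvd t - (a + d + (k + m) * \<theta>)" by (simp add: algebra_simps)
      then show ?thesis using pe dvd_trans by blast
    qed
    ultimately show ?thesis by blast
  next
    case False
    have "\<exists>k. \<not> Q ^ 7 dvd f k (- k)"
    proof (rule ccontr)
      assume "\<not> ?thesis"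
      then have all: "\<And>k. Q ^ 7 dvd f k (- k)" by blast
      \<comment> \<open>A second difference isolates the quadratic term; the 2 it produces is the
        reason for the factor 2 in M.\<close>
      have "Q ^ 7 dvd 2 * f 0 0 - (f 1 (- 1) + f (- 1) 1)"
        using all[of 0] all[of 1] all[of "- 1"] by (intro dvd_diff dvd_add dvd_mult) simp_all
      then have "Q ^ 7 dvd 2 * \<nu> * \<theta>" by (simp add: f_def algebra_simps)
      then have "Q ^ 7 dvd (2 * w) * (2 * \<nu> * \<theta>)" by (rule dvd_mult)
      then have "Q ^ (2 + 5) dvd M ^ 2 * \<theta>" by (simp add: M_def \<nu>_def power2_eq_square mult_ac)
      then have "Q ^ 5 dvd \<theta>" by (rule cancel)
      moreover have "Q ^ 4 dvd Q ^ 5" by (rule le_imp_power_dvd) simp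
      ultimately show False using False dvd_trans by blast
    qed
    then obtain k where k: "\<not> Q ^ 7 dvd f k (- k)" by blast
    have "p ^ e dvd t - (a + d + (k + - k) * \<theta>)" if "p ^ e dvd w * f k (- k)" for e
    proof -
      have "\<not> Q ^ 8 dvd w * f k (- k)" using k w_cancel[of 7 "f k (- k)"] by (auto simp: numeral_eq_Suc)
      then have "p ^ e dvd Q ^ 8" using that by (rule power_cmp)
      then show ?thesis using Qt dvd_trans by auto
    qed
    then show ?thesis using k by blast
  qed
qed

text \<open>The choices of k and m at the single primes are glued by the Chinese remainder theorem
  modulo Q ^ 8. A power of U then raises the precision of the trace from M ^ 8 to M ^ J: it moves
  the trace by multiples of w * c, and \<open>local_prime\<close> ensures that every power of p
  dividing w * c divides the remaining discrepancy.\<close>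

lemma local_lift:
  assumes \<gamma>: "\<gamma> \<in> H" and t: "[tr \<gamma> = t] (mod M ^ 8)"
  obtains a b c d \<beta> c' where "(a, b, c, d) \<in> H" "[a + d = t] (mod M ^ J)"
    "c = \<beta> * c'" "\<beta> > 0" "\<beta> dvd M ^ 8" "coprime c' M" "c' \<noteq> 0"
proof -
  obtain a b c d where abcd: "\<gamma> = (a, b, c, d)" by (metis prod_cases4)
  have H: "(a, b, c, d) \<in> H" and t': "[a + d = t] (mod M ^ 8)" using \<gamma> t abcd by auto
  define \<nu> where "\<nu> = w * \<kappa> ^ 2"
  define \<theta> where "\<theta> = w * r * \<kappa> * (a - d) + \<nu> * b - w * r ^ 2 * c"
  define \<alpha> where "\<alpha> = \<nu> * a - w * r * \<kappa> * c"
  define \<beta> where "\<beta> = \<nu> * d + w * r * \<kappa> * c"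
  define f where "f k m = c + k * \<alpha> + m * \<beta> + k * m * \<theta> * \<nu>" for k m
  define Q where "Q p = p ^ multiplicity p M" for p :: int
  have "\<forall>p\<in>prime_factors M. \<exists>k m. \<not> Q p ^ 7 dvd f k m \<and>
      (\<forall>e. p ^ e dvd w * f k m \<longrightarrow> p ^ e dvd t - (a + d + (k + m) * \<theta>))"
    using local_prime[OF H t'] unfolding f_def Q_def \<theta>_def \<alpha>_def \<beta>_def \<nu>_def by auto
  then obtain k0 m0 where km0: "\<And>p. p \<in> prime_factors M \<Longrightarrow> \<not> Q p ^ 7 dvd f (k0 p) (m0 p) \<and>
      (\<forall>e. p ^ e dvd w * f (k0 p) (m0 p) \<longrightarrow> p ^ e dvd t - (a + d + (k0 p + m0 p) * \<theta>))"
    by metis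
  have crt: "\<exists>k::int. \<forall>p\<in>prime_factors M. [k = u p] (mod Q p ^ 8)" for u :: "int \<Rightarrow> int"
  proof -
    have Qpos: "Q p ^ 8 > 0" if "p \<in> prime_factors M" for p
      using that by (auto simp: Q_def prime_gt_0_int)
    have "\<exists>k::nat. \<forall>p\<in>prime_factors M. [k = nat (u p mod Q p ^ 8)] (mod nat (Q p ^ 8))"
    proof (rule chinese_remainder_nat)
      show "\<forall>p\<in>prime_factors M. \<forall>p'\<in>prime_factors M. p \<noteq> p' \<longrightarrow> coprime (nat (Q p ^ 8)) (nat (Q p' ^ 8))"
      proof (intro ballI impI)
        fix p p' assume p: "p \<in> prime_factors M" "p' \<in> prime_factors M" "p \<noteq> p'"
        then have "coprime p p'" by (intro primes_coprime) auto
        then have "coprime (Q p ^ 8) (Q p' ^ 8)" by (simp add: Q_def)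
        then show "coprime (nat (Q p ^ 8)) (nat (Q p' ^ 8))"
          using Qpos[OF p(1)] Qpos[OF p(2)] by (subst coprime_int_iff[symmetric]) simp
      qed
    qed simp
    then obtain k :: nat where k: "\<And>p. p \<in> prime_factors M \<Longrightarrow> [k = nat (u p mod Q p ^ 8)] (mod nat (Q p ^ 8))"
      by blast
    have "[int k = u p] (mod Q p ^ 8)" if p: "p \<in> prime_factors M" for p
    proof -
      have "[int k = int (nat (u p mod Q p ^ 8))] (mod int (nat (Q p ^ 8)))"
        using k[OF p] by (simp only: cong_int_iff)
      then show ?thesis using Qpos[OF p] by (simp add: cong_def)
    qed
    then show ?thesis by blast
  qed
  obtain k where k: "\<And>p. p \<in> prime_factors M \<Longrightarrow> [k = k0 p] (mod Q p ^ 8)" using crt[of k0] by blast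
  obtain m where m: "\<And>p. p \<in> prime_factors M \<Longrightarrow> [m = m0 p] (mod Q p ^ 8)" using crt[of m0] by blast
  define c1 where "c1 = f k m"
  define T where "T = a + d + (k + m) * \<theta>"
  have prime7: "\<not> Q p ^ 7 dvd c1" and primeT: "p ^ e dvd w * c1 \<Longrightarrow> p ^ e dvd t - T"
    if p: "p \<in> prime_factors M" for p e
  proof -
    have cf: "[c1 = f (k0 p) (m0 p)] (mod Q p ^ 8)"
      unfolding c1_def f_def using k[OF p] m[OF p] by (intro cong_add cong_mult cong_refl)
    have cT: "[T = a + d + (k0 p + m0 p) * \<theta>] (mod Q p ^ 8)"
      unfolding T_def using k[OF p] m[OF p] by (intro cong_add cong_mult cong_refl)
    have "[c1 = f (k0 p) (m0 p)] (mod Q p ^ 7)"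
      by (rule cong_dvd_modulus[OF cf]) (rule le_imp_power_dvd, simp)
    then show seven: "\<not> Q p ^ 7 dvd c1" using km0[OF p] by (simp add: cong_dvd_iff)
    assume e: "p ^ e dvd w * c1"
    have pr: "prime p" using p by auto
    have "\<not> Q p ^ Suc 7 dvd w * c1" using seven w_dvd_cancel[OF pr, of 7 c1] unfolding Q_def by blast
    then have pe: "p ^ e dvd Q p ^ 8"
      using power_dvd_if_not_multiple[OF _ e, of "multiplicity p M" 8] by (simp add: Q_def)
    have "[c1 = f (k0 p) (m0 p)] (mod p ^ e)" using cf pe by (rule cong_dvd_modulus)
    then have "[w * c1 = w * f (k0 p) (m0 p)] (mod p ^ e)" by (intro cong_mult cong_refl)
    then have "p ^ e dvd w * f (k0 p) (m0 p)" using e by (simp add: cong_dvd_iff)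
    then have 1: "p ^ e dvd t - (a + d + (k0 p + m0 p) * \<theta>)" using km0[OF p] by blast
    have "[T = a + d + (k0 p + m0 p) * \<theta>] (mod p ^ e)" using cT pe by (rule cong_dvd_modulus)
    then have "[t - T = t - (a + d + (k0 p + m0 p) * \<theta>)] (mod p ^ e)" by (intro cong_diff cong_refl)
    then show "p ^ e dvd t - T" using 1 by (simp add: cong_dvd_iff)
  qed
  obtain a1 b1 d1 where g1: "(a1, b1, c1, d1) \<in> H" "a1 + d1 = T"
    using conjugates[OF H, of k m] unfolding c1_def f_def T_def \<theta>_def \<alpha>_def \<beta>_def \<nu>_def by blast
  have "gcd (w * c1) (M ^ J) dvd t - T"
  proof (rule dvd_if_prime_powers_dvd)
    show "gcd (w * c1) (M ^ J) \<noteq> 0" using M_pos by simp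
    fix p e assume p: "prime (p::int)" "p ^ e dvd gcd (w * c1) (M ^ J)"
    show "p ^ e dvd t - T"
    proof (cases "e = 0")
      case False
      then have "p dvd p ^ e" by (intro dvd_power) simp
      then have "p dvd M ^ J" using p(2) by (meson dvd_trans gcd_dvd2)
      then have "p dvd M" using p(1) prime_dvd_power by blast
      then have "p \<in> prime_factors M" using p(1) M_pos by (simp add: in_prime_factors_iff)
      then show ?thesis using p(2) by (intro primeT) simp_all
    qed simp
  qed
  then obtain i where i: "[w * c1 * i = t - T] (mod M ^ J)" using cong_solve_dvd_int by blast
  have H2: "(a1 + i * w * c1, b1 + i * w * d1, c1, d1) \<in> H" using trace_step(2)[OF g1(1)] .
  have t2: "[a1 + i * w * c1 + d1 = t] (mod M ^ J)"
  proof -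
    have "[w * c1 * i + T = t - T + T] (mod M ^ J)" using i by (intro cong_add cong_refl)
    then show ?thesis using g1(2)[symmetric] by (simp add: algebra_simps)
  qed
  have M0: "M \<noteq> 0" using M_pos by simp
  \<comment> \<open>Since Q p ^ 7 never divides \<open>c1\<close>, this gcd is the whole part of
    \<open>c1\<close> composed of primes dividing M.\<close>
  define b2 where "b2 = gcd c1 (M ^ 8)"
  have b2: "b2 > 0" "b2 dvd c1" "b2 dvd M ^ 8" using M_pos by (auto simp: b2_def)
  obtain c2 where c2: "c1 = b2 * c2" using b2(2) by (elim dvdE)
  \<comment> \<open>A single prime factor of M suffices to see that \<open>c1\<close> is nonzero,
    and 2 is always available.\<close>
  have two: "(2::int) \<in> prime_factors M" using M0 by (simp add: in_prime_factors_iff M_def)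
  have c10: "c1 \<noteq> 0" using prime7[OF two] by auto
  have "coprime c2 M"
  proof (rule ccontr)
    assume "\<not> coprime c2 M"
    then obtain p where p: "prime p" "p dvd c2" "p dvd M"
      using prime_divisor_exists[of "gcd c2 M"] M0 by (auto simp: is_unit_gcd)
    define e where "e = multiplicity p c1"
    have pM: "p \<in> prime_factors M" using p M0 by (simp add: in_prime_factors_iff)
    have pe: "p ^ e dvd c1" unfolding e_def by (rule multiplicity_dvd)
    have "p ^ e dvd Q p ^ 7"
      using power_dvd_if_not_multiple[OF _ pe, of "multiplicity p M" 7] prime7[OF pM] by (simp add: Q_def)
    moreover have "Q p ^ 7 dvd M ^ 7" unfolding Q_def by (intro dvd_power_same multiplicity_dvd)
    moreover have "M ^ 7 dvd M ^ 8" by (rule le_imp_power_dvd) simp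
    ultimately have "p ^ e dvd M ^ 8" using dvd_trans by blast
    then have "p ^ e dvd b2" unfolding b2_def using pe by simp
    then have "p ^ e * p dvd b2 * c2" using p(2) by (rule mult_dvd_mono)
    then have "p ^ Suc e dvd c1" by (simp add: c2 mult.commute)
    then have "Suc e \<le> multiplicity p c1" using c10 p(1) by (intro multiplicity_geI) auto
    then show False by (simp add: e_def)
  qed
  then show thesis using that[OF H2 t2 c2 b2(1,3)] c10 c2 by auto
qed

end

section \<open>Matrices behind the tree\<close>

lemma node_orbit:
  assumes "u \<in> orbit a B v" "node a B v" "a > 0" "B > 0"
  shows "node a B u"
  using assms(1) by induction (use assms node_child in auto)

context cusp_group
begin

text \<open>The new matrix is \<gamma> U^(q n) V^q; its trace agrees with that of \<gamma> modulo q
  because U^q and V^q are trivial modulo q. The cofactor y is the lower left entry of V^q \<gamma>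
  U^(q n), where the two factors are multiplied in the opposite order.\<close>

lemma child_matrix:
  fixes a B \<beta> :: nat
  assumes B: "int B = q * w * \<kappa> * int \<beta>" and a: "int a * int \<beta> = q * w * \<kappa>"
    and H: "(a1, b1, c1, d1) \<in> H" and c1: "c1 = s * int (\<beta> * fst v)" and e1: "\<kappa> * d1 + r * c1 = s * int (snd v)"
  obtains a3 b3 c3 d3 y where "(a3, b3, c3, d3) \<in> H" "[a3 + d3 = a1 + d1] (mod q)"
    "c3 = s * int (\<beta> * fst (child a B v n))" "\<kappa> * d3 + r * c3 = s * int (snd (child a B v n))"
    "c3 * y = c1 ^ 2 + (q * w * \<kappa> ^ 2) ^ 2 + c1 * (q * w * \<kappa> ^ 2) * (a3 + d3)"
proof -
  define m where "m = q * int n * w"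
  define d2 where "d2 = d1 + c1 * m"
  define b2 where "b2 = b1 + a1 * m"
  have 2: "(a1, b2, c1, d2) \<in> H"
    using H_mult[OF H H_U[of "q * int n"]] by (simp add: m_def b2_def d2_def add.commute)
  have det: "a1 * d2 - b2 * c1 = 1" by (rule H_det[OF 2])
  have e2: "\<kappa> * d2 + r * c1 = s * int (snd v + B * fst v * n)"
  proof -
    have "\<kappa> * d2 + r * c1 = (\<kappa> * d1 + r * c1) + \<kappa> * m * c1" by (simp add: d2_def algebra_simps)
    also have "\<dots> = s * int (snd v) + (q * w * \<kappa> * int \<beta>) * (s * int (fst v) * int n)"
      unfolding e1 unfolding c1 m_def by (simp add: algebra_simps)
    also have "\<dots> = s * int (snd v + B * fst v * n)" unfolding B[symmetric] by (simp add: algebra_simps)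
    finally show ?thesis .
  qed
  define z where "z = q * w * r * \<kappa>"
  define h where "h = q * w * \<kappa> ^ 2"
  define \<rho> where "\<rho> = q * w * r ^ 2"
  have z2: "z * z = h * \<rho>" by (simp add: z_def h_def \<rho>_def algebra_simps power2_eq_square)
  define a3 where "a3 = a1 * (1 + z) + b2 * h"
  define b3 where "b3 = a1 * - \<rho> + b2 * (1 - z)"
  define c3 where "c3 = c1 * (1 + z) + d2 * h"
  define d3 where "d3 = c1 * - \<rho> + d2 * (1 - z)"
  have 3: "(a3, b3, c3, d3) \<in> H"
    using H_mult[OF 2 H_V[of q]] by (simp add: a3_def b3_def c3_def d3_def z_def h_def \<rho>_def)
  have "a3 + d3 - (a1 + d1) = q * (a1 * w * r * \<kappa> + b2 * w * \<kappa> ^ 2 - c1 * w * r ^ 2 + c1 * int n * w - d2 * w * r * \<kappa>)"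
    by (simp add: a3_def d3_def d2_def m_def z_def h_def \<rho>_def algebra_simps)
  then have t3: "[a3 + d3 = a1 + d1] (mod q)" by (simp add: cong_iff_dvd_diff)
  have c3: "c3 = s * int (\<beta> * fst (child a B v n))"
  proof -
    have "c3 = c1 + (q * w * \<kappa>) * (\<kappa> * d2 + r * c1)"
      by (simp add: c3_def z_def h_def algebra_simps power2_eq_square)
    also have "\<dots> = s * int (\<beta> * fst (child a B v n))"
      unfolding e2 unfolding c1 a[symmetric] child_def by (simp add: algebra_simps)
    finally show ?thesis .
  qed
  \<comment> \<open>V fixes the vector (r, \<kappa>), so this linear form in the bottom row does not
    change.\<close>
  have "\<kappa> * d3 + r * c3 = \<kappa> * d2 + r * c1"
    by (simp add: d3_def c3_def z_def h_def \<rho>_def algebra_simps power2_eq_square)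
  then have e3: "\<kappa> * d3 + r * c3 = s * int (snd (child a B v n))" unfolding e2 child_def by simp
  have "c3 * (h * a1 + (1 - z) * c1) - (c1 ^ 2 + h ^ 2 + c1 * h * (a3 + d3))
      = h ^ 2 * (a1 * d2 - b2 * c1 - 1) - c1 ^ 2 * (z * z - h * \<rho>)"
    unfolding c3_def a3_def d3_def by (simp add: algebra_simps power2_eq_square)
  also have "\<dots> = 0" unfolding det z2 by simp
  finally have "c3 * (h * a1 + (1 - z) * c1) = c1 ^ 2 + h ^ 2 + c1 * h * (a3 + d3)" by simp
  then show thesis using that[OF 3 t3 c3 e3] unfolding h_def by blast
qed

lemma orbit_matrix:
  fixes a B \<beta> :: nat
  assumes B: "int B = q * w * \<kappa> * int \<beta>" and a: "int a * int \<beta> = q * w * \<kappa>"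
    and v0: "(a0, b0, c0, d0) \<in> H" "[a0 + d0 = t] (mod q)" "c0 = s * int (\<beta> * fst v0)" "\<kappa> * d0 + r * c0 = s * int (snd v0)"
    and v: "v \<in> orbit a B v0"
  shows "\<exists>a1 b1 c1 d1. (a1, b1, c1, d1) \<in> H \<and> [a1 + d1 = t] (mod q) \<and> c1 = s * int (\<beta> * fst v)
      \<and> \<kappa> * d1 + r * c1 = s * int (snd v)"
  using v
proof induction
  case orbit_base
  then show ?case using v0 by blast
next
  case (orbit_step u n)
  then obtain a1 b1 c1 d1 where 1: "(a1, b1, c1, d1) \<in> H" "[a1 + d1 = t] (mod q)"
    "c1 = s * int (\<beta> * fst u)" "\<kappa> * d1 + r * c1 = s * int (snd u)" by blast
  obtain a3 b3 c3 d3 y where 3: "(a3, b3, c3, d3) \<in> H" "[a3 + d3 = a1 + d1] (mod q)"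
    "c3 = s * int (\<beta> * fst (child a B u n))" "\<kappa> * d3 + r * c3 = s * int (snd (child a B u n))"
    using child_matrix[OF B a 1(1,3,4)] by metis
  then show ?case using cong_trans[OF 3(2) 1(2)] by blast
qed

text \<open>The divisibility hypothesis is \<open>x dvd c(\<gamma>\<^sub>1) c(\<gamma>\<^sub>2) t + c(\<gamma>\<^sub>1)\<^sup>2 + c(\<gamma>\<^sub>2)\<^sup>2\<close>, where \<open>x\<close> is essentially
  \<open>c(\<gamma>\<^sub>1\<gamma>\<^sub>2)\<close>. By the identity
  \<open>c(\<gamma>\<^sub>1\<gamma>\<^sub>2) c(\<gamma>\<^sub>2\<gamma>\<^sub>1) - c(\<gamma>\<^sub>1) c(\<gamma>\<^sub>2) tr(\<gamma>\<^sub>1\<gamma>\<^sub>2) = c(\<gamma>\<^sub>1)\<^sup>2 + c(\<gamma>\<^sub>2)\<^sup>2\<close> it says that \<open>t\<close> is congruent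
  to \<open>tr(\<gamma>\<^sub>1\<gamma>\<^sub>2)\<close> modulo \<open>x\<close>, so that \<open>t\<close> is the trace of some \<open>U\<^sup>m \<gamma>\<^sub>1\<gamma>\<^sub>2\<close>.\<close>

lemma divisor_gives_trace:
  fixes a B \<beta> h :: nat
  assumes B: "int B = q * w * \<kappa> * int \<beta>" and a: "int a * int \<beta> = q * w * \<kappa>" and h: "int h = q * w * \<kappa> ^ 2"
    and s: "\<bar>s\<bar> = 1" and wq: "w * int \<beta> dvd q" and pos: "a > 0" "B > 0"
    and bad: "\<And>k. coprime k a \<Longrightarrow> coprime k (B * \<beta> * h)"
    and v0: "(a0, b0, c0, d0) \<in> H" "[a0 + d0 = t0] (mod q)" "c0 = s * int (\<beta> * fst v0)" "\<kappa> * d0 + r * c0 = s * int (snd v0)"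
    and node: "node a B v0" and v: "v \<in> orbit a B v0" and t: "[t = t0] (mod q)"
    and x: "int (fst (child a B v n)) dvd int (\<beta> ^ 2 * fst v ^ 2 + h ^ 2) + int (\<beta> * h * fst v) * (s * t)"
  shows "t \<in> tr ` H"
proof -
  define X where "X = fst (child a B v n)"
  obtain a1 b1 c1 d1 where 1: "(a1, b1, c1, d1) \<in> H" "[a1 + d1 = t0] (mod q)"
    "c1 = s * int (\<beta> * fst v)" "\<kappa> * d1 + r * c1 = s * int (snd v)"
    using orbit_matrix[OF B a v0 v] by blast
  obtain a3 b3 c3 d3 y where 3: "(a3, b3, c3, d3) \<in> H" "[a3 + d3 = a1 + d1] (mod q)"
    and c3: "c3 = s * int (\<beta> * X)" and id: "c3 * y = c1 ^ 2 + int h ^ 2 + c1 * int h * (a3 + d3)"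
    using child_matrix[OF B a 1(1,3,4)] unfolding X_def h by metis
  have "[a3 + d3 = t] (mod q)" using 3(2) 1(2) t by (meson cong_sym cong_trans)
  then have qd: "q dvd t - (a3 + d3)" by (simp add: cong_iff_dvd_diff dvd_diff_commute)
  have ss: "s * s = 1" using s by (metis abs_mult_self_eq mult_1)
  have nv: "node a B v" by (rule node_orbit[OF v node pos])
  have nX: "coprime X a" using node_child[OF nv pos, of n] by (simp add: node_def X_def)
  have "coprime X (\<beta> * h * fst v)"
    using bad[OF nX] child_coprime_parent[OF nv, of n] by (simp add: X_def)
  then have cX: "coprime (int X) (int (\<beta> * h * fst v))" by (simp only: coprime_int_iff)
  have "int X dvd c3 * y" unfolding c3 by simp
  moreover have "c1 ^ 2 = int (\<beta> ^ 2 * fst v ^ 2)" unfolding 1(3) using ss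
    by (simp add: power_mult_distrib power2_eq_square[of s])
  ultimately have "int X dvd (int (\<beta> ^ 2 * fst v ^ 2 + h ^ 2) + int (\<beta> * h * fst v) * (s * t))
      - (int (\<beta> ^ 2 * fst v ^ 2) + int h ^ 2 + c1 * int h * (a3 + d3))"
    using x unfolding X_def[symmetric] id by (intro dvd_diff) simp_all
  also have "\<dots> = s * (int (\<beta> * h * fst v) * (t - (a3 + d3)))" unfolding 1(3) by (simp add: algebra_simps)
  finally have "int X dvd s * (s * (int (\<beta> * h * fst v) * (t - (a3 + d3))))" by (rule dvd_mult)
  also have "\<dots> = int (\<beta> * h * fst v) * (t - (a3 + d3))" by (simp only: mult.assoc[symmetric] ss mult_1)
  finally have Xd: "int X dvd t - (a3 + d3)" using cX by (simp only: coprime_dvd_mult_right_iff)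
  \<comment> \<open>The modulus w * \<beta> comes from the residue modulo q and X from the
    divisibility; being coprime they combine to w * c3 up to sign, the step of the progression of
    traces.\<close>
  have wbd: "w * int \<beta> dvd t - (a3 + d3)" using wq qd by (rule dvd_trans)
  have "coprime (int X) (int (B * \<beta> * h))" using bad[OF nX] by (simp only: coprime_int_iff)
  moreover have "w * int \<beta> dvd int (B * \<beta> * h)" by (simp add: B)
  ultimately have "coprime (int X) (w * int \<beta>)" using coprime_divisors[OF dvd_refl] by blast
  then have "coprime (w * int \<beta>) (int X)" by (simp only: coprime_commute)
  then have "(w * int \<beta>) * int X dvd t - (a3 + d3)" by (rule divides_mult[OF wbd Xd])
  then obtain y' where y': "t - (a3 + d3) = (w * int \<beta>) * int X * y'" by (elim dvdE)
  have "(s * y') * w * c3 = (s * s) * ((w * int \<beta>) * int X * y')" unfolding c3 by simp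
  also have "\<dots> = t - (a3 + d3)" unfolding ss y' by simp
  finally have "a3 + d3 + (s * y') * w * c3 = t" by simp
  then show ?thesis using trace_step(1)[OF 3(1), of "s * y'"] by simp
qed

text \<open>Fixing t modulo q = M ^ 10 isolates the bad primes: \<open>local_lift\<close> provides a
  root with trace t0 modulo q, and every step of the tree is trivial modulo q.\<close>

lemma class_bound:
  assumes \<gamma>: "\<gamma> \<in> H" "[tr \<gamma> = t0] (mod M ^ 8)"
  obtains C \<epsilon> :: real where "C > 0" "\<epsilon> > 0"
    "\<And>N::nat. N \<ge> 1 \<Longrightarrow> real (card {t\<in>{- int N..int N}. [t = t0] (mod M ^ 10) \<and> t \<notin> tr ` H}) \<le> C * real N powr (1 - \<epsilon>)"
proof -
  define q where "q = M ^ 10"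
  have q0: "q > 0" using M_pos by (simp add: q_def)
  obtain a0 b0 c0 d0 bi c' where g0: "(a0, b0, c0, d0) \<in> H" "[a0 + d0 = t0] (mod q)"
    "c0 = bi * c'" "bi > 0" "bi dvd M ^ 8" "coprime c' M" "c' \<noteq> 0"
    using local_lift[OF \<gamma>, of 10] unfolding q_def by metis
  obtain z where z: "M ^ 8 = bi * z" using g0(5) by (elim dvdE)
  have z0: "z > 0" using z g0(4) M_pos by (metis zero_less_mult_pos zero_less_power)
  define \<beta> where "\<beta> = nat bi"
  define c where "c = nat \<bar>c'\<bar>"
  define s where "s = sgn c'"
  \<comment> \<open>This is q * w * \<kappa> / \<beta> without a division; the factor M ^ 2 puts
    every prime of M into a, which yields \<open>bad\<close>.\<close>
  define a where "a = nat (z * M ^ 2 * w * \<kappa>)"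
  define B where "B = nat (q * w * \<kappa> * bi)"
  define h where "h = nat (q * w * \<kappa> ^ 2)"
  have \<beta>: "int \<beta> = bi" using g0(4) by (simp add: \<beta>_def)
  have ai: "int a = z * M ^ 2 * w * \<kappa>" using z0 w_pos \<kappa>_pos by (simp add: a_def)
  have Bi: "int B = q * w * \<kappa> * int \<beta>" using q0 g0(4) w_pos \<kappa>_pos by (simp add: B_def \<beta>)
  have hi: "int h = q * w * \<kappa> ^ 2" using q0 w_pos by (simp add: h_def)
  have ab: "int a * int \<beta> = q * w * \<kappa>"
  proof -
    have "int a * int \<beta> = (bi * z) * M ^ 2 * w * \<kappa>" unfolding ai \<beta> by simp
    also have "\<dots> = q * w * \<kappa>" unfolding z[symmetric] q_def by (simp flip: power_add)
    finally show ?thesis .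
  qed
  have s1: "\<bar>s\<bar> = 1" using g0(7) by (simp add: s_def abs_sgn_eq)
  then have ss: "s * s = 1" by (metis abs_mult_self_eq mult_1)
  have c': "c' = s * int c" by (simp add: c_def s_def mult_sgn_abs)
  have pos: "a > 0" "B > 0" "\<beta> > 0" "h > 0" "c > 0"
    using z0 M_pos w_pos \<kappa>_pos q0 g0(4,7) by (simp_all add: a_def B_def h_def \<beta>_def c_def)
  have wM: "w dvd M" and \<kappa>M: "\<kappa> dvd M" by (auto simp: M_def)
  have cop_factors: "coprime k w" "coprime k \<kappa>" "coprime k bi" "coprime k q" "coprime k z" if "coprime k M" for k :: int
  proof -
    show "coprime k w" "coprime k \<kappa>" using that wM \<kappa>M coprime_divisors[OF dvd_refl] by blast+
    have "coprime k (M ^ 8)" using that by simp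
    then show "coprime k bi" "coprime k z" unfolding z by simp_all
    show "coprime k q" using that by (simp add: q_def)
  qed
  have bad: "coprime k (B * \<beta> * h)" if "coprime k a" for k
  proof -
    have "coprime (int k) (int a)" using that by (simp only: coprime_int_iff)
    then have kM: "coprime (int k) M" unfolding ai by simp
    have "coprime (int k) (int (B * \<beta> * h))"
      using cop_factors[OF kM] by (simp add: Bi hi \<beta>)
    then show ?thesis by (simp only: coprime_int_iff)
  qed
  define m where "m = int B * int c"
  have m0: "m > 0" using pos by (simp add: m_def)
  define e0 where "e0 = \<kappa> * d0 + r * c0"
  \<comment> \<open>The power of U^q that reduces the second coordinate modulo m = B * c, as
    \<open>node\<close> demands.\<close>
  define n0 where "n0 = - ((s * e0) div m)"
  define d1 where "d1 = d0 + c0 * (q * n0 * w)"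
  define b1 where "b1 = b0 + a0 * (q * n0 * w)"
  have g1: "(a0, b1, c0, d1) \<in> H"
    using H_mult[OF g0(1) H_U[of "q * n0"]] by (simp add: b1_def d1_def add.commute)
  have t1: "[a0 + d1 = t0] (mod q)"
  proof -
    have "[a0 + d1 = a0 + d0] (mod q)" by (simp add: cong_iff_dvd_diff d1_def)
    then show ?thesis using g0(2) by (rule cong_trans)
  qed
  define v0 where "v0 = (c, nat ((s * e0) mod m))"
  have c0: "c0 = s * int (\<beta> * fst v0)" unfolding g0(3) c' v0_def by (simp add: \<beta>)
  have sn: "int (snd v0) = (s * e0) mod m" using m0 by (simp add: v0_def)
  have e1: "\<kappa> * d1 + r * c0 = s * int (snd v0)"
  proof -
    have "\<kappa> * d1 + r * c0 = e0 + (q * w * \<kappa> * bi) * c' * n0" by (simp add: d1_def e0_def g0(3) algebra_simps)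
    also have "\<dots> = s * (s * e0) + s * (m * n0)" using ss by (simp add: c' m_def Bi \<beta> mult.assoc[symmetric])
    also have "\<dots> = s * (s * e0 - m * ((s * e0) div m))" by (simp add: n0_def algebra_simps)
    also have "\<dots> = s * ((s * e0) mod m)" by (simp only: minus_mult_div_eq_mod)
    finally show ?thesis using sn by simp
  qed
  have nod: "node a B v0"
    unfolding node_def
  proof (intro conjI)
    show "0 < fst v0" using pos by (simp add: v0_def)
    have "(s * e0) mod m < m" using m0 by simp
    then have "int (snd v0) < int (B * fst v0)" unfolding sn by (simp add: m_def v0_def)
    then show "snd v0 < B * fst v0" by (simp only: of_nat_less_iff)
    have cM: "coprime (int c) M" using g0(6) unfolding c' using s1 by (simp add: coprime_mult_left_iff)
    have "coprime (int c) (int a)" unfolding ai using cop_factors[OF cM] cM by simp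
    then show "coprime (fst v0) a" by (simp add: v0_def coprime_int_iff)
    \<comment> \<open>A common divisor divides \<kappa> * d0, hence d0, and therefore the
      determinant.\<close>
    have "coprime (int c) e0"
    proof (rule coprimeI)
      fix k assume k: "k dvd int c" "k dvd e0"
      have "k dvd c0" unfolding c0 v0_def using k(1) by simp
      then have "k dvd e0 - r * c0" using k(2) by (intro dvd_diff dvd_mult)
      then have "k dvd \<kappa> * d0" by (simp add: e0_def)
      moreover have "coprime k \<kappa>" by (rule coprime_divisors[OF k(1) dvd_refl cop_factors(2)[OF cM]])
      ultimately have "k dvd d0" by (simp only: coprime_dvd_mult_right_iff)
      then have "k dvd a0 * d0 - b0 * c0" using \<open>k dvd c0\<close> by (intro dvd_diff dvd_mult)
      then show "is_unit k" using H_det[OF g0(1)] by simp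
    qed
    moreover have "coprime (int c) s" using s1 by (metis coprime_1_right coprime_abs_right_iff)
    ultimately have "coprime (int c) (s * e0)" by simp
    moreover have "gcd (int c) ((s * e0) mod m) = gcd (int c) (s * e0)"
    proof -
      have "(s * e0) mod m + (int B * ((s * e0) div m)) * int c = s * e0"
        using mod_mult_div_eq[of "s * e0" m] by (simp add: m_def mult_ac)
      then show ?thesis by (metis add.commute gcd_add_mult)
    qed
    ultimately have "coprime (int c) (int (snd v0))" unfolding sn by (simp add: coprime_iff_gcd_eq_1)
    then have "coprime c (snd v0)" by (simp only: coprime_int_iff)
    then show "coprime (fst v0) (snd v0)" by (simp add: v0_def)
  qed
  have wq: "w * int \<beta> dvd q"
  proof -
    have "w * bi dvd M * M ^ 8" using wM g0(5) by (rule mult_dvd_mono)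
    also have "\<dots> = M ^ 9" by (simp flip: power_Suc)
    also have "M ^ 9 dvd q" unfolding q_def by (rule le_imp_power_dvd) simp
    finally show ?thesis by (simp add: \<beta>)
  qed
  obtain C \<epsilon> :: real where C: "C > 0" "\<epsilon> > 0"
    "\<And>N::nat. N \<ge> 1 \<Longrightarrow> real (card (missed a B \<beta> h v0 N))
      \<le> C * real N powr (1 - \<epsilon>)"
    by (rule exceptional_set_bound[OF pos(1-4) bad nod], assumption) (rule that)
  show thesis
  proof (rule that[OF C(1,2)])
    fix N :: nat assume N: "N \<ge> 1"
    let ?S = "{t\<in>{- int N..int N}. [t = t0] (mod M ^ 10) \<and> t \<notin> tr ` H}"
    let ?Z = "missed a B \<beta> h v0 N"
    have sub: "(\<lambda>t. s * t) ` ?S \<subseteq> ?Z"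
    proof
      fix \<tau> assume "\<tau> \<in> (\<lambda>t. s * t) ` ?S"
      then obtain t where t: "\<tau> = s * t" "t \<in> {- int N..int N}" "[t = t0] (mod q)" "t \<notin> tr ` H"
        by (auto simp: q_def)
      have "\<bar>\<tau>\<bar> = \<bar>t\<bar>" using s1 by (simp add: t(1) abs_mult)
      then have "\<tau> \<in> {- int N..int N}" using t(2) by (simp add: abs_le_iff) linarith
      moreover have "\<not> int (fst (child a B v n)) dvd int (\<beta> ^ 2 * fst v ^ 2 + h ^ 2) + int (\<beta> * h * fst v) * \<tau>"
        if "v \<in> orbit a B v0" "n \<ge> 1" for v n
        using divisor_gives_trace[OF Bi ab hi s1 wq pos(1,2) bad g1 t1 c0 e1 nod that(1) t(3)] t(4)
        unfolding t(1) by blast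
      ultimately show "\<tau> \<in> ?Z" unfolding missed_def by blast
    qed
    have fin: "finite ?Z" by (rule finite_subset[of _ "{- int N..int N}"]) (auto simp: missed_def)
    have "inj_on (\<lambda>t. s * t) ?S" using ss by (auto simp: inj_on_def)
    then have "card ?S = card ((\<lambda>t. s * t) ` ?S)" by (rule card_image[symmetric])
    also have "\<dots> \<le> card ?Z" by (rule card_mono[OF fin sub])
    finally show "real (card ?S) \<le> C * real N powr (1 - \<epsilon>)" using C(3)[OF N] by linarith
  qed
qed

text \<open>A union over the finitely many residues modulo M ^ 10 that agree with some trace modulo
  M ^ 8. The local condition left over concerns M ^ 8 alone and holds for every admissible
  t.\<close>

lemma exceptional_traces_bound:
  obtains C \<epsilon> :: real where "C > 0" "\<epsilon> > 0"
    "\<And>N::nat. N \<ge> 1 \<Longrightarrow> real (card {t\<in>{- int N..int N}. (\<exists>\<gamma>\<in>H. [tr \<gamma> = t] (mod M ^ 8)) \<and> t \<notin> tr ` H})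
       \<le> C * real N powr (1 - \<epsilon>)"
proof -
  define Cl where "Cl = {t0\<in>{0..<M ^ 10}. \<exists>\<gamma>\<in>H. [tr \<gamma> = t0] (mod M ^ 8)}"
  have finCl: "finite Cl" by (rule finite_subset[of _ "{0..<M ^ 10}"]) (auto simp: Cl_def)
  define bound where "bound t0 C \<epsilon> \<longleftrightarrow> C > 0 \<and> \<epsilon> > 0 \<and> (\<forall>N::nat. N \<ge> 1 \<longrightarrow>
      real (card {t\<in>{- int N..int N}. [t = t0] (mod M ^ 10) \<and> t \<notin> tr ` H}) \<le> C * real N powr (1 - \<epsilon>))"
    for t0 and C \<epsilon> :: real
  have "\<exists>C \<epsilon>. bound t0 C \<epsilon>" if t0: "t0 \<in> Cl" for t0
  proof -
    obtain \<gamma> where \<gamma>: "\<gamma> \<in> H" "[tr \<gamma> = t0] (mod M ^ 8)" using t0 unfolding Cl_def by blast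
    show ?thesis unfolding bound_def by (rule class_bound[OF \<gamma>]) (intro exI conjI allI impI)
  qed
  then obtain C \<epsilon> where "\<And>t0. t0 \<in> Cl \<Longrightarrow> bound t0 (C t0) (\<epsilon> t0)" by metis
  note Ce = this[unfolded bound_def]
  \<comment> \<open>The inserted 1 keeps the set nonempty.\<close>
  define e where "e = Min (insert 1 (\<epsilon> ` Cl))"
  have e: "e > 0" "\<And>t0. t0 \<in> Cl \<Longrightarrow> e \<le> \<epsilon> t0" using finCl Ce by (auto simp: e_def)
  show thesis
  proof (rule that[of "1 + (\<Sum>t0\<in>Cl. C t0)" e])
    show "1 + (\<Sum>t0\<in>Cl. C t0) > 0" using Ce by (intro add_pos_nonneg sum_nonneg) (auto intro: less_imp_le)
    show "e > 0" by (rule e(1))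
    fix N :: nat assume N: "N \<ge> 1"
    let ?A = "{t\<in>{- int N..int N}. (\<exists>\<gamma>\<in>H. [tr \<gamma> = t] (mod M ^ 8)) \<and> t \<notin> tr ` H}"
    let ?B = "\<lambda>t0. {t\<in>{- int N..int N}. [t = t0] (mod M ^ 10) \<and> t \<notin> tr ` H}"
    have finB: "finite (?B t0)" for t0 by (rule finite_subset[of _ "{- int N..int N}"]) auto
    have "?A \<subseteq> (\<Union>t0\<in>Cl. ?B t0)"
    proof
      fix t assume t: "t \<in> ?A"
      then obtain \<gamma> where \<gamma>: "\<gamma> \<in> H" "[tr \<gamma> = t] (mod M ^ 8)" by blast
      have c: "[t = t mod M ^ 10] (mod M ^ 10)" by (simp add: cong_def)
      moreover have "M ^ 8 dvd M ^ 10" by (rule le_imp_power_dvd) simp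
      ultimately have "[t = t mod M ^ 10] (mod M ^ 8)" by (rule cong_dvd_modulus)
      then have "[tr \<gamma> = t mod M ^ 10] (mod M ^ 8)" using \<gamma>(2) cong_trans by blast
      moreover have "t mod M ^ 10 \<in> {0..<M ^ 10}" using M_pos by simp
      ultimately have "t mod M ^ 10 \<in> Cl" using \<gamma>(1) unfolding Cl_def by blast
      then show "t \<in> (\<Union>t0\<in>Cl. ?B t0)" using t c by blast
    qed
    then have "card ?A \<le> card (\<Union>t0\<in>Cl. ?B t0)" by (rule card_mono[OF finite_UN_I[OF finCl finB]])
    also have "\<dots> \<le> (\<Sum>t0\<in>Cl. card (?B t0))" by (rule card_UN_le[OF finCl])
    finally have "real (card ?A) \<le> (\<Sum>t0\<in>Cl. real (card (?B t0)))"
      by (simp only: of_nat_sum[symmetric] of_nat_le_iff)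
    also have "\<dots> \<le> (\<Sum>t0\<in>Cl. C t0 * real N powr (1 - e))"
    proof (rule sum_mono)
      fix t0 assume t0: "t0 \<in> Cl"
      have "real (card (?B t0)) \<le> C t0 * real N powr (1 - \<epsilon> t0)" using Ce[OF t0] N by blast
      also have "\<dots> \<le> C t0 * real N powr (1 - e)"
        using Ce[OF t0] e(2)[OF t0] N by (intro mult_left_mono powr_mono) auto
      finally show "real (card (?B t0)) \<le> C t0 * real N powr (1 - e)" .
    qed
    also have "\<dots> \<le> (1 + (\<Sum>t0\<in>Cl. C t0)) * real N powr (1 - e)"
      by (simp add: sum_distrib_right[symmetric] distrib_right)
    finally show "real (card ?A) \<le> (1 + (\<Sum>t0\<in>Cl. C t0)) * real N powr (1 - e)" .
  qed
qed

text \<open>V has trace 2 and lower left entry w * \<kappa> ^ 2, so 2 + m * w ^ 2 * \<kappa> ^ 2 is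
  a trace for every m. This positive density turns a count of exceptions into a bound for the
  ratio.\<close>

lemma many_traces:
  obtains D n0 :: nat where "D > 0"
    "\<And>n. n \<ge> n0 \<Longrightarrow> real n \<le> real (4 * D) * real (card {t\<in>{- int n..int n}. t \<in> tr ` H \<and> \<bar>t\<bar> > 2})"
proof -
  define D where "D = nat (w ^ 2 * \<kappa> ^ 2)"
  have Di: "int D = w ^ 2 * \<kappa> ^ 2" by (simp add: D_def)
  have D0: "D > 0" using w_pos \<kappa>_pos by (simp add: D_def)
  have tr: "2 + m * int D \<in> tr ` H" for m
    using trace_step(1)[OF H_V[of 1], of m] unfolding Di by (simp add: power2_eq_square algebra_simps)
  show thesis
  proof (rule that[of D "4 + 4 * D"])
    show "D > 0" by (rule D0)
    fix n assume n: "n \<ge> 4 + 4 * D"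
    let ?S = "{t\<in>{- int n..int n}. t \<in> tr ` H \<and> \<bar>t\<bar> > 2}"
    define k where "k = (n - 2) div D"
    have "k * D \<le> n - 2" by (simp add: k_def)
    then have kn: "int k * int D \<le> int n - 2" using n by (simp flip: of_nat_mult)
    have "(\<lambda>m. 2 + int m * int D) ` {1..k} \<subseteq> ?S"
    proof
      fix t assume "t \<in> (\<lambda>m. 2 + int m * int D) ` {1..k}"
      then obtain m where "t = 2 + int m * int D" "m \<in> {1..k}" by (elim imageE)
      then have m: "t = 2 + int m * int D" "1 \<le> m" "m \<le> k" by simp_all
      have "int m * int D \<le> int k * int D" using m by (intro mult_right_mono) auto
      then have "t \<le> int n" using m(1) kn by linarith
      moreover have "int m * int D > 0" using m D0 by simp
      ultimately show "t \<in> ?S" using m(1) tr[of "int m"] by auto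
    qed
    moreover have "finite ?S" by (rule finite_subset[of _ "{- int n..int n}"]) auto
    ultimately have "card ((\<lambda>m. 2 + int m * int D) ` {1..k}) \<le> card ?S" by (intro card_mono)
    moreover have "card ((\<lambda>m. 2 + int m * int D) ` {1..k}) = k"
      using D0 by (subst card_image) (auto simp: inj_on_def)
    ultimately have "k \<le> card ?S" by simp
    moreover have "n - 2 < (k + 1) * D" unfolding k_def using dividend_less_div_times[OF D0, of "n - 2"] by simp
    then have "n \<le> 4 * D * k"
    proof -
      have "k * D + D + 2 > n" using \<open>n - 2 < (k + 1) * D\<close> n by (simp add: algebra_simps)
      then have "k * D \<ge> 3 * D" using n by linarith
      then show ?thesis using \<open>k * D + D + 2 > n\<close> n by (simp add: algebra_simps)
    qed
    ultimately have "n \<le> 4 * D * card ?S" by (meson le_trans mult_le_mono2)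
    then have "real n \<le> real (4 * D * card ?S)" by (simp only: of_nat_le_iff)
    then show "real n \<le> real (4 * D) * real (card ?S)" by (simp only: of_nat_mult)
  qed
qed

end

section \<open>From subgroups of SL2 to groups with a cusp\<close>

definition quad :: "int ^ 2 ^ 2 \<Rightarrow> mat2" where
  "quad A = (A $ 1 $ 1, A $ 1 $ 2, A $ 2 $ 1, A $ 2 $ 2)"

lemma quad_mult: "quad (A ** B) = mm (quad A) (quad B)"
  by (simp add: quad_def matrix_matrix_mult_def sum_2)

lemma tr_quad: "tr (quad A) = trace A"
  by (simp add: quad_def trace_def sum_2)

lemma quad_det: "quad A = (a, b, c, d) \<Longrightarrow> det A = a * d - b * c"
  by (auto simp: quad_def det_2)

lemma mm_assoc: "mm (mm x y) z = mm x (mm y z)"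
  by (cases x; cases y; cases z) (simp add: algebra_simps)

text \<open>A nilpotent A - 1 has determinant 0, and for det A = 1 this determinant is 2 - trace
  A.\<close>

lemma parabolic_trace:
  assumes "parabolic A" "det A = 1"
  shows "A $ 1 $ 1 + A $ 2 $ 2 = 2"
proof -
  obtain k where k: "(((**) (A - mat 1)) ^^ k) (mat 1) = 0"
    using assms by (auto simp: parabolic_def unipotent_def)
  have "det ((((**) (A - mat 1)) ^^ k) (mat 1)) = det (A - mat 1) ^ k"
    by (induction k) (simp_all add: det_mul)
  then have "det (A - mat 1) ^ k = 0" unfolding k by (simp add: det_2)
  then have "det (A - mat 1) = 0" by simp
  then show ?thesis using assms(2) by (simp add: det_2 mat_def algebra_simps)
qed

text \<open>The matrix with rows x, y and z, -x has square zero, so its first column lies in the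
  kernel and is divided by its gcd; if that column is zero, (1, 0) serves.\<close>

lemma nilpotent_kernel_vector:
  fixes x y z :: int
  assumes "x * x + y * z = 0"
  obtains u1 u2 where "coprime u1 u2" "x * u1 + y * u2 = 0" "z * u1 - x * u2 = 0"
proof (cases "x = 0 \<and> z = 0")
  case True
  then show ?thesis using that[of 1 0] by simp
next
  case False
  define g where "g = gcd x z"
  have g: "g \<noteq> 0" using False by (simp add: g_def)
  obtain u1 u2 where u: "x = g * u1" "z = g * u2"
    unfolding g_def by (meson dvdE gcd_dvd1 gcd_dvd2)
  have "coprime u1 u2" using div_gcd_coprime[of x z] False g u unfolding g_def[symmetric] by simp
  moreover have "g * (x * u1 + y * u2) = 0" using assms u by (simp add: algebra_simps)
  then have "x * u1 + y * u2 = 0" using g by simp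
  moreover have "z * u1 - x * u2 = 0" by (simp add: u)
  ultimately show ?thesis by (rule that)
qed

text \<open>The expression is a polynomial in A that vanishes exactly when A preserves the line
  through (u1, u2). Vanishing on \<Gamma> would extend to SL2 over the complex numbers, where the
  two elementary unipotents force u1 = 0 and u2 = 0.\<close>

lemma zariski_dense_not_fixing:
  fixes u1 u2 :: int
  assumes dense: "zariski_dense_SL2 \<Gamma>" and cop: "coprime u1 u2"
  obtains A where "A \<in> \<Gamma>" "u1 * (A $ 2 $ 1 * u1 + A $ 2 $ 2 * u2) - u2 * (A $ 1 $ 1 * u1 + A $ 1 $ 2 * u2) \<noteq> 0"
proof -
  define f :: "complex ^ 2 ^ 2 \<Rightarrow> complex" where
    "f A = of_int u1 * (A $ 2 $ 1 * of_int u1 + A $ 2 $ 2 * of_int u2)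
         + (- of_int u2) * (A $ 1 $ 1 * of_int u1 + A $ 1 $ 2 * of_int u2)" for A
  have poly: "matrix_polynomial f" unfolding f_def by (intro matrix_polynomial.intros)
  have "\<exists>A\<in>\<Gamma>. f (map_matrix of_int A) \<noteq> 0"
  proof (rule ccontr)
    assume "\<not> ?thesis"
    then have "map_matrix of_int ` \<Gamma> \<subseteq> {A. f A = 0}" by auto
    moreover have "zariski_closed {A. f A = 0}"
      unfolding zariski_closed_def using poly by (intro exI[of _ "{f}"]) auto
    ultimately have "zariski_closure (map_matrix of_int ` \<Gamma>) \<subseteq> {A. f A = 0}"
      by (auto simp: zariski_closure_def)
    then have all: "f A = 0" if "det A = 1" for A
      using dense that by (auto simp: zariski_dense_SL2_def SL2_def)
    have "f (\<chi> i j. if i = 1 \<and> j = 2 then 0 else 1) = 0" by (rule all) (simp add: det_2)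
    then have "u1 = 0" by (simp add: f_def algebra_simps)
    have "f (\<chi> i j. if i = 2 \<and> j = 1 then 0 else 1) = 0" by (rule all) (simp add: det_2)
    then have "u2 = 0" by (simp add: f_def algebra_simps)
    then show False using \<open>u1 = 0\<close> cop by simp
  qed
  then obtain A where A: "A \<in> \<Gamma>" "f (map_matrix of_int A) \<noteq> 0" by blast
  have "f (map_matrix of_int A) = of_int (u1 * (A $ 2 $ 1 * u1 + A $ 2 $ 2 * u2) - u2 * (A $ 1 $ 1 * u1 + A $ 1 $ 2 * u2))"
    by (simp add: f_def map_matrix_def)
  then show thesis using that[OF A(1)] A(2) by (metis of_int_0)
qed

text \<open>Conjugation by an integral matrix of determinant 1 whose first column is a primitive
  fixed vector of the parabolic keeps entries integral and traces unchanged. The second cusp is the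
  image of infinity under an element not fixing infinity, which density provides.\<close>

lemma cusp_group_exists:
  fixes \<Gamma> :: "(int ^ 2 ^ 2) set"
  assumes sub: "subgroup \<Gamma> SL2" and dense: "zariski_dense_SL2 \<Gamma>" and par: "\<exists>A\<in>\<Gamma>. parabolic A"
  obtains H w r \<kappa> where "cusp_group H w r \<kappa>" "tr ` H = trace ` \<Gamma>"
proof -
  have mult: "A ** B \<in> \<Gamma>" if "A \<in> \<Gamma>" "B \<in> \<Gamma>" for A B
    using subgroup.m_closed[OF sub that] by (simp add: SL2_def)
  have det1: "det A = 1" if "A \<in> \<Gamma>" for A
    using subgroup.subset[OF sub] that by (auto simp: SL2_def)
  have inv: "\<exists>B\<in>\<Gamma>. quad B = (d, - b, - c, a)" if A: "A \<in> \<Gamma>" and q: "quad A = (a, b, c, d)" for A a b c d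
  proof
    let ?B = "inv\<^bsub>SL2\<^esub> A"
    show B: "?B \<in> \<Gamma>" by (rule subgroup.m_inv_closed[OF sub A])
    have "A \<in> carrier SL2" using subgroup.subset[OF sub] A by blast
    then have "?B ** A = mat 1" using group.l_inv[OF group_SL2] by (simp add: SL2_def)
    then have "mm (quad ?B) (a, b, c, d) = (1, 0, 0, 1)"
      unfolding q[symmetric] quad_mult[symmetric] by (simp add: quad_def mat_def)
    moreover have "a * d - b * c = 1" using quad_det[OF q] det1[OF A] by simp
    then have "mm (a, b, c, d) (d, - b, - c, a) = (1, 0, 0, 1)" by (simp add: algebra_simps)
    ultimately have "mm (quad ?B) (1, 0, 0, 1) = mm (1, 0, 0, 1) (d, - b, - c, a)"
      by (metis mm_assoc)
    then show "quad ?B = (d, - b, - c, a)" by (cases "quad ?B") simp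
  qed
  obtain A where A: "A \<in> \<Gamma>" "parabolic A" using par by blast
  obtain a b c d where q: "quad A = (a, b, c, d)" by (metis prod_cases4)
  have tr2: "a + d = 2" using parabolic_trace[OF A(2) det1[OF A(1)]] q by (auto simp: quad_def)
  have dA: "a * d - b * c = 1" using quad_det[OF q] det1[OF A(1)] by simp
  define x where "x = a - 1"
  have ad: "a = 1 + x" "d = 1 - x" using tr2 by (auto simp: x_def)
  have nil: "x * x + b * c = 0" using dA unfolding ad by (simp add: algebra_simps)
  obtain u1 u2 where u: "coprime u1 u2" "x * u1 + b * u2 = 0" "c * u1 - x * u2 = 0"
    using nilpotent_kernel_vector[OF nil] by blast
  \<comment> \<open>Bezout coefficients complete (u1, u2) to a matrix of determinant 1.\<close>
  obtain y1 y2 where y: "y1 * u1 + y2 * u2 = 1"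
    using bezout_int[of u1 u2] u(1) by auto
  define cj where "cj X = mm (mm (y1, y2, - u2, u1) X) (u1, - y2, u2, y1)" for X
  define H where "H = cj ` quad ` \<Gamma>"
  have g1: "mm (u1, - y2, u2, y1) (y1, y2, - u2, u1) = (1, 0, 0, 1)" using y by (simp add: algebra_simps)
  have cj_mult: "mm (cj X) (cj Z) = cj (mm X Z)" for X Z
  proof -
    have "mm (cj X) (cj Z) = mm (mm (y1, y2, - u2, u1) X)
        (mm (mm (u1, - y2, u2, y1) (y1, y2, - u2, u1)) (mm Z (u1, - y2, u2, y1)))"
      by (simp only: cj_def mm_assoc)
    also have "\<dots> = cj (mm X Z)" unfolding g1 by (cases Z) (simp add: cj_def mm_assoc del: mm.simps, simp)
    finally show ?thesis .
  qed
  have cj_tr: "tr (cj X) = tr X" for X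
  proof -
    obtain p q r s where X: "X = (p, q, r, s)" by (metis prod_cases4)
    have "tr (cj X) = (y1 * u1 + y2 * u2) * (p + s)" by (simp add: cj_def X algebra_simps)
    then show ?thesis using y X by simp
  qed
  have cj_det: "a' * d' - b' * c' = p * s - q * r" if "cj (p, q, r, s) = (a', b', c', d')" for a' b' c' d' p q r s
  proof -
    have eqs: "a' = (y1 * p + y2 * r) * u1 + (y1 * q + y2 * s) * u2" "b' = - (y1 * p + y2 * r) * y2 + (y1 * q + y2 * s) * y1"
      "c' = (u1 * r - u2 * p) * u1 + (u1 * s - u2 * q) * u2" "d' = - (u1 * r - u2 * p) * y2 + (u1 * s - u2 * q) * y1"
      using that by (auto simp: cj_def algebra_simps)
    have "a' * d' - b' * c' = (y1 * u1 + y2 * u2) ^ 2 * (p * s - q * r)"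
      unfolding eqs by (simp add: algebra_simps power2_eq_square)
    then show ?thesis using y by simp
  qed
  have H_mult: "mm X Z \<in> H" if "X \<in> H" "Z \<in> H" for X Z
    using that mult unfolding H_def by (auto simp: cj_mult simp flip: quad_mult)
  have H_det: "a' * d' - b' * c' = 1" if X: "(a', b', c', d') \<in> H" for a' b' c' d'
  proof -
    obtain C where C: "C \<in> \<Gamma>" "(a', b', c', d') = cj (quad C)" using X unfolding H_def by blast
    obtain p q r s where pq: "quad C = (p, q, r, s)" by (metis prod_cases4)
    then show ?thesis using cj_det[of p q r s] C quad_det[OF pq] det1[OF C(1)] by simp
  qed
  have H_inv: "(d', - b', - c', a') \<in> H" if X: "(a', b', c', d') \<in> H" for a' b' c' d'
  proof -
    obtain C where C: "C \<in> \<Gamma>" "(a', b', c', d') = cj (quad C)" using X unfolding H_def by blast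
    obtain p q r s where pq: "quad C = (p, q, r, s)" by (metis prod_cases4)
    obtain D where D: "D \<in> \<Gamma>" "quad D = (s, - q, - r, p)" using inv[OF C(1) pq] by blast
    have "cj (quad D) = (d', - b', - c', a')"
      using C(2) by (auto simp: D(2) pq cj_def algebra_simps)
    then show ?thesis using D(1) unfolding H_def by (metis imageI)
  qed
  have unip: "cj (a, b, c, d) = (1, y1 * (b * y1 - x * y2) - y2 * (x * y1 + c * y2), 0, 1)"
  proof -
    have c1: "a * u1 + b * u2 = u1" "c * u1 + d * u2 = u2" using u unfolding ad by (simp_all add: algebra_simps)
    have "cj (a, b, c, d) = (y1 * (a * u1 + b * u2) + y2 * (c * u1 + d * u2),
        - y2 * (y1 * a + y2 * c) + y1 * (y1 * b + y2 * d),
        u1 * (c * u1 + d * u2) - u2 * (a * u1 + b * u2), - y2 * (u1 * c - u2 * a) + y1 * (u1 * d - u2 * b))"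
      by (simp add: cj_def algebra_simps)
    moreover have "- y2 * (u1 * c - u2 * a) + y1 * (u1 * d - u2 * b)
       = (y1 * u1 + y2 * u2) * (a + d) - (y1 * (a * u1 + b * u2) + y2 * (c * u1 + d * u2))" by (simp add: algebra_simps)
    ultimately show ?thesis unfolding c1 tr2 using y by (simp add: ad algebra_simps)
  qed
  define w0 where "w0 = y1 * (b * y1 - x * y2) - y2 * (x * y1 + c * y2)"
  have U0: "(1, w0, 0, 1) \<in> H" using unip A(1) q unfolding H_def w0_def by (metis imageI)
  have w0: "w0 \<noteq> 0"
  proof
    assume "w0 = 0"
    then have cj1: "cj (a, b, c, d) = (1, 0, 0, 1)" using unip by (simp add: w0_def)
    have "(a, b, c, d) = mm (mm (mm (u1, - y2, u2, y1) (y1, y2, - u2, u1)) (a, b, c, d)) (mm (u1, - y2, u2, y1) (y1, y2, - u2, u1))"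
      unfolding g1 by simp
    also have "\<dots> = mm (mm (u1, - y2, u2, y1) (cj (a, b, c, d))) (y1, y2, - u2, u1)"
      unfolding cj_def by (simp only: mm_assoc)
    also have "\<dots> = (1, 0, 0, 1)" unfolding cj1 using y by (simp add: algebra_simps)
    finally have "A = mat 1" using q by (simp add: quad_def vec_eq_iff forall_2 mat_def)
    then show False using A(2) by (simp add: parabolic_def)
  qed
  define w where "w = \<bar>w0\<bar>"
  have w_pos: "w > 0" using w0 by (simp add: w_def)
  have U1: "(1, w, 0, 1) \<in> H" "(1, - w, 0, 1) \<in> H"
    using U0 H_inv[OF U0] by (cases "w0 > 0"; simp add: w_def)+
  have one: "(1, 0, 0, 1) \<in> H" using H_mult[OF U1] by simp
  have Un: "(1, int n * w, 0, 1) \<in> H \<and> (1, - int n * w, 0, 1) \<in> H" for n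
  proof (induction n)
    case (Suc n)
    then show ?case using H_mult[OF _ U1(1), of "(1, int n * w, 0, 1)"] H_mult[OF _ U1(2), of "(1, - int n * w, 0, 1)"]
      by (simp add: algebra_simps)
  qed (simp add: one)
  have U: "(1, n * w, 0, 1) \<in> H" for n
    using Un[of "nat \<bar>n\<bar>"] by (cases "n \<ge> 0") auto
  obtain C where C: "C \<in> \<Gamma>" "u1 * (C $ 2 $ 1 * u1 + C $ 2 $ 2 * u2) - u2 * (C $ 1 $ 1 * u1 + C $ 1 $ 2 * u2) \<noteq> 0"
    using zariski_dense_not_fixing[OF dense u(1)] by blast
  obtain p0 q0 r0 s0 where g0: "cj (quad C) = (p0, q0, r0, s0)" by (metis prod_cases4)
  have "r0 = u1 * (C $ 2 $ 1 * u1 + C $ 2 $ 2 * u2) - u2 * (C $ 1 $ 1 * u1 + C $ 1 $ 2 * u2)"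
    using g0 by (auto simp: cj_def quad_def algebra_simps)
  then have r0: "r0 \<noteq> 0" using C(2) by simp
  have gH: "(p0, q0, r0, s0) \<in> H" using C(1) g0 unfolding H_def by (metis imageI)
  \<comment> \<open>Passing to the inverse changes the sign of the lower left entry.\<close>
  obtain r \<beta> \<kappa> \<delta> where g: "(r, \<beta>, \<kappa>, \<delta>) \<in> H" "\<kappa> > 0"
  proof (cases "r0 > 0")
    case True
    then show ?thesis using that gH by blast
  next
    case False
    then show ?thesis using that[OF H_inv[OF gH]] r0 by simp
  qed
  have V: "(1 + n * w * r * \<kappa>, - (n * w * r ^ 2), n * w * \<kappa> ^ 2, 1 - n * w * r * \<kappa>) \<in> H" for n
  proof -
    \<comment> \<open>V^n is the conjugate of U^(- n); this sign gives the lower left entry n * w *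
      \<kappa> ^ 2.\<close>
    have "mm (mm (r, \<beta>, \<kappa>, \<delta>) (1, (- n) * w, 0, 1)) (\<delta>, - \<beta>, - \<kappa>, r) \<in> H"
      by (intro H_mult g(1) U H_inv)
    moreover have "r * \<delta> - \<beta> * \<kappa> = 1" by (rule H_det[OF g(1)])
    then have "r * \<delta> = 1 + \<beta> * \<kappa>" by simp
    ultimately show ?thesis by (simp add: algebra_simps power2_eq_square)
  qed
  have "cusp_group H w r \<kappa>" by unfold_locales (use H_mult H_det U V w_pos g(2) in blast)+
  moreover have "tr ` H = trace ` \<Gamma>" unfolding H_def image_image by (simp add: cj_tr tr_quad)
  ultimately show thesis by (rule that)
qed

section \<open>From exceptional traces to the saturation ratio\<close>

theorem theorem1p4:
  fixes \<Gamma> :: "(int ^ 2 ^ 2) set"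
  assumes "subgroup \<Gamma> SL2"
    and "zariski_dense_SL2 \<Gamma>"
    and "\<exists>A\<in>\<Gamma>. parabolic A"
  shows "asymptotically_length_saturating \<Gamma> \<and>
    (\<exists>\<epsilon>>0. (\<lambda>N. saturation_ratio \<Gamma> N - 1) \<in> O[at_top](\<lambda>N. N powr (- \<epsilon>)))"
proof -
  obtain H w r \<kappa> where cg: "cusp_group H w r \<kappa>" and trH: "tr ` H = trace ` \<Gamma>"
    using cusp_group_exists[OF assms] by blast
  interpret cusp_group H w r \<kappa> by (rule cg)
  obtain C \<epsilon> where C: "C > 0" "\<epsilon> > 0" and exc: "\<And>N::nat. N \<ge> 1 \<Longrightarrow>
      real (card {t\<in>{- int N..int N}. (\<exists>\<gamma>\<in>H. [tr \<gamma> = t] (mod M ^ 8)) \<and> t \<notin> tr ` H}) \<le> C * real N powr (1 - \<epsilon>)"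
    by (rule exceptional_traces_bound) (rule that)
  obtain D n0 :: nat where D: "D > 0" and many: "\<And>n. n \<ge> n0 \<Longrightarrow>
      real n \<le> real (4 * D) * real (card {t\<in>{- int n..int n}. t \<in> tr ` H \<and> \<bar>t\<bar> > 2})"
    by (rule many_traces) (rule that)
  \<comment> \<open>The cap at 1 lets the constant 5 below be absorbed by n powr (1 - e).\<close>
  define e where "e = min \<epsilon> 1"
  have e: "e > 0" "e \<le> 1" "e \<le> \<epsilon>" using C(2) by (auto simp: e_def)
  define C' where "C' = real (4 * D) * (5 + C) * 2"
  have ts: "trace_set \<Gamma> = {t. t \<in> tr ` H \<and> \<bar>t\<bar> > 2}"
    unfolding trH trace_set_def hyperbolic_def by auto
  have adm: "admissible \<Gamma> t" if "t \<in> trace_set \<Gamma>" for t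
    unfolding admissible_def using that cong_refl by blast
  have main: "\<bar>saturation_ratio \<Gamma> N - 1\<bar> \<le> C' * N powr (- e)" if N: "N \<ge> real n0 + 2" for N
  proof -
    define n where "n = nat \<lfloor>N\<rfloor>"
    have nN: "real n \<le> N" "N < real n + 1" using N by (simp_all add: n_def)
    have n2: "n \<ge> 2" "n \<ge> n0" using N nN by linarith+
    have iff: "real_of_int t \<in> {- N..N} \<longleftrightarrow> t \<in> {- int n..int n}" for t
      using nN by auto
    let ?T = "{t \<in> trace_set \<Gamma>. t \<in> {- int n..int n}}"
    let ?A = "{t. t \<in> {- int n..int n} \<and> admissible \<Gamma> t}"
    have fin: "finite ?A" by (rule finite_subset[of _ "{- int n..int n}"]) auto
    have sub: "?T \<subseteq> ?A" using adm by auto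
    have ratio: "saturation_ratio \<Gamma> N = real (card ?T) / real (card ?A)"
      by (simp only: saturation_ratio_def iff)
    have "?T = {t\<in>{- int n..int n}. t \<in> tr ` H \<and> \<bar>t\<bar> > 2}" unfolding ts by auto
    then have T_ge: "real n \<le> real (4 * D) * real (card ?T)" using many[OF n2(2)] by simp
    have TA: "card ?T \<le> card ?A" by (rule card_mono[OF fin sub])
    then have A_ge: "real n \<le> real (4 * D) * real (card ?A)"
      using T_ge by (meson mult_left_mono of_nat_0_le_iff of_nat_mono order_trans)
    have A0: "real (card ?A) > 0"
    proof (rule ccontr)
      assume "\<not> ?thesis"
      then have "real (card ?A) = 0" by simp
      then show False using A_ge n2 by simp
    qed
    let ?E = "{t\<in>{- int n..int n}. (\<exists>\<gamma>\<in>H. [tr \<gamma> = t] (mod M ^ 8)) \<and> t \<notin> tr ` H}"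
    \<comment> \<open>An admissible t outside \<open>trace_set\<close> is either exceptional or lies
      in the range \<bar>t\<bar> \<le> 2 that hyperbolicity removes from the traces.\<close>
    have "?A - ?T \<subseteq> {-2..2} \<union> ?E"
    proof
      fix t assume t: "t \<in> ?A - ?T"
      show "t \<in> {-2..2} \<union> ?E"
      proof (cases "\<bar>t\<bar> \<le> 2")
        case False
        then have "t \<notin> tr ` H" using t by (auto simp: ts)
        moreover have "M ^ 8 \<ge> 1" using M_pos by (simp add: int_one_le_iff_zero_less)
        then obtain s where "s \<in> trace_set \<Gamma>" "[s = t] (mod M ^ 8)"
          using t unfolding admissible_def by blast
        then have "\<exists>\<gamma>\<in>H. [tr \<gamma> = t] (mod M ^ 8)" unfolding ts by blast
        ultimately show ?thesis using t by blast
      qed auto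
    qed
    moreover have "finite ({-2..2} \<union> ?E)"
      by (intro finite_UnI finite_atLeastAtMost_int finite_subset[of ?E "{- int n..int n}"]) auto
    ultimately have "card (?A - ?T) \<le> card ({-2..2} \<union> ?E)" by (intro card_mono)
    also have "\<dots> \<le> card {-2..2::int} + card ?E" by (rule card_Un_le)
    finally have "real (card (?A - ?T)) \<le> 5 + real (card ?E)" by simp
    also have "\<dots> \<le> 5 * real n powr (1 - e) + C * real n powr (1 - e)"
    proof (rule add_mono)
      show "5 \<le> 5 * real n powr (1 - e)" using n2 e by (simp add: ge_one_powr_ge_zero)
      have "real (card ?E) \<le> C * real n powr (1 - \<epsilon>)" using exc[of n] n2 by simp
      also have "\<dots> \<le> C * real n powr (1 - e)" using C(1) e n2 by (intro mult_left_mono powr_mono) auto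
      finally show "real (card ?E) \<le> C * real n powr (1 - e)" .
    qed
    finally have E: "real (card (?A - ?T)) \<le> (5 + C) * real n powr (1 - e)" by (simp add: distrib_right)
    have "card (?A - ?T) = card ?A - card ?T" by (rule card_Diff_subset[OF finite_subset[OF sub fin] sub])
    then have "real (card ?A) - real (card ?T) = real (card (?A - ?T))" using TA by simp
    then have "saturation_ratio \<Gamma> N - 1 = - (real (card (?A - ?T)) / real (card ?A))"
      unfolding ratio using A0 by (simp add: field_simps)
    then have "\<bar>saturation_ratio \<Gamma> N - 1\<bar> = real (card (?A - ?T)) / real (card ?A)"
      by simp
    also have "\<dots> \<le> ((5 + C) * real n powr (1 - e)) / (real n / real (4 * D))"
    proof (rule frac_le[OF _ E])
      show "real n / real (4 * D) > 0" using n2 D by simp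
      show "real n / real (4 * D) \<le> real (card ?A)" using A_ge D by (simp add: field_simps)
    qed (use C(1) in simp)
    also have "\<dots> = real (4 * D) * (5 + C) * (real n powr (1 - e) / real n powr 1)" using n2 D by simp
    also have "real n powr (1 - e) / real n powr 1 = real n powr (- e)"
      by (subst powr_diff[symmetric]) simp
    also have "real (4 * D) * (5 + C) * real n powr (- e) \<le> real (4 * D) * (5 + C) * (2 * N powr (- e))"
    proof (rule mult_left_mono)
      have "N / 2 \<le> real n" using nN n2 by simp
      then have "real n powr (- e) \<le> (N / 2) powr (- e)" using N e by (intro powr_mono2') auto
      also have "\<dots> = 2 powr e * N powr (- e)"
        using N by (simp add: powr_divide powr_minus_divide)
      also have "\<dots> \<le> 2 powr 1 * N powr (- e)" using e by (intro mult_right_mono powr_mono) auto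
      finally show "real n powr (- e) \<le> 2 * N powr (- e)" by simp
    qed (use C(1) in simp)
    also have "\<dots> = C' * N powr (- e)" by (simp add: C'_def)
    finally show ?thesis .
  qed
  have ev: "eventually (\<lambda>N. \<bar>saturation_ratio \<Gamma> N - 1\<bar> \<le> C' * N powr (- e)) at_top"
    using eventually_ge_at_top[of "real n0 + 2"] by eventually_elim (rule main)
  have bigo: "(\<lambda>N. saturation_ratio \<Gamma> N - 1) \<in> O[at_top](\<lambda>N. N powr (- e))"
    by (rule bigoI[of _ C']) (use ev in \<open>simp add: eventually_mono\<close>)
  have "((\<lambda>N. C' * N powr (- e)) \<longlongrightarrow> C' * 0) at_top"
    using e by (intro tendsto_mult tendsto_const tendsto_neg_powr filterlim_ident) auto
  then have lim0: "((\<lambda>N. C' * N powr (- e)) \<longlongrightarrow> 0) at_top" by simp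
  have "((\<lambda>N. saturation_ratio \<Gamma> N - 1) \<longlongrightarrow> 0) at_top"
    by (rule Lim_null_comparison[OF _ lim0]) (use ev in \<open>simp only: real_norm_def\<close>)
  then have "(saturation_ratio \<Gamma> \<longlongrightarrow> 1) at_top" by (subst (asm) LIM_zero_iff)
  then show ?thesis using bigo e(1) unfolding asymptotically_length_saturating_def by blast
qed

end
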